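(* Let $k$ be an infinite field of arbitrary characteristic, let $I$ be an arbitrary homogeneous ideal in $R=k[x_1,\ldots,x_n]$, and let $d=\dim R/I\ge 1$. Let $a_1\ge a_2\ge\cdots\ge a_s$ be the degrees of the minimal homogeneous generators of $I$. Then: (i) $r(R/I^{lex})\le d\left[\displaystyle\binom{r(R/I)+n-d}{n-d}-2\right]+1$; (ii) $r(R/I^{lex})\le d\,(a_1\cdots a_{n-d}-2)+1$.
   Context: A lex-segment ideal is a monomial ideal $J$ of $R$ such that if a monomial $x^A$ is in $J$, then $x^B\in J$ for every monomial $x^B$ of the same degree with $x^B\ge x^A$ in the lexicographic order (with $x_1>x_2>\cdots>x_n$). For a homogeneous ideal $I$, $I^{lex}$ denotes the unique lex-segment ideal whose Hilbert function equals that of $I$. Let $A$ be a standard graded algebra over $k$ of dimension $d$. An ideal $\mathfrak q=(z_1,\ldots,z_d)$ generated by $d$ linear forms of $A$ is called a $d$-reduction of $A$ if $\mathfrak q_t=A_t$ for all $t$ large enough. Its reduction number $r_{\mathfrak q}(A)$ is the minimum integer $r\ge 0$ such that $\mathfrak q_{r+1}=A_{r+1}$. The reduction number of $A$ is $r(A)=r_d(A)=\min\{r_{\mathfrak q}(A)\mid \mathfrak q=(z_1,\ldots,z_d)\text{ is a reduction of }A\}$. (Note $\dim R/I^{lex}=\dim R/I=d$.)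
   Formalization: If d ≥ 2, some minimal generator of I is required to have degree at least 2: for I = 0 or I generated by linear forms, r(R/I) = 0, the binomial and the product are 1, and both bounds equal 1 − d < 0, so the claim is false there. *)

theory Defs
  imports Complex_Main "HOL-Library.Poly_Mapping" "HOL-Library.Extended_Nat" "HOL-Algebra.QuotRing"
begin

section \<open>The graded polynomial ring in n variables\<close>

text \<open>Exponent vectors are finitely supported functions \<open>nat \<Rightarrow>\<^sub>0 nat\<close> and polynomials are finitely
  supported functions on exponent vectors, multiplied by convolution. The ring
  \<open>k[x\<^sub>1, \<dots>, x\<^sub>n]\<close> is the subring of polynomials in which only the variables with index \<open>< n\<close>
  occur; the index \<open>i\<close> stands for \<open>x\<^bsub>i+1\<^esub>\<close>.\<close>

type_synonym 'k mpoly = "(nat \<Rightarrow>\<^sub>0 nat) \<Rightarrow>\<^sub>0 'k"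

definition exponents :: "nat \<Rightarrow> (nat \<Rightarrow>\<^sub>0 nat) set" where
  "exponents n = {m. Poly_Mapping.keys m \<subseteq> {..<n}}"

definition poly_ring :: "nat \<Rightarrow> ('k::field) mpoly ring" where
  "poly_ring n = \<lparr>carrier = {f. Poly_Mapping.keys f \<subseteq> exponents n}, mult = (*), one = 1, zero = 0, add = (+)\<rparr>"

definition monomial :: "(nat \<Rightarrow>\<^sub>0 nat) \<Rightarrow> ('k::field) mpoly" where
  "monomial m = Poly_Mapping.single m 1"

definition mdeg :: "(nat \<Rightarrow>\<^sub>0 nat) \<Rightarrow> nat" where
  "mdeg m = (\<Sum>i\<in>Poly_Mapping.keys m. Poly_Mapping.lookup m i)"

text \<open>The component \<open>R\<^sub>t\<close>: homogeneous polynomials of degree \<open>t\<close>, including \<open>0\<close>.\<close>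

definition forms :: "nat \<Rightarrow> nat \<Rightarrow> ('k::field) mpoly set" where
  "forms n t = {f \<in> carrier (poly_ring n). \<forall>m\<in>Poly_Mapping.keys f. mdeg m = t}"

definition homogeneous_ideal :: "nat \<Rightarrow> ('k::field) mpoly set \<Rightarrow> bool" where
  "homogeneous_ideal n I \<longleftrightarrow> (\<exists>S \<subseteq> (\<Union>t. forms n t). I = Idl\<^bsub>poly_ring n\<^esub> S)"

text \<open>Total degree, meaningful for nonzero polynomials only. This is no restriction for minimal
  generators, since \<open>0\<close> is never a member of a minimal generating set.\<close>

definition tdeg :: "('k::field) mpoly \<Rightarrow> nat" where
  "tdeg f = Max (mdeg ` Poly_Mapping.keys f)"

definition minimal_homogeneous_generators :: "nat \<Rightarrow> ('k::field) mpoly set \<Rightarrow> 'k mpoly list \<Rightarrow> bool" where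
  "minimal_homogeneous_generators n I fs \<longleftrightarrow>
     distinct fs \<and> set fs \<subseteq> (\<Union>t. forms n t) \<and> I = Idl\<^bsub>poly_ring n\<^esub> (set fs) \<and>
     (\<forall>S. S \<subset> set fs \<longrightarrow> I \<noteq> Idl\<^bsub>poly_ring n\<^esub> S)"

lemma exponents_0: "0 \<in> exponents n"
  by (simp add: exponents_def)

lemma exponents_add: "a \<in> exponents n \<Longrightarrow> b \<in> exponents n \<Longrightarrow> a + b \<in> exponents n"
  using keys_add[of a b] by (auto simp: exponents_def)

lemma poly_ring_cring: "cring (poly_ring n :: ('k::field) mpoly ring)"
proof -
  let ?R = "poly_ring n :: 'k mpoly ring"
  have add: "x + y \<in> carrier ?R" if "x \<in> carrier ?R" "y \<in> carrier ?R" for x y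
    using that keys_add[of x y] by (auto simp: poly_ring_def)
  have mul: "x * y \<in> carrier ?R" if "x \<in> carrier ?R" "y \<in> carrier ?R" for x y
    using that keys_mult[of x y] by (fastforce simp: poly_ring_def intro: exponents_add)
  have neg: "\<exists>y\<in>carrier ?R. y + x = 0" if "x \<in> carrier ?R" for x
    using that by (intro bexI[of _ "- x"]) (auto simp: poly_ring_def)
  show ?thesis
  proof (rule cringI)
    show "abelian_group ?R"
      by (rule abelian_groupI)
        (use add neg in \<open>auto simp: poly_ring_def algebra_simps\<close>)
    show "comm_monoid ?R"
      by (rule comm_monoidI)
        (use mul exponents_0[of n] in \<open>auto simp: poly_ring_def algebra_simps\<close>)
  qed (simp add: poly_ring_def algebra_simps)
qed

section \<open>Hilbert functions and lex-segment ideals\<close>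

definition scale :: "'k \<Rightarrow> ('k::field) mpoly \<Rightarrow> 'k mpoly" where
  "scale c f = Poly_Mapping.single 0 c * f"

global_interpretation mpoly_space: vector_space scale
  by standard (simp_all add: scale_def single_add algebra_simps mult_single flip: mult.assoc)

text \<open>Equality of Hilbert functions is the same for \<open>I\<close> and \<open>R/I\<close>, because
  \<open>dim I\<^sub>t + dim (R/I)\<^sub>t = dim R\<^sub>t < \<infinity>\<close>.\<close>

definition hilbert_function :: "nat \<Rightarrow> ('k::field) mpoly set \<Rightarrow> nat \<Rightarrow> nat" where
  "hilbert_function n I t = mpoly_space.dim (I \<inter> forms n t)"

definition monomial_ideal :: "nat \<Rightarrow> ('k::field) mpoly set \<Rightarrow> bool" where
  "monomial_ideal n J \<longleftrightarrow> (\<exists>M \<subseteq> exponents n. J = Idl\<^bsub>poly_ring n\<^esub> (monomial ` M))"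

text \<open>The library order on \<open>nat \<Rightarrow>\<^sub>0 nat\<close> is decided at the least index where two exponent vectors
  differ; hence on monomials it is the lexicographic order with \<open>x\<^sub>1 > x\<^sub>2 > \<dots> > x\<^sub>n\<close>.\<close>

lemma lex_order_exponents:
  "(a :: nat \<Rightarrow>\<^sub>0 nat) < b \<longleftrightarrow>
     (\<exists>i. Poly_Mapping.lookup a i < Poly_Mapping.lookup b i \<and>
       (\<forall>j<i. Poly_Mapping.lookup a j = Poly_Mapping.lookup b j))"
  by transfer (simp add: less_fun_def)

definition lex_segment_ideal :: "nat \<Rightarrow> ('k::field) mpoly set \<Rightarrow> bool" where
  "lex_segment_ideal n J \<longleftrightarrow> monomial_ideal n J \<and>
     (\<forall>a\<in>exponents n. \<forall>b\<in>exponents n.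
        monomial a \<in> J \<and> mdeg b = mdeg a \<and> a \<le> b \<longrightarrow> monomial b \<in> J)"

text \<open>For homogeneous \<open>I\<close> such a \<open>J\<close> exists (Macaulay) and is unique.\<close>

definition lex_ideal :: "nat \<Rightarrow> ('k::field) mpoly set \<Rightarrow> 'k mpoly set" where
  "lex_ideal n I = (THE J. lex_segment_ideal n J \<and> hilbert_function n J = hilbert_function n I)"

section \<open>Krull dimension and reduction numbers\<close>

text \<open>The zero ring gets dimension \<open>0\<close> here, as the supremum of the empty set.\<close>

definition krull_dim :: "('a, 'b) ring_scheme \<Rightarrow> enat" where
  "krull_dim A = Sup {enat l | l. \<exists>P :: nat \<Rightarrow> 'a set.
     (\<forall>i\<le>l. primeideal (P i) A) \<and> (\<forall>i<l. P i \<subset> P (Suc i))}"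

text \<open>A graded algebra is given by a ring \<open>A\<close> and the family \<open>G\<close> of its graded components
  \<open>G t = A\<^sub>t\<close>. The list \<open>zs\<close> is \<open>z\<^sub>1, \<dots>, z\<^sub>d\<close>.\<close>

definition is_reduction :: "('a, 'b) ring_scheme \<Rightarrow> (nat \<Rightarrow> 'a set) \<Rightarrow> nat \<Rightarrow> 'a set \<Rightarrow> bool" where
  "is_reduction A G d q \<longleftrightarrow>
     (\<exists>zs. length zs = d \<and> set zs \<subseteq> G 1 \<and> q = Idl\<^bsub>A\<^esub> (set zs)) \<and>
     (\<exists>t0. \<forall>t\<ge>t0. q \<inter> G t = G t)"

definition reduction_number_wrt :: "(nat \<Rightarrow> 'a set) \<Rightarrow> 'a set \<Rightarrow> nat" where
  "reduction_number_wrt G q = (LEAST r. q \<inter> G (r + 1) = G (r + 1))"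

text \<open>Over an infinite field the set of reductions is nonempty, so that the infimum is a minimum.\<close>

definition reduction_number :: "('a, 'b) ring_scheme \<Rightarrow> (nat \<Rightarrow> 'a set) \<Rightarrow> nat" where
  "reduction_number A G =
     Inf {reduction_number_wrt G q | q d. krull_dim A = enat d \<and> is_reduction A G d q}"

definition quotient_component :: "nat \<Rightarrow> ('k::field) mpoly set \<Rightarrow> nat \<Rightarrow> 'k mpoly set set" where
  "quotient_component n I t = (\<lambda>f. I +>\<^bsub>poly_ring n\<^esub> f) ` forms n t"

text \<open>\<open>r(R/I)\<close>, for the standard grading of \<open>R/I\<close>.\<close>

definition red :: "nat \<Rightarrow> ('k::field) mpoly set \<Rightarrow> nat" where
  "red n I = reduction_number (poly_ring n Quot I) (quotient_component n I)"

end

theory Submission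
  imports Defs "HOL-Computational_Algebra.Formal_Power_Series" "HOL-Computational_Algebra.Polynomial"
begin

text \<open>Write \<open>A = R/I\<close>. The ideal \<open>I\<^sup>l\<^sup>e\<^sup>x\<close> depends on the Hilbert function of \<open>I\<close> only, and both
bounds come from upper bounds for the Hilbert function \<open>H\<close> of \<open>A\<close>.

Let \<open>d < n\<close>; for \<open>d = n\<close> the last \<open>d\<close> variables are all variables and generate every form of
positive degree. If \<open>H(t)\<close> is smaller than \<open>(t + d) choose d\<close>, the number of monomials of degree \<open>t\<close> in the last
\<open>d + 1\<close> variables, then one of these monomials lies in \<open>I\<^sup>l\<^sup>e\<^sup>x\<close>. The largest of them is the power
of degree \<open>t\<close> of the first of the \<open>d + 1\<close> variables, so it lies in \<open>I\<^sup>l\<^sup>e\<^sup>x\<close>, and so does each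
monomial of degree \<open>t\<close> without the last \<open>d\<close> variables, since it is at least as large. Hence the last
\<open>d\<close> variables generate a reduction of \<open>R/I\<^sup>l\<^sup>e\<^sup>x\<close> with reduction number at most \<open>t - 1\<close>
(\<open>lex_segment_covered\<close>, \<open>red_lex_le\<close>). With \<open>e\<close> the binomial coefficient or the product of
degrees, it remains to show \<open>H(t) < (t + d) choose d\<close> for \<open>t = d (e - 2) + 2\<close>.

Compared coefficientwise, the Hilbert series of \<open>A\<close> is at most \<open>p(T) / (1 - T)\<^sup>d\<close>, where \<open>p\<close> has
nonnegative coefficients, \<open>p(0) = 1\<close> and \<open>p(1) \<le> e\<close>. The extreme case is \<open>p = 1 + (e - 1) T\<close>, and
comparing binomial coefficients gives the inequality (\<open>coefficient_bound\<close>). For the first bound,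
\<open>p\<close> is the Hilbert series of \<open>A/(z)\<close>, where \<open>z\<close> are \<open>d\<close> linear forms generating a reduction with
reduction number \<open>r = r(A)\<close>: this algebra is a quotient of a polynomial ring in \<open>n - d\<close> variables and
vanishes above degree \<open>r\<close> (\<open>hilb_bound_of_reduction_number\<close>). For the second bound, \<open>I\<close> contains
forms \<open>f\<close> of degrees \<open>a\<^sub>1, \<dots>, a\<^bsub>n-d\<^esub>\<close> that together with \<open>z\<close> are a system of parameters of
\<open>R\<close>. Such a system is a regular sequence, so that
\<open>p = \<Prod>\<^sub>i (1 + T + \<dots> + T\<^bsup>a\<^sub>i - 1\<^esup>)\<close> is possible
(\<open>choose_forms\<close>, \<open>system_of_parameters\<close>, \<open>hilb_bound_of_degrees\<close>).

Three facts stand behind this. Over an infinite field, forms can be eliminated by general linear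
combinations as long as they are algebraically dependent modulo \<open>J\<close>; this is Noether normalization
(\<open>eliminate_form\<close>, \<open>eliminate_to_dimension\<close>). The Krull dimension of \<open>R/J\<close> is the order of growth
of its Hilbert function (\<open>krull_dim_eqI\<close>), so that \<open>R/I\<^sup>l\<^sup>e\<^sup>x\<close> has dimension \<open>d\<close> too. Finally,
\<open>I\<^sup>l\<^sup>e\<^sup>x\<close> exists by Macaulay's theorem (\<open>macaulay\<close>, \<open>lex_ideal_exists\<close>), which is proved by
compressing a set of monomials to a strongly stable one and comparing that with a lex segment.

If \<open>d \<ge> 2\<close>, the first estimate needs \<open>e \<ge> 2\<close>, that is \<open>r(A) \<ge> 1\<close> and \<open>d < n\<close>. Otherwise \<open>I\<close>
would be generated by linear forms (\<open>linear_ideal_of_reduction_zero\<close>), and a minimal system of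
generators could not contain a form of degree at least \<open>2\<close>.\<close>

section \<open>Linear algebra\<close>

text \<open>Finite dimensionality is a property of subspaces, since the space of all polynomials has infinite
dimension.\<close>

definition fin_dim :: "('k::field) mpoly set \<Rightarrow> bool" where
  "fin_dim V \<longleftrightarrow> (\<exists>B. finite B \<and> V \<subseteq> mpoly_space.span B)"

lemma fin_dim_mono: "fin_dim V \<Longrightarrow> W \<subseteq> V \<Longrightarrow> fin_dim W"
  unfolding fin_dim_def by blast

lemma fin_dim_basis:
  assumes "fin_dim V"
  obtains B where "B \<subseteq> V" "mpoly_space.independent B" "finite B" "V \<subseteq> mpoly_space.span B" "card B = mpoly_space.dim V"
proof -
  obtain B where B: "B \<subseteq> V" "mpoly_space.independent B" "V \<subseteq> mpoly_space.span B" "card B = mpoly_space.dim V"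
    by (rule mpoly_space.basis_exists)
  obtain A where A: "finite A" "V \<subseteq> mpoly_space.span A" using assms unfolding fin_dim_def by blast
  have "finite B" using mpoly_space.independent_span_bound[OF A(1) B(2)] A(2) B(1) by auto
  thus ?thesis using B by (intro that)
qed

lemma fin_dim_independent:
  assumes "fin_dim V" "mpoly_space.independent B" "B \<subseteq> V"
  shows "finite B" "card B \<le> mpoly_space.dim V"
proof -
  obtain A where A: "A \<subseteq> V" "mpoly_space.independent A" "finite A" "V \<subseteq> mpoly_space.span A"
    "card A = mpoly_space.dim V" by (rule fin_dim_basis[OF assms(1)])
  thus "finite B" "card B \<le> mpoly_space.dim V"
    using mpoly_space.independent_span_bound[of A B] assms(2,3) by auto
qed

lemma dim_mono_fin:
  assumes "fin_dim V" "W \<subseteq> V" shows "mpoly_space.dim W \<le> mpoly_space.dim V"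
proof -
  obtain B where B: "B \<subseteq> W" "mpoly_space.independent B" "card B = mpoly_space.dim W"
    by (rule mpoly_space.basis_exists)
  thus ?thesis using fin_dim_independent(2)[OF assms(1) B(2)] assms(2) by simp
qed

lemma dim_span_insert:
  assumes "mpoly_space.subspace W" "fin_dim W" "x \<notin> W"
  shows "mpoly_space.dim (mpoly_space.span (insert x W)) = Suc (mpoly_space.dim W)"
proof -
  obtain B where B: "B \<subseteq> W" "mpoly_space.independent B" "finite B" "W \<subseteq> mpoly_space.span B" "card B = mpoly_space.dim W"
    by (rule fin_dim_basis[OF assms(2)])
  have W: "mpoly_space.span B = W" using B(1,4) assms(1) mpoly_space.span_minimal by blast
  hence "x \<notin> mpoly_space.span B" using assms by simp
  hence i: "mpoly_space.independent (insert x B)" and n: "x \<notin> B" using B mpoly_space.independent_insertI mpoly_space.span_base by auto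
  have "mpoly_space.span (insert x W) = mpoly_space.span (insert x B)"
    unfolding mpoly_space.span_insert W[symmetric] mpoly_space.span_span ..
  thus ?thesis using mpoly_space.dim_span_eq_card_independent[OF i] B n by simp
qed

lemma subspace_eq_fin:
  assumes "mpoly_space.subspace W" "W \<subseteq> V" "fin_dim V" "mpoly_space.dim V \<le> mpoly_space.dim W"
  shows "W = V"
proof (rule ccontr)
  assume "W \<noteq> V"
  then obtain x where x: "x \<in> V" "x \<notin> W" using assms(2) by blast
  have fW: "fin_dim W" using assms fin_dim_mono by blast
  have "Suc (mpoly_space.dim W) = mpoly_space.dim (mpoly_space.span (insert x W))" using dim_span_insert assms(1) fW x by metis
  also have "\<dots> \<le> mpoly_space.dim (mpoly_space.span V)"
  proof (rule dim_mono_fin)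
    show "fin_dim (mpoly_space.span V)" using assms(3) unfolding fin_dim_def
      by (meson mpoly_space.span_minimal mpoly_space.subspace_span)
  qed (use x assms in \<open>auto intro!: mpoly_space.span_mono\<close>)
  finally show False using assms by simp
qed

text \<open>Rank and nullity of the map from \<open>U\<close> to the quotient by \<open>W\<close> that \<open>f\<close> induces. The exact
sequences of Hilbert functions below, homogeneous and filtered, are instances of this count.\<close>

lemma dim_sum_image:
  fixes f :: "('k::field) mpoly \<Rightarrow> 'k mpoly"
  assumes W: "mpoly_space.subspace W" "fin_dim W" and U: "mpoly_space.subspace U" "fin_dim U"
    and add: "\<And>x y. f (x + y) = f x + f y" and sc: "\<And>c x. f (scale c x) = scale c (f x)"
  shows "mpoly_space.dim {w + f u | w u. w \<in> W \<and> u \<in> U} + mpoly_space.dim {u \<in> U. f u \<in> W} = mpoly_space.dim W + mpoly_space.dim U"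
proof -
  define K where "K = {u \<in> U. f u \<in> W}"
  have f0: "f 0 = 0" using sc[of 0 0] by simp
  have K: "mpoly_space.subspace K" using W U add sc f0 unfolding K_def mpoly_space.subspace_def by auto
  have fK: "fin_dim K" by (rule fin_dim_mono[OF U(2)]) (auto simp: K_def)
  \<comment> \<open>A basis of the preimage \<open>K\<close> of \<open>W\<close>, extended to a basis of \<open>U\<close>; the images of the added
  vectors are independent modulo \<open>W\<close>.\<close>
  obtain B0 where B0: "B0 \<subseteq> K" "mpoly_space.independent B0" "finite B0" "K \<subseteq> mpoly_space.span B0" "card B0 = mpoly_space.dim K"
    by (rule fin_dim_basis[OF fK])
  have KB: "mpoly_space.span B0 = K" using mpoly_space.span_minimal[OF B0(1) K] B0(4) by (rule equalityI)
  obtain B where B: "B0 \<subseteq> B" "B \<subseteq> U" "mpoly_space.independent B" "U \<subseteq> mpoly_space.span B"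
  proof (rule mpoly_space.maximal_independent_subset_extend)
    show "B0 \<subseteq> U" using B0(1) unfolding K_def by auto
  qed (rule B0(2))
  have fB: "finite B" by (rule fin_dim_independent(1)[OF U(2) B(3,2)])
  have cB: "card B = mpoly_space.dim U" by (rule mpoly_space.basis_card_eq_dim[OF B(2,4,3)])
  have UB: "mpoly_space.span B = U" using mpoly_space.span_minimal[OF B(2) U(1)] B(4) by (rule equalityI)
  define S where "S D = {w + f u | w u. w \<in> W \<and> u \<in> mpoly_space.span D}" for D
  have subS: "mpoly_space.subspace (S D)" for D
  proof -
    have "f ` mpoly_space.span D = mpoly_space.span (f ` D)"
    proof -
      have "Vector_Spaces.linear scale scale f" using add sc by (simp add: Vector_Spaces.linear_iff mpoly_space.vector_space_axioms)
      then interpret Vector_Spaces.linear scale scale f .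
      show ?thesis by (rule span_image[symmetric])
    qed
    moreover have "S D = {x + y |x y. x \<in> W \<and> y \<in> f ` mpoly_space.span D}" unfolding S_def by auto
    ultimately show ?thesis using mpoly_space.subspace_sums[OF W(1) mpoly_space.subspace_span, of "f ` D"] by simp
  qed
  have "fin_dim (S D) \<and> mpoly_space.dim (S D) = mpoly_space.dim W + card D" if "finite D" "D \<subseteq> B - B0" for D
    using that
  proof (induction D rule: finite_induct)
    case empty
    have "S {} = W" unfolding S_def using f0 by auto
    thus ?case using W by simp
  next
    case (insert b D)
    have nb: "f b \<notin> S D"
    proof
      assume "f b \<in> S D"
      then obtain w u where wu: "f b = w + f u" "w \<in> W" "u \<in> mpoly_space.span D" unfolding S_def by auto
      have uU: "u \<in> U" using wu(3) insert.prems mpoly_space.span_mono[of D B] unfolding UB by blast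
      have bU: "b \<in> U" using insert.prems B by auto
      have "f b = f (b - u) + f u" using add[of "b - u" u] by simp
      hence "f (b - u) = w" using wu(1) by simp
      hence "b - u \<in> K" using wu uU bU mpoly_space.subspace_diff[OF U(1)] by (auto simp: K_def)
      hence "b - u \<in> mpoly_space.span (B - {b})" using mpoly_space.span_mono[of B0 "B - {b}"] B(1) insert.prems unfolding KB by blast
      moreover have "u \<in> mpoly_space.span (B - {b})" using wu(3) mpoly_space.span_mono[of D "B - {b}"] insert.hyps insert.prems by blast
      ultimately have "b \<in> mpoly_space.span (B - {b})" using mpoly_space.span_add[of "b - u" "B - {b}" u] by simp
      thus False using B(3) insert.prems unfolding mpoly_space.dependent_def by blast
    qed
    have eq: "S (insert b D) = mpoly_space.span (insert (f b) (S D))"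
    proof
      show "S (insert b D) \<subseteq> mpoly_space.span (insert (f b) (S D))"
      proof
        fix x assume "x \<in> S (insert b D)"
        then obtain w u where wu: "x = w + f u" "w \<in> W" "u \<in> mpoly_space.span (insert b D)" unfolding S_def by auto
        then obtain k where "u - scale k b \<in> mpoly_space.span D" using mpoly_space.span_breakdown_eq by blast
        hence "w + f (u - scale k b) \<in> S D" using wu(2) unfolding S_def by blast
        moreover have "x = scale k (f b) + (w + f (u - scale k b))"
          unfolding wu(1) using add[of "u - scale k b" "scale k b"] sc[of k b] by (simp add: algebra_simps)
        ultimately show "x \<in> mpoly_space.span (insert (f b) (S D))"
          by (simp add: mpoly_space.span_add mpoly_space.span_base mpoly_space.span_scale)
      qed
      have "f b \<in> S (insert b D)" unfolding S_def
        using mpoly_space.subspace_0[OF W(1)] mpoly_space.span_base[of b "insert b D"]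
        by (intro CollectI exI[of _ 0] exI[of _ b]) simp
      moreover have "S D \<subseteq> S (insert b D)" unfolding S_def using mpoly_space.span_mono[of D "insert b D"] by auto
      ultimately show "mpoly_space.span (insert (f b) (S D)) \<subseteq> S (insert b D)"
        using subS by (intro mpoly_space.span_minimal) auto
    qed
    have IH: "fin_dim (S D)" "mpoly_space.dim (S D) = mpoly_space.dim W + card D" using insert by auto
    obtain A where "finite A" "S D \<subseteq> mpoly_space.span A" using IH(1) unfolding fin_dim_def by blast
    hence "insert (f b) (S D) \<subseteq> mpoly_space.span (insert (f b) A)"
      using mpoly_space.span_mono[of A "insert (f b) A"] mpoly_space.span_base[of "f b" "insert (f b) A"]
      by auto
    hence "mpoly_space.span (insert (f b) (S D)) \<subseteq> mpoly_space.span (insert (f b) A)"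
      by (rule mpoly_space.span_minimal) (rule mpoly_space.subspace_span)
    hence "fin_dim (S (insert b D))" unfolding eq fin_dim_def using \<open>finite A\<close> by blast
    moreover have "mpoly_space.dim (S (insert b D)) = Suc (mpoly_space.dim (S D))"
      using dim_span_insert[OF subS IH(1) nb] unfolding eq .
    ultimately show ?case using IH(2) insert.hyps by simp
  qed
  from this[of "B - B0"] have d: "mpoly_space.dim (S (B - B0)) = mpoly_space.dim W + card (B - B0)" using fB by auto
  have "{w + f u | w u. w \<in> W \<and> u \<in> U} = S (B - B0)"
  proof
    show "S (B - B0) \<subseteq> {w + f u | w u. w \<in> W \<and> u \<in> U}"
      unfolding S_def using UB mpoly_space.span_mono[of "B - B0" B] by auto
    show "{w + f u | w u. w \<in> W \<and> u \<in> U} \<subseteq> S (B - B0)"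
    proof
      fix x assume "x \<in> {w + f u | w u. w \<in> W \<and> u \<in> U}"
      then obtain w u where wu: "x = w + f u" "w \<in> W" "u \<in> U" by auto
      have "B = B0 \<union> (B - B0)" using B by auto
      hence "u \<in> mpoly_space.span (B0 \<union> (B - B0))" using wu UB by simp
      then obtain p q where pq: "u = p + q" "p \<in> mpoly_space.span B0" "q \<in> mpoly_space.span (B - B0)"
        unfolding mpoly_space.span_Un by blast
      have "x = (w + f p) + f q" unfolding wu(1) pq(1) add by (simp add: add.assoc)
      moreover have "w + f p \<in> W" using pq KB W wu mpoly_space.subspace_add by (auto simp: K_def)
      ultimately show "x \<in> S (B - B0)" unfolding S_def using pq(3) by (intro CollectI exI[of _ "w + f p"] exI[of _ q]) simp
    qed
  qed
  moreover have "card (B - B0) + card B0 = card B" 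
    using card_Diff_subset[OF B0(3) B(1)] card_mono[OF fB B(1)] by simp
  ultimately show ?thesis using d cB B0(5) unfolding K_def by simp
qed

section \<open>Polynomials and exponent vectors\<close>

abbreviation cf :: "('a \<Rightarrow>\<^sub>0 'b::zero) \<Rightarrow> 'a \<Rightarrow> 'b" where "cf \<equiv> Poly_Mapping.lookup"
abbreviation supp :: "('a \<Rightarrow>\<^sub>0 'b::zero) \<Rightarrow> 'a set" where "supp \<equiv> Poly_Mapping.keys"
abbreviation polys :: "nat \<Rightarrow> ('k::field) mpoly set" where "polys n \<equiv> carrier (poly_ring n)"

lemma poly_ring_simps [simp]:
  "monoid.mult (poly_ring n) = (*)" "monoid.one (poly_ring n) = 1" "ring.zero (poly_ring n) = 0" "ring.add (poly_ring n) = (+)"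
  by (simp_all add: poly_ring_def)

lemma polys_iff: "f \<in> polys n \<longleftrightarrow> supp f \<subseteq> exponents n"
  by (simp add: poly_ring_def)

lemma zero_polys [simp]: "0 \<in> polys n" by (simp add: polys_iff)
lemma one_polys [simp]: "1 \<in> polys n" by (simp add: polys_iff exponents_0)

lemma add_polys: "f \<in> polys n \<Longrightarrow> g \<in> polys n \<Longrightarrow> f + g \<in> polys n"
  using keys_add[of f g] by (auto simp: polys_iff)

lemma mult_polys: "f \<in> polys n \<Longrightarrow> g \<in> polys n \<Longrightarrow> f * g \<in> polys n"
  using keys_mult[of f g] by (fastforce simp: polys_iff intro: exponents_add)

lemma uminus_polys: "f \<in> polys n \<Longrightarrow> - f \<in> polys n"
  by (simp add: polys_iff)

lemma single_polys: "m \<in> exponents n \<Longrightarrow> Poly_Mapping.single m c \<in> polys n"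
  by (simp add: polys_iff)

lemma scale_lookup [simp]: "cf (scale c f) m = c * cf f m"
proof -
  have "scale c f = Poly_Mapping.map ((*) c) f" by (simp add: scale_def mult_map_scale_conv_mult)
  thus ?thesis by (simp add: Poly_Mapping.map.rep_eq when_def)
qed

lemma scale_mult_left: "scale c f * g = scale c (f * g)"
  by (simp add: scale_def mult.assoc)

lemma scale_mult_right: "f * scale c g = scale c (f * g)"
  by (simp add: scale_def mult.left_commute)

lemma scale_polys: "f \<in> polys n \<Longrightarrow> scale c f \<in> polys n"
  unfolding scale_def by (rule mult_polys) (auto simp: polys_iff exponents_0)

lemma poly_expansion: "f = (\<Sum>m\<in>supp f. Poly_Mapping.single m (cf f m))"
  by (rule poly_mapping_eqI) (simp add: lookup_sum lookup_single when_def in_keys_iff)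

lemma mdeg_superset:
  assumes "finite A" "supp m \<subseteq> A" shows "mdeg m = (\<Sum>i\<in>A. cf m i)"
  unfolding mdeg_def using assms by (intro sum.mono_neutral_left) (auto simp: in_keys_iff)

lemma mdeg_add: "mdeg (a + b) = mdeg a + mdeg b"
proof -
  let ?A = "supp a \<union> supp b"
  have "mdeg (a + b) = (\<Sum>i\<in>?A. cf (a + b) i)" using keys_add[of a b] by (intro mdeg_superset) auto
  also have "\<dots> = (\<Sum>i\<in>?A. cf a i) + (\<Sum>i\<in>?A. cf b i)" by (simp add: lookup_add sum.distrib)
  finally show ?thesis using mdeg_superset[of ?A a] mdeg_superset[of ?A b] by simp
qed

lemma mdeg_zero [simp]: "mdeg 0 = 0" by (simp add: mdeg_def)

lemma mdeg_single [simp]: "mdeg (Poly_Mapping.single i k) = k"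
  by (cases "k = 0") (simp_all add: mdeg_def)

lemma mdeg_eq_0: "mdeg m = 0 \<longleftrightarrow> m = 0"
  by (auto simp: mdeg_def in_keys_iff poly_mapping_eq_iff fun_eq_iff)

section \<open>Counting monomials\<close>

text \<open>The set \<open>V\<close> of variables is arbitrary because, besides all variables, the last \<open>d + 1\<close> of them
have to be counted.\<close>

definition mons :: "nat set \<Rightarrow> nat \<Rightarrow> (nat \<Rightarrow>\<^sub>0 nat) set" where
  "mons V t = {m. supp m \<subseteq> V \<and> mdeg m = t}"

lemma mons_0: "mons V 0 = {0}" by (auto simp: mons_def mdeg_eq_0)

lemma mons_empty: "mons {} (Suc t) = {}"
  by (auto simp: mons_def)

lemma add_minus_single:
  fixes m :: "nat \<Rightarrow>\<^sub>0 nat"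
  assumes "cf m x \<noteq> 0"
  shows "m - Poly_Mapping.single x 1 + Poly_Mapping.single x 1 = m"
  using assms by (intro poly_mapping_eqI) (auto simp: lookup_add lookup_minus lookup_single when_def)

text \<open>Pascal's rule: a monomial either omits \<open>x\<close> or is \<open>x\<close> times a monomial of lower degree.\<close>

lemma mons_insert_Suc:
  assumes "x \<notin> V"
  shows "mons (insert x V) (Suc t) = mons V (Suc t) \<union> (\<lambda>m. m + Poly_Mapping.single x 1) ` mons (insert x V) t"
    and "mons V (Suc t) \<inter> (\<lambda>m. m + Poly_Mapping.single x 1) ` mons (insert x V) t = {}"
proof -
  show "mons V (Suc t) \<inter> (\<lambda>m. m + Poly_Mapping.single x 1) ` mons (insert x V) t = {}"
    using assms by (auto simp: mons_def subset_iff in_keys_iff lookup_add)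
  have "m \<in> mons V (Suc t) \<union> (\<lambda>m. m + Poly_Mapping.single x 1) ` mons (insert x V) t"
    if m: "m \<in> mons (insert x V) (Suc t)" for m
  proof (cases "cf m x = 0")
    case True
    thus ?thesis using m by (auto simp: mons_def in_keys_iff)
  next
    case False
    let ?m = "m - Poly_Mapping.single x 1"
    have eq: "?m + Poly_Mapping.single x 1 = m" by (rule add_minus_single[OF False])
    hence "mdeg ?m = t" using m mdeg_add[of ?m "Poly_Mapping.single x 1"] by (simp add: mons_def)
    moreover have "supp ?m \<subseteq> insert x V"
      using m by (auto simp: mons_def in_keys_iff lookup_minus subset_iff)
    ultimately have "?m \<in> mons (insert x V) t" by (simp add: mons_def)
    thus ?thesis using eq by (intro UnI2) (metis image_eqI)
  qed
  moreover have "mons V (Suc t) \<union> (\<lambda>m. m + Poly_Mapping.single x 1) ` mons (insert x V) t \<subseteq> mons (insert x V) (Suc t)"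
    using keys_add by (fastforce simp: mons_def mdeg_add)
  ultimately show "mons (insert x V) (Suc t) = mons V (Suc t) \<union> (\<lambda>m. m + Poly_Mapping.single x 1) ` mons (insert x V) t"
    by blast
qed

lemma mons_card:
  assumes "finite V"
  shows "finite (mons V t) \<and> card (mons V t) = (card V + t - 1) choose t"
  using assms
proof (induction V arbitrary: t rule: finite_induct)
  case empty
  show ?case by (cases t) (simp_all add: mons_0 mons_empty)
next
  case (insert x V)
  note IH = insert.IH and x = insert.hyps(2)
  show ?case
  proof (induction t)
    case 0
    show ?case by (simp add: mons_0)
  next
    case (Suc t)
    have inj: "card ((\<lambda>m. m + Poly_Mapping.single x (1::nat)) ` A) = card A" for A
      by (rule card_image) (auto simp: inj_on_def)
    have f: "finite (mons (insert x V) (Suc t))"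
      using IH Suc by (simp add: mons_insert_Suc(1)[OF x])
    have "card (mons (insert x V) (Suc t)) = card (mons V (Suc t)) + card (mons (insert x V) t)"
      unfolding mons_insert_Suc(1)[OF x] using mons_insert_Suc(2)[OF x] IH Suc
      by (subst card_Un_disjoint) (auto simp: inj[unfolded One_nat_def])
    also have "\<dots> = (card V + t choose Suc t) + (card V + t choose t)"
      using IH Suc insert.hyps by simp
    also have "\<dots> = (card (insert x V) + Suc t - 1) choose Suc t"
      using insert.hyps by simp
    finally show ?case using f by simp
  qed
qed

lemmas finite_mons = mons_card[THEN conjunct1]

lemma forms_iff: "f \<in> forms n t \<longleftrightarrow> supp f \<subseteq> mons {..<n} t"
  by (auto simp: forms_def polys_iff mons_def exponents_def)

lemma forms_polys: "f \<in> forms n t \<Longrightarrow> f \<in> polys n" by (simp add: forms_def)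

lemma zero_forms [simp]: "0 \<in> forms n t" by (simp add: forms_iff)

lemma forms_subspace: "mpoly_space.subspace (forms n t)"
proof (rule mpoly_space.subspaceI)
  show "f + g \<in> forms n t" if "f \<in> forms n t" "g \<in> forms n t" for f g :: "'a mpoly"
    using that keys_add[of f g] unfolding forms_iff by blast
  show "scale c f \<in> forms n t" if "f \<in> forms n t" for c and f :: "'a mpoly"
    using that unfolding forms_iff by (auto simp: in_keys_iff subset_iff)
qed simp

lemma monomial_forms: "m \<in> mons {..<n} t \<Longrightarrow> monomial m \<in> forms n t"
  by (simp add: forms_iff monomial_def)

lemma single_eq_scale: "Poly_Mapping.single m c = scale c (monomial m)"
  by (simp add: scale_def monomial_def mult_single)

lemma supp_in_span_monomials:
  fixes f :: "('k::field) mpoly"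
  assumes "supp f \<subseteq> M" shows "f \<in> mpoly_space.span (monomial ` M)"
proof -
  have "(\<Sum>m\<in>supp f. Poly_Mapping.single m (cf f m)) \<in> mpoly_space.span (monomial ` M)"
    unfolding single_eq_scale using assms
    by (intro mpoly_space.span_sum mpoly_space.span_scale mpoly_space.span_base) auto
  thus ?thesis using poly_expansion[of f] by simp
qed

lemma span_monomials: "mpoly_space.span (monomial ` M) = {f :: ('k::field) mpoly. supp f \<subseteq> M}"
proof
  have "mpoly_space.subspace {f :: 'k mpoly. supp f \<subseteq> M}"
  proof (rule mpoly_space.subspaceI)
    show "f + g \<in> {f. supp f \<subseteq> M}" if "f \<in> {f. supp f \<subseteq> M}" "g \<in> {f. supp f \<subseteq> M}" for f g :: "'k mpoly"
      using that keys_add[of f g] by blast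
    show "scale c f \<in> {f. supp f \<subseteq> M}" if "f \<in> {f. supp f \<subseteq> M}" for c and f :: "'k mpoly"
      using that by (auto simp: in_keys_iff subset_iff)
  qed simp
  thus "mpoly_space.span (monomial ` M) \<subseteq> {f :: 'k mpoly. supp f \<subseteq> M}"
    by (intro mpoly_space.span_minimal) (auto simp: monomial_def)
qed (auto intro: supp_in_span_monomials)

text \<open>The span of the other monomials consists of the polynomials in which the given monomial does not
occur.\<close>

lemma independent_monomials: "mpoly_space.independent (monomial ` M :: ('k::field) mpoly set)"
proof
  assume "mpoly_space.dependent (monomial ` M :: 'k mpoly set)"
  then obtain m where m: "m \<in> M" "(monomial m :: 'k mpoly) \<in> mpoly_space.span (monomial ` M - {monomial m})"
    unfolding mpoly_space.dependent_def by blast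
  have "(monomial ` M - {monomial m} :: 'k mpoly set) \<subseteq> monomial ` (M - {m})" by auto
  hence "(monomial m :: 'k mpoly) \<in> mpoly_space.span (monomial ` (M - {m}))"
    using m(2) mpoly_space.span_mono by blast
  thus False unfolding span_monomials by (simp add: monomial_def)
qed

lemma inj_monomial: "inj_on (monomial :: _ \<Rightarrow> ('k::field) mpoly) M"
  by (auto simp: inj_on_def monomial_def dest: arg_cong[where f = supp])

lemma dim_supp_subset:
  assumes "finite M"
  shows "fin_dim {f :: ('k::field) mpoly. supp f \<subseteq> M}" "mpoly_space.dim {f :: 'k mpoly. supp f \<subseteq> M} = card M"
proof -
  show "fin_dim {f :: ('k::field) mpoly. supp f \<subseteq> M}"
    unfolding fin_dim_def span_monomials[symmetric] using assms by blast
  show "mpoly_space.dim {f :: 'k mpoly. supp f \<subseteq> M} = card M"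
    unfolding span_monomials[symmetric] mpoly_space.dim_span_eq_card_independent[OF independent_monomials]
    by (rule card_image[OF inj_monomial])
qed

lemma forms_eq: "forms n t = {f. supp f \<subseteq> mons {..<n} t}" by (auto simp: forms_iff)

lemma fin_dim_forms: "fin_dim (forms n t)"
  unfolding forms_eq by (rule dim_supp_subset) (simp add: finite_mons)

lemma dim_forms: "mpoly_space.dim (forms n t :: ('k::field) mpoly set) = (n + t - 1) choose t"
  unfolding forms_eq by (subst dim_supp_subset(2)) (simp_all add: mons_card)

lemma mult_forms:
  assumes "f \<in> forms n s" "g \<in> forms n t" shows "f * g \<in> forms n (s + t)"
proof -
  have "f * g \<in> polys n" using assms by (auto intro: mult_polys forms_polys)
  moreover have "mdeg m = s + t" if "m \<in> supp (f * g)" for m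
    using that keys_mult[of f g] assms by (fastforce simp: forms_def mdeg_add)
  ultimately show ?thesis by (simp add: forms_def)
qed

section \<open>Homogeneous components\<close>

definition hcomp :: "nat \<Rightarrow> ('k::field) mpoly \<Rightarrow> 'k mpoly" where
  "hcomp t f = (\<Sum>m\<in>{m\<in>supp f. mdeg m = t}. Poly_Mapping.single m (cf f m))"

lemma hcomp_lookup: "cf (hcomp t f) m = (if mdeg m = t then cf f m else 0)"
  by (simp add: hcomp_def lookup_sum lookup_single when_def in_keys_iff)

lemma hcomp_add: "hcomp t (f + g) = hcomp t f + hcomp t g"
  by (rule poly_mapping_eqI) (simp add: hcomp_lookup lookup_add)

lemma hcomp_zero [simp]: "hcomp t 0 = 0"
  by (rule poly_mapping_eqI) (simp add: hcomp_lookup)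

lemma hcomp_sum: "hcomp t (sum f A) = (\<Sum>i\<in>A. hcomp t (f i))"
  by (induction A rule: infinite_finite_induct) (simp_all add: hcomp_add)

lemma hcomp_homogeneous:
  assumes "\<forall>m\<in>supp f. mdeg m = a" shows "hcomp t f = (if t = a then f else 0)"
  using assms by (intro poly_mapping_eqI) (auto simp: hcomp_lookup in_keys_iff)

lemma hcomp_forms: "f \<in> polys n \<Longrightarrow> hcomp t f \<in> forms n t"
  by (auto simp: forms_def polys_iff in_keys_iff hcomp_lookup subset_iff split: if_splits)

lemma hcomp_decomposition:
  assumes "finite T" "mdeg ` supp f \<subseteq> T" shows "f = (\<Sum>t\<in>T. hcomp t f)"
  using assms by (intro poly_mapping_eqI) (auto simp: lookup_sum hcomp_lookup image_subset_iff in_keys_iff)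

text \<open>By linearity it suffices to multiply \<open>f\<close> by a single term, which shifts all degrees by the same
amount.\<close>

lemma hcomp_mult_homogeneous:
  assumes f: "\<forall>m\<in>supp f. mdeg m = a"
  shows "hcomp t (h * f) = (if a \<le> t then hcomp (t - a) h * f else 0)"
proof -
  have 1: "hcomp t (Poly_Mapping.single m c * f) = (if a \<le> t then hcomp (t - a) (Poly_Mapping.single m c) * f else 0)"
    for m c
  proof -
    have "\<forall>k\<in>supp (Poly_Mapping.single m c * f). mdeg k = mdeg m + a"
      using keys_mult[of "Poly_Mapping.single m c" f] f by (fastforce simp: mdeg_add split: if_splits)
    hence "hcomp t (Poly_Mapping.single m c * f) = (if t = mdeg m + a then Poly_Mapping.single m c * f else 0)"
      by (rule hcomp_homogeneous)
    moreover have "hcomp (t - a) (Poly_Mapping.single m c) = (if t - a = mdeg m then Poly_Mapping.single m c else 0)"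
      by (rule hcomp_homogeneous) simp
    ultimately show ?thesis by auto
  qed
  have "h * f = (\<Sum>m\<in>supp h. Poly_Mapping.single m (cf h m) * f)"
    by (subst poly_expansion[of h]) (simp add: sum_distrib_right)
  hence "hcomp t (h * f) = (\<Sum>m\<in>supp h. if a \<le> t then hcomp (t - a) (Poly_Mapping.single m (cf h m)) * f else 0)"
    by (simp add: hcomp_sum 1)
  also have "\<dots> = (if a \<le> t then hcomp (t - a) (\<Sum>m\<in>supp h. Poly_Mapping.single m (cf h m)) * f else 0)"
    by (simp add: hcomp_sum sum_distrib_right)
  finally show ?thesis using poly_expansion[of h] by simp
qed

section \<open>Ideals\<close>

lemma ideal_iff:
  "ideal J (poly_ring n) \<longleftrightarrow> J \<subseteq> polys n \<and> 0 \<in> J \<and> (\<forall>a\<in>J. \<forall>b\<in>J. a + b \<in> J) \<and> (\<forall>a\<in>J. \<forall>x\<in>polys n. x * a \<in> J)"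
  (is "?L \<longleftrightarrow> ?R")
proof
  assume ?L
  then interpret ideal J "poly_ring n" .
  show ?R using a_subset I_l_closed additive_subgroup.zero_closed[OF is_additive_subgroup]
      additive_subgroup.a_closed[OF is_additive_subgroup] by simp
next
  assume R: ?R
  interpret cring "poly_ring n" by (rule poly_ring_cring)
  have neg: "- a \<in> J" if "a \<in> J" for a
  proof -
    have "(- 1) * a \<in> J" using R that by (metis one_polys uminus_polys)
    thus ?thesis by simp
  qed
  have inv: "inv\<^bsub>add_monoid (poly_ring n)\<^esub> a = - a" if "a \<in> J" for a
    using that R neg by (intro group.inv_equality[OF a_group]) auto
  have "subgroup J (add_monoid (poly_ring n))"
    by (rule group.subgroupI[OF a_group]) (use R neg inv in auto)
  thus ?L by (rule idealI[OF ring_axioms]) (use R in \<open>auto simp: mult.commute\<close>)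
qed

lemma ideal_subset: "ideal J (poly_ring n) \<Longrightarrow> J \<subseteq> polys n" by (simp add: ideal_iff)
lemma ideal_zero: "ideal J (poly_ring n) \<Longrightarrow> 0 \<in> J" by (simp add: ideal_iff)
lemma ideal_add: "ideal J (poly_ring n) \<Longrightarrow> a \<in> J \<Longrightarrow> b \<in> J \<Longrightarrow> a + b \<in> J" by (simp add: ideal_iff)
lemma ideal_mult: "ideal J (poly_ring n) \<Longrightarrow> a \<in> J \<Longrightarrow> x \<in> polys n \<Longrightarrow> x * a \<in> J" by (simp add: ideal_iff)

lemma ideal_scale: "ideal J (poly_ring n) \<Longrightarrow> a \<in> J \<Longrightarrow> scale c a \<in> J"
  unfolding scale_def by (rule ideal_mult) (auto simp: polys_iff exponents_0)

lemma ideal_subspace: "ideal J (poly_ring n) \<Longrightarrow> mpoly_space.subspace J"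
  by (intro mpoly_space.subspaceI ideal_zero ideal_add ideal_scale)

lemma ideal_diff: "ideal J (poly_ring n) \<Longrightarrow> a \<in> J \<Longrightarrow> b \<in> J \<Longrightarrow> a - b \<in> J"
  by (rule mpoly_space.subspace_diff[OF ideal_subspace])

lemma ideal_sum: "ideal J (poly_ring n) \<Longrightarrow> (\<And>i. i \<in> A \<Longrightarrow> f i \<in> J) \<Longrightarrow> sum f A \<in> J"
  by (rule mpoly_space.subspace_sum[OF ideal_subspace])

abbreviation gen :: "nat \<Rightarrow> ('k::field) mpoly set \<Rightarrow> 'k mpoly set" where
  "gen n S \<equiv> genideal (poly_ring n) S"

lemma gen_ideal: "S \<subseteq> polys n \<Longrightarrow> ideal (gen n S) (poly_ring n)"
  using ring.genideal_ideal[OF cring.axioms(1)[OF poly_ring_cring]] .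

lemma gen_superset: "S \<subseteq> polys n \<Longrightarrow> S \<subseteq> gen n S"
  using ring.genideal_self[OF cring.axioms(1)[OF poly_ring_cring]] .

lemma gen_minimal: "ideal J (poly_ring n) \<Longrightarrow> S \<subseteq> J \<Longrightarrow> gen n S \<subseteq> J"
  using ring.genideal_minimal[OF cring.axioms(1)[OF poly_ring_cring]] .

lemma gen_mono: "T \<subseteq> polys n \<Longrightarrow> S \<subseteq> T \<Longrightarrow> gen n S \<subseteq> gen n T"
  by (rule gen_minimal[OF gen_ideal]) (use gen_superset[of T n] in auto)

lemma gen_of_ideal: "ideal J (poly_ring n) \<Longrightarrow> gen n J = J"
  by (rule equalityI[OF gen_minimal gen_superset[OF ideal_subset]]) auto

text \<open>The ideal \<open>J + (f)\<close>.\<close>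

definition adj :: "nat \<Rightarrow> ('k::field) mpoly set \<Rightarrow> 'k mpoly \<Rightarrow> 'k mpoly set" where
  "adj n J f = {j + h * f | j h. j \<in> J \<and> h \<in> polys n}"

lemma adj_ideal:
  assumes J: "ideal J (poly_ring n)" and f: "f \<in> polys n"
  shows "ideal (adj n J f) (poly_ring n)"
  unfolding ideal_iff
proof (intro conjI ballI)
  show "adj n J f \<subseteq> polys n" using ideal_subset[OF J] f by (auto simp: adj_def intro!: add_polys mult_polys)
  have "0 = 0 + 0 * f" by simp
  thus "0 \<in> adj n J f" unfolding adj_def using ideal_zero[OF J] zero_polys by blast
  show "a + b \<in> adj n J f" if "a \<in> adj n J f" "b \<in> adj n J f" for a b
  proof -
    obtain j h where a: "a = j + h * f" "j \<in> J" "h \<in> polys n" using \<open>a \<in> adj n J f\<close> unfolding adj_def by blast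
    obtain j' h' where b: "b = j' + h' * f" "j' \<in> J" "h' \<in> polys n" using \<open>b \<in> adj n J f\<close> unfolding adj_def by blast
    have "a + b = (j + j') + (h + h') * f" using a b by (simp add: algebra_simps)
    thus ?thesis unfolding adj_def using ideal_add[OF J a(2) b(2)] add_polys[OF a(3) b(3)] by blast
  qed
  show "x * a \<in> adj n J f" if "a \<in> adj n J f" "x \<in> polys n" for a x
  proof -
    obtain j h where a: "a = j + h * f" "j \<in> J" "h \<in> polys n" using \<open>a \<in> adj n J f\<close> unfolding adj_def by blast
    have "x * a = x * j + (x * h) * f" using a by (simp add: algebra_simps)
    thus ?thesis unfolding adj_def using ideal_mult[OF J a(2) that(2)] mult_polys[OF that(2) a(3)] by blast
  qed
qed

lemma adj_superset: "J \<subseteq> adj n J f"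
proof
  fix j assume "j \<in> J"
  moreover have "j = j + 0 * f" by simp
  ultimately show "j \<in> adj n J f" unfolding adj_def using zero_polys by blast
qed

lemma adj_self: "ideal J (poly_ring n) \<Longrightarrow> f \<in> adj n J f"
proof -
  assume "ideal J (poly_ring n)"
  moreover have "f = 0 + 1 * f" by simp
  ultimately show "f \<in> adj n J f" unfolding adj_def using one_polys ideal_zero by blast
qed

lemma adj_minimal:
  assumes "ideal K (poly_ring n)" "J \<subseteq> K" "f \<in> K" shows "adj n J f \<subseteq> K"
  using assms by (auto simp: adj_def intro!: ideal_add[OF assms(1)] ideal_mult[OF assms(1)])

lemma gen_insert:
  assumes "S \<subseteq> polys n" "f \<in> polys n"
  shows "gen n (insert f S) = adj n (gen n S) f"
proof
  show "gen n (insert f S) \<subseteq> adj n (gen n S) f"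
    using gen_superset[OF assms(1)] adj_superset[of "gen n S" n f] adj_self[OF gen_ideal[OF assms(1)], of f]
    by (intro gen_minimal[OF adj_ideal[OF gen_ideal[OF assms(1)] assms(2)]]) auto
  show "adj n (gen n S) f \<subseteq> gen n (insert f S)"
    using assms gen_superset[of "insert f S" n]
    by (intro adj_minimal[OF gen_ideal] gen_mono) auto
qed

text \<open>Homogeneity in terms of components. Unlike generation by forms it passes to unions and colon ideals
without choosing generators.\<close>

definition graded :: "nat \<Rightarrow> ('k::field) mpoly set \<Rightarrow> bool" where
  "graded n J \<longleftrightarrow> ideal J (poly_ring n) \<and> (\<forall>f\<in>J. \<forall>t. hcomp t f \<in> J)"

lemma graded_ideal: "graded n J \<Longrightarrow> ideal J (poly_ring n)" by (simp add: graded_def)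
lemma graded_hcomp: "graded n J \<Longrightarrow> f \<in> J \<Longrightarrow> hcomp t f \<in> J" by (simp add: graded_def)

lemma graded_zero: "graded n {0}" by (simp add: graded_def ideal_iff)
lemma graded_eqI:
  assumes "graded n J" "ideal K (poly_ring n)" "\<And>t. J \<inter> forms n t \<subseteq> K"
  shows "J \<subseteq> K"
proof
  fix f assume f: "f \<in> J"
  have "hcomp t f \<in> K" for t
    using assms(3)[of t] graded_hcomp[OF assms(1) f] hcomp_forms ideal_subset[OF graded_ideal[OF assms(1)]] f by blast
  hence "(\<Sum>t\<in>mdeg ` supp f. hcomp t f) \<in> K" by (intro ideal_sum[OF assms(2)])
  thus "f \<in> K" using hcomp_decomposition[of "mdeg ` supp f" f] by simp
qed

text \<open>The elements of the generated ideal all of whose components lie in it form an ideal that contains the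
generators.\<close>

lemma graded_gen:
  assumes "S \<subseteq> (\<Union>t. forms n t)" shows "graded n (gen n S :: ('k::field) mpoly set)"
proof -
  have Sp: "S \<subseteq> polys n" using assms forms_polys by fast
  note I = gen_ideal[OF Sp]
  define K where "K = {f \<in> gen n S. \<forall>t. hcomp t f \<in> gen n S}"
  have "ideal K (poly_ring n)" unfolding ideal_iff
  proof (intro conjI ballI)
    show "K \<subseteq> polys n" using ideal_subset[OF I] K_def by auto
    show "0 \<in> K" using ideal_zero[OF I] by (simp add: K_def)
    show "a + b \<in> K" if "a \<in> K" "b \<in> K" for a b
      using that ideal_add[OF I] by (simp add: K_def hcomp_add)
    show "x * a \<in> K" if a: "a \<in> K" and x: "x \<in> polys n" for a x
    proof -
      have "hcomp t (x * a) \<in> gen n S" for t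
      proof -
        have "x * a = (\<Sum>m\<in>supp x. a * Poly_Mapping.single m (cf x m))"
          by (subst poly_expansion[of x]) (simp add: sum_distrib_left mult.commute)
        hence "hcomp t (x * a) = (\<Sum>m\<in>supp x. hcomp t (a * Poly_Mapping.single m (cf x m)))"
          by (simp add: hcomp_sum)
        also have "\<dots> \<in> gen n S"
        proof (rule ideal_sum[OF I])
          fix m assume m: "m \<in> supp x"
          have "Poly_Mapping.single m (cf x m) * hcomp (t - mdeg m) a \<in> gen n S"
            using a m x by (intro ideal_mult[OF I] single_polys) (auto simp: K_def polys_iff)
          thus "hcomp t (a * Poly_Mapping.single m (cf x m)) \<in> gen n S"
            using hcomp_mult_homogeneous[of "Poly_Mapping.single m (cf x m)" "mdeg m" t a] ideal_zero[OF I]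
            by (simp add: mult.commute)
        qed
        finally show ?thesis .
      qed
      thus ?thesis using ideal_mult[OF I _ x] a by (simp add: K_def)
    qed
  qed
  moreover have "S \<subseteq> K"
  proof
    fix f assume f: "f \<in> S"
    then obtain a where "f \<in> forms n a" using assms by blast
    hence "hcomp t f = (if t = a then f else 0)" for t by (intro hcomp_homogeneous) (simp add: forms_def)
    thus "f \<in> K" using f gen_superset[OF Sp] ideal_zero[OF I] by (auto simp: K_def)
  qed
  ultimately have "gen n S \<subseteq> K" by (rule gen_minimal)
  thus ?thesis using I by (auto simp: graded_def K_def)
qed

lemma graded_adj:
  assumes J: "graded n J" and f: "f \<in> forms n a" shows "graded n (adj n J f)"
  unfolding graded_def
proof (intro conjI ballI allI)
  note I = graded_ideal[OF J]
  show "ideal (adj n J f) (poly_ring n)" using f by (intro adj_ideal I) (rule forms_polys)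
  fix g t assume "g \<in> adj n J f"
  then obtain j h where g: "g = j + h * f" "j \<in> J" "h \<in> polys n" by (auto simp: adj_def)
  have "hcomp t g = hcomp t j + (if a \<le> t then hcomp (t - a) h else 0) * f"
    using f hcomp_mult_homogeneous[of f a t h] by (simp add: g hcomp_add forms_def)
  moreover have "(if a \<le> t then hcomp (t - a) h else 0) \<in> polys n"
    using forms_polys[OF hcomp_forms[OF g(3)]] by simp
  ultimately show "hcomp t g \<in> adj n J f" unfolding adj_def using graded_hcomp[OF J g(2)] by blast
qed

text \<open>The colon ideal \<open>J : f\<close>. The element \<open>f\<close> is a nonzerodivisor on \<open>R/J\<close> if
and only if \<open>J : f = J\<close>.\<close>

definition colon :: "nat \<Rightarrow> ('k::field) mpoly set \<Rightarrow> 'k mpoly \<Rightarrow> 'k mpoly set" where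
  "colon n J f = {g \<in> polys n. g * f \<in> J}"

lemma colon_ideal:
  assumes J: "ideal J (poly_ring n)" and f: "f \<in> polys n" shows "ideal (colon n J f) (poly_ring n)"
  using ideal_zero[OF J] ideal_add[OF J] ideal_mult[OF J]
  by (auto simp: ideal_iff colon_def add_polys mult_polys distrib_right mult.assoc)

lemma colon_superset: "ideal J (poly_ring n) \<Longrightarrow> f \<in> polys n \<Longrightarrow> J \<subseteq> colon n J f"
  using ideal_subset ideal_mult by (fastforce simp: colon_def mult.commute)

section \<open>Hilbert functions of quotients\<close>

text \<open>The Hilbert function of \<open>R/J\<close>.\<close>

definition hilb :: "nat \<Rightarrow> ('k::field) mpoly set \<Rightarrow> nat \<Rightarrow> nat" where
  "hilb n J t = mpoly_space.dim (forms n t :: 'k mpoly set) - mpoly_space.dim (J \<inter> forms n t)"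

lemma dim_Int_forms_le: "mpoly_space.dim ((J :: ('k::field) mpoly set) \<inter> forms n t) \<le> mpoly_space.dim (forms n t :: 'k mpoly set)"
  by (intro dim_mono_fin[OF fin_dim_forms]) blast

lemma hilb_antimono:
  fixes J K :: "('k::field) mpoly set"
  assumes "J \<inter> forms n t \<subseteq> K" shows "hilb n K t \<le> hilb n J t"
proof -
  have "mpoly_space.dim (J \<inter> forms n t) \<le> mpoly_space.dim (K \<inter> forms n t)"
    by (rule dim_mono_fin[OF fin_dim_mono[OF fin_dim_forms]]) (use assms in auto)
  thus ?thesis by (simp add: hilb_def)
qed

lemma hilb_eqD:
  fixes J K :: "('k::field) mpoly set"
  assumes "ideal J (poly_ring n)" "J \<inter> forms n t \<subseteq> K" "hilb n J t \<le> hilb n K t"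
  shows "J \<inter> forms n t = K \<inter> forms n t"
proof (rule subspace_eq_fin)
  show "mpoly_space.subspace (J \<inter> forms n t)"
    by (intro mpoly_space.subspace_inter ideal_subspace[OF assms(1)] forms_subspace)
  show "fin_dim (K \<inter> forms n t)" by (rule fin_dim_mono[OF fin_dim_forms]) auto
  show "mpoly_space.dim (K \<inter> forms n t) \<le> mpoly_space.dim (J \<inter> forms n t)"
    using assms(3) dim_Int_forms_le[of J n t] dim_Int_forms_le[of K n t] by (simp add: hilb_def)
qed (use assms in auto)

lemma hilb_eq_0_iff:
  fixes J :: "('k::field) mpoly set"
  assumes "ideal J (poly_ring n)" shows "hilb n J t = 0 \<longleftrightarrow> forms n t \<subseteq> J"
proof
  assume "hilb n J t = 0"
  hence "J \<inter> forms n t = polys n \<inter> forms n t"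
    using ideal_subset[OF assms] by (intro hilb_eqD assms) auto
  thus "forms n t \<subseteq> J" using forms_polys by blast
next
  assume "forms n t \<subseteq> J"
  hence "J \<inter> forms n t = forms n t" by blast
  thus "hilb n J t = 0" by (simp add: hilb_def)
qed

text \<open>The count of dimensions in degree \<open>t\<close> along
\<open>0 \<longrightarrow> (R/(J : f))(-a) \<longrightarrow> R/J \<longrightarrow> R/(J + (f)) \<longrightarrow> 0\<close>.\<close>

lemma hilb_exact:
  fixes J :: "('k::field) mpoly set"
  assumes J: "graded n J" and f: "f \<in> forms n a"
  shows "hilb n J t = hilb n (adj n J f) t + (if a \<le> t then hilb n (colon n J f) (t - a) else 0)"
proof (cases "a \<le> t")
  case False
  have "adj n J f \<inter> forms n t = J \<inter> forms n t"
  proof (intro equalityI subsetI)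
    fix g assume g: "g \<in> adj n J f \<inter> forms n t"
    then obtain j h where jh: "g = j + h * f" "j \<in> J" "h \<in> polys n" by (auto simp: adj_def)
    have "hcomp t g = hcomp t j"
      using f False hcomp_mult_homogeneous[of f a t h] by (simp add: jh hcomp_add forms_def)
    moreover have "hcomp t g = g" using g hcomp_homogeneous[of g t t] by (simp add: forms_def)
    ultimately show "g \<in> J \<inter> forms n t" using graded_hcomp[OF J jh(2), of t] g by simp
  qed (use adj_superset in auto)
  thus ?thesis using False by (simp add: hilb_def)
next
  case True
  define W where "W = J \<inter> forms n t"
  define U where "U = (forms n (t - a) :: 'k mpoly set)"
  have ideal: "ideal J (poly_ring n)" by (rule graded_ideal[OF J])
  have W: "mpoly_space.subspace W" "fin_dim W" unfolding W_def
    by (intro mpoly_space.subspace_inter ideal_subspace[OF ideal] forms_subspace)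
       (rule fin_dim_mono[OF fin_dim_forms], blast)
  have U: "mpoly_space.subspace U" "fin_dim U" unfolding U_def by (rule forms_subspace, rule fin_dim_forms)
  have deg: "u * f \<in> forms n t" if "u \<in> U" for u
    using mult_forms[OF that[unfolded U_def] f] True by simp
  have dims: "mpoly_space.dim {w + u * f | w u. w \<in> W \<and> u \<in> U} + mpoly_space.dim {u \<in> U. u * f \<in> W}
      = mpoly_space.dim W + mpoly_space.dim U"
    by (rule dim_sum_image[OF W U]) (simp_all add: distrib_right scale_mult_left)
  have A: "{w + u * f | w u. w \<in> W \<and> u \<in> U} = adj n J f \<inter> forms n t"
  proof (intro equalityI subsetI)
    fix g assume "g \<in> {w + u * f | w u. w \<in> W \<and> u \<in> U}"
    then obtain w u where wu: "g = w + u * f" "w \<in> W" "u \<in> U" by blast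
    have "g \<in> forms n t" unfolding wu(1)
      using wu deg by (intro mpoly_space.subspace_add[OF forms_subspace]) (auto simp: W_def)
    moreover have "w \<in> J" "u \<in> polys n" using wu forms_polys[of u n "t - a"] by (auto simp: W_def U_def)
    ultimately show "g \<in> adj n J f \<inter> forms n t" unfolding adj_def wu(1) by blast
  next
    fix g assume g: "g \<in> adj n J f \<inter> forms n t"
    then obtain j h where jh: "g = j + h * f" "j \<in> J" "h \<in> polys n" by (auto simp: adj_def)
    have "hcomp t g = hcomp t j + hcomp (t - a) h * f"
      using f True hcomp_mult_homogeneous[of f a t h] by (simp add: jh(1) hcomp_add forms_def)
    moreover have "hcomp t g = g" using g hcomp_homogeneous[of g t t] by (simp add: forms_def)
    moreover have "hcomp t j \<in> W" using jh(2) graded_hcomp[OF J jh(2), of t] hcomp_forms[of j n t] ideal_subset[OF ideal]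
      by (auto simp: W_def)
    moreover have "hcomp (t - a) h \<in> U" using hcomp_forms[OF jh(3)] by (simp add: U_def)
    ultimately show "g \<in> {w + u * f | w u. w \<in> W \<and> u \<in> U}" by fastforce
  qed
  have B: "{u \<in> U. u * f \<in> W} = colon n J f \<inter> forms n (t - a)"
    using deg by (auto simp: colon_def U_def W_def forms_polys)
  have "mpoly_space.dim (adj n J f \<inter> forms n t) + mpoly_space.dim (colon n J f \<inter> forms n (t - a))
      = mpoly_space.dim (J \<inter> forms n t) + mpoly_space.dim (forms n (t - a) :: 'k mpoly set)"
    using dims unfolding A B unfolding W_def U_def .
  moreover note dim_Int_forms_le[of "adj n J f" n t] dim_Int_forms_le[of "colon n J f" n "t - a"]
    dim_Int_forms_le[of J n t]
  ultimately show ?thesis using True by (simp add: hilb_def)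
qed

lemma exponents_mons: "exponents n = (\<Union>t. mons {..<n} t)" by (auto simp: exponents_def mons_def)

section \<open>Adjoining several forms\<close>

text \<open>The ideal \<open>J + (fs)\<close>. It is defined from the set of the forms, so that they can be reordered at
will.\<close>

definition ext :: "nat \<Rightarrow> ('k::field) mpoly set \<Rightarrow> 'k mpoly list \<Rightarrow> 'k mpoly set" where
  "ext n J fs = gen n (J \<union> set fs)"

lemma ext_Nil: "ideal J (poly_ring n) \<Longrightarrow> ext n J [] = J"
  by (simp add: ext_def gen_of_ideal)

lemma ext_Cons:
  "ideal J (poly_ring n) \<Longrightarrow> set (f # fs) \<subseteq> polys n \<Longrightarrow> ext n J (f # fs) = adj n (ext n J fs) f"
  using gen_insert[of "J \<union> set fs" n f] ideal_subset[of J n] by (auto simp: ext_def)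

lemma ext_ideal: "ideal J (poly_ring n) \<Longrightarrow> set fs \<subseteq> polys n \<Longrightarrow> ideal (ext n J fs) (poly_ring n)"
  unfolding ext_def by (rule gen_ideal) (use ideal_subset in auto)

lemma ext_superset:
  assumes "ideal J (poly_ring n)" "set fs \<subseteq> polys n" shows "J \<subseteq> ext n J fs" "set fs \<subseteq> ext n J fs"
  using gen_superset[of "J \<union> set fs" n] ideal_subset[OF assms(1)] assms(2) by (auto simp: ext_def)

lemma ext_minimal: "ideal K (poly_ring n) \<Longrightarrow> J \<subseteq> K \<Longrightarrow> set fs \<subseteq> K \<Longrightarrow> ext n J fs \<subseteq> K"
  unfolding ext_def by (rule gen_minimal) auto

lemma ext_cong_set: "set fs = set gs \<Longrightarrow> ext n J fs = ext n J gs"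
  by (simp add: ext_def)

lemma ext_ext:
  assumes J: "ideal J (poly_ring n)" and f: "set fs \<subseteq> polys n" "set gs \<subseteq> polys n"
  shows "ext n (ext n J fs) gs = ext n J (fs @ gs)"
proof (rule equalityI)
  have I: "ideal (ext n J (fs @ gs)) (poly_ring n)" using f by (intro ext_ideal J) auto
  have s: "J \<subseteq> ext n J (fs @ gs)" "set (fs @ gs) \<subseteq> ext n J (fs @ gs)"
    using f by (intro ext_superset J; auto)+
  show "ext n (ext n J fs) gs \<subseteq> ext n J (fs @ gs)"
    using s by (intro ext_minimal I) auto
  have I2: "ideal (ext n J fs) (poly_ring n)" using f by (intro ext_ideal J)
  show "ext n J (fs @ gs) \<subseteq> ext n (ext n J fs) gs"
    using ext_superset[OF I2 f(2)] ext_superset[OF J f(1)] by (intro ext_minimal ext_ideal I2 f) auto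
qed

definition forms_of_degrees :: "nat \<Rightarrow> nat list \<Rightarrow> ('k::field) mpoly list \<Rightarrow> bool" where
  "forms_of_degrees n as fs \<longleftrightarrow> list_all2 (\<lambda>a f. a \<ge> 1 \<and> f \<in> forms n a) as fs"

lemma forms_of_degrees_simps [simp]:
  "forms_of_degrees n [] fs \<longleftrightarrow> fs = []"
  "forms_of_degrees n as [] \<longleftrightarrow> as = []"
  "forms_of_degrees n (a # as) (f # fs) \<longleftrightarrow> a \<ge> 1 \<and> f \<in> forms n a \<and> forms_of_degrees n as fs"
  by (simp_all add: forms_of_degrees_def)

lemma forms_of_degrees_append:
  "forms_of_degrees n as fs \<Longrightarrow> forms_of_degrees n bs gs \<Longrightarrow> forms_of_degrees n (as @ bs) (fs @ gs)"
  unfolding forms_of_degrees_def by (rule list_all2_appendI)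

lemma forms_of_degrees_polys: "forms_of_degrees n as fs \<Longrightarrow> set fs \<subseteq> polys n"
  by (induction as fs rule: list_induct2') (auto intro: forms_polys)

lemma forms_of_degrees_length: "forms_of_degrees n as fs \<Longrightarrow> length as = length fs"
  by (auto simp: forms_of_degrees_def list_all2_lengthD)

lemma forms_of_degrees_const:
  "e \<ge> 1 \<Longrightarrow> set fs \<subseteq> forms n e \<Longrightarrow> forms_of_degrees n (replicate (length fs) e) fs"
  by (induction fs) auto

lemma graded_ext_list: "graded n J \<Longrightarrow> set fs \<subseteq> (\<Union>a. forms n a) \<Longrightarrow> graded n (ext n J fs)"
proof (induction fs)
  case Nil
  thus ?case by (simp add: ext_Nil graded_ideal)
next
  case (Cons f fs)
  then obtain a where a: "f \<in> forms n a" by auto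
  have p: "set (f # fs) \<subseteq> polys n" using Cons.prems forms_polys by fast
  show ?case unfolding ext_Cons[OF graded_ideal[OF Cons.prems(1)] p] using Cons a by (intro graded_adj) auto
qed

lemma graded_ext: "graded n J \<Longrightarrow> forms_of_degrees n as fs \<Longrightarrow> graded n (ext n J fs)"
proof (rule graded_ext_list)
  show "forms_of_degrees n as fs \<Longrightarrow> set fs \<subseteq> (\<Union>a. forms n a)"
    by (induction as fs rule: list_induct2') auto
qed

section \<open>Growth of Hilbert functions\<close>

text \<open>This says \<open>dim R/J \<le> D\<close> without mentioning primes. Summation over all degrees up to \<open>t\<close> makes
\<open>D = 0\<close> the case of finite length.\<close>

definition growth :: "nat \<Rightarrow> ('k::field) mpoly set \<Rightarrow> nat \<Rightarrow> bool" where
  "growth n J D \<longleftrightarrow> (\<exists>c. \<forall>t. (\<Sum>u\<le>t. hilb n J u) \<le> c * (t + 1) ^ D)"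

definition finite_length :: "nat \<Rightarrow> ('k::field) mpoly set \<Rightarrow> bool" where
  "finite_length n J \<longleftrightarrow> (\<exists>t0. \<forall>t\<ge>t0. hilb n J t = 0)"

lemma growth_antimono: "growth n J D \<Longrightarrow> J \<subseteq> K \<Longrightarrow> growth n K D"
  unfolding growth_def by (meson hilb_antimono inf.coboundedI1 order_trans sum_mono)

lemma growth_cong: "(\<And>t. hilb n J t = hilb n K t) \<Longrightarrow> growth n J D \<longleftrightarrow> growth n K D"
  by (simp add: growth_def)

lemma growth_mono: assumes "growth n J D" "D \<le> E" shows "growth n J E"
proof -
  obtain c where c: "\<And>t. (\<Sum>u\<le>t. hilb n J u) \<le> c * (t + 1) ^ D" using assms by (auto simp: growth_def)
  have "(\<Sum>u\<le>t. hilb n J u) \<le> c * (t + 1) ^ E" for t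
    by (rule order_trans[OF c]) (intro mult_left_mono power_increasing assms, auto)
  thus ?thesis by (auto simp: growth_def)
qed

lemma finite_length_antimono: "finite_length n J \<Longrightarrow> J \<subseteq> K \<Longrightarrow> finite_length n K"
  unfolding finite_length_def by (metis hilb_antimono inf.coboundedI1 le_zero_eq)

lemma finite_length_iff:
  "ideal J (poly_ring n) \<Longrightarrow> finite_length n J \<longleftrightarrow> (\<exists>t0. \<forall>t\<ge>t0. forms n t \<subseteq> J)"
  by (simp add: finite_length_def hilb_eq_0_iff)

lemma growth_of_finite_length: assumes "finite_length n J" shows "growth n J 0"
proof -
  obtain t0 where t0: "\<And>t. t \<ge> t0 \<Longrightarrow> hilb n J t = 0" using assms by (auto simp: finite_length_def)
  have "(\<Sum>u\<le>t. hilb n J u) \<le> (\<Sum>u\<le>t0. hilb n J u)" for t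
  proof -
    have "(\<Sum>u\<le>t. hilb n J u) \<le> (\<Sum>u\<le>max t t0. hilb n J u)" by (rule sum_mono2) auto
    also have "\<dots> = (\<Sum>u\<le>t0. hilb n J u)" using t0 by (intro sum.mono_neutral_right) auto
    finally show ?thesis .
  qed
  thus ?thesis by (auto simp: growth_def)
qed

text \<open>By the exact sequence, the Hilbert function of \<open>R/J\<close> at \<open>t\<close> is at most the sum of the values of
that of \<open>R/(J + (f))\<close> at \<open>t, t - a, t - 2a, \<dots>\<close>, which are at most \<open>t + 1\<close> terms.\<close>

lemma growth_adj:
  assumes J: "graded n J" and f: "f \<in> forms n a" and a: "a \<ge> 1" and g: "growth n (adj n J f) D"
  shows "growth n J (Suc D)"
proof -
  obtain c where c: "\<And>t. (\<Sum>u\<le>t. hilb n (adj n J f) u) \<le> c * (t + 1) ^ D" using g by (auto simp: growth_def)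
  have colon: "hilb n (colon n J f) t \<le> hilb n J t" for t
    using colon_superset[OF graded_ideal[OF J] forms_polys[OF f]] by (intro hilb_antimono) auto
  have "(\<Sum>u\<le>t. hilb n J u) \<le> (t + 1) * (c * (t + 1) ^ D)" for t
  proof (induction t rule: less_induct)
    case (less t)
    have "(\<Sum>u\<le>t. hilb n J u) = (\<Sum>u\<le>t. hilb n (adj n J f) u) + (\<Sum>u\<le>t. if a \<le> u then hilb n (colon n J f) (u - a) else 0)"
      by (simp add: hilb_exact[OF J f] sum.distrib)
    also have "(\<Sum>u\<le>t. if a \<le> u then hilb n (colon n J f) (u - a) else 0) = (\<Sum>u\<in>{a..t}. hilb n (colon n J f) (u - a))"
      by (rule sum.mono_neutral_cong_right) auto
    also have "\<dots> \<le> (\<Sum>u\<in>{a..t}. hilb n J (u - a))" by (rule sum_mono) (rule colon)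
    also have "(\<Sum>u\<in>{a..t}. hilb n J (u - a)) \<le> t * (c * (t + 1) ^ D)"
    proof (cases "a \<le> t")
      case True
      have "(\<Sum>u\<in>{a..t}. hilb n J (u - a)) = (\<Sum>u\<le>t - a. hilb n J u)"
        by (rule sum.reindex_bij_witness[of _ "\<lambda>u. u + a" "\<lambda>u. u - a"]) (use True in auto)
      also have "\<dots> \<le> (t - a + 1) * (c * (t - a + 1) ^ D)" using less[of "t - a"] a True by simp
      also have "\<dots> \<le> t * (c * (t + 1) ^ D)"
        using a True by (intro mult_mono power_mono mult_left_mono) auto
      finally show ?thesis .
    qed simp
    finally show ?case using c[of t] by simp
  qed
  thus ?thesis unfolding growth_def by (intro exI[of _ c]) (simp add: mult.left_commute)
qed

lemma growth_ext:
  "graded n J \<Longrightarrow> forms_of_degrees n as fs \<Longrightarrow> growth n (ext n J fs) D \<Longrightarrow> growth n J (length fs + D)"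
proof (induction as fs arbitrary: D rule: list_induct2')
  case (4 a as f fs)
  have p: "set (f # fs) \<subseteq> polys n" using 4(3) forms_of_degrees_polys by blast
  have "growth n (ext n J fs) (Suc D)"
    using 4 ext_Cons[OF graded_ideal[OF 4(2)] p] graded_ext by (intro growth_adj[of n _ f a]) auto
  thus ?case using 4 by fastforce
qed (auto simp: ext_Nil graded_ideal)

lemma choose_lower: "(t + 1) ^ s \<le> fact s * (s + t choose t)"
proof (induction s)
  case (Suc s)
  have "(t + 1) ^ Suc s \<le> (Suc s + t) * (fact s * (s + t choose t))"
    using Suc by (simp only: power_Suc) (intro mult_mono, auto)
  also have "\<dots> = fact s * ((Suc s + t) * (s + t choose s))"
    using binomial_symmetric[of t "s + t"] by (simp only: mult.left_commute) simp
  also have "(Suc s + t) * (s + t choose s) = Suc s * (Suc s + t choose Suc s)"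
    using Suc_times_binomial_eq[of "s + t" s] by simp
  also have "(Suc s + t choose Suc s) = (Suc s + t choose t)"
    using binomial_symmetric[of t "Suc s + t"] by simp
  finally show ?case by (simp add: algebra_simps)
qed simp

text \<open>As a function of \<open>t\<close>, the binomial coefficient is a polynomial of degree \<open>s > D\<close>.\<close>

lemma choose_exceeds:
  assumes "D < s" shows "\<exists>t. c * (e * t + 1) ^ D < (s + t choose t)"
proof (rule ccontr)
  assume "\<not> ?thesis"
  hence le: "(s + t choose t) \<le> c * (e * t + 1) ^ D" for t by (simp add: not_less)
  \<comment> \<open>At \<open>t = B\<close> the lower bound \<open>(t + 1)\<^sup>s / s!\<close> exceeds \<open>c (e t + 1)\<^sup>D\<close>.\<close>
  define B where "B = fact s * c * (e + 1) ^ D"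
  have "(B + 1) * (B + 1) ^ D \<le> (B + 1) ^ s"
    using power_increasing[of "Suc D" s "B + 1"] assms by simp
  also have "\<dots> \<le> fact s * (c * (e * B + 1) ^ D)" using choose_lower[of B s] le[of B]
    by (rule order_trans[OF _ mult_le_mono2])
  also have "\<dots> \<le> fact s * (c * ((e + 1) * (B + 1)) ^ D)"
    by (intro mult_left_mono power_mono) (auto simp: algebra_simps)
  also have "\<dots> = (fact s * c * (e + 1) ^ D) * (B + 1) ^ D"
    by (simp only: power_mult_distrib mult.assoc)
  also have "\<dots> = B * (B + 1) ^ D" by (simp only: B_def[symmetric])
  finally show False by simp
qed

lemma sum_choose_diag: "(\<Sum>u\<le>t. s + u choose u) = (Suc s + t choose t)"
  by (induction t) simp_all

lemma hilb_zero: "hilb n ({0} :: ('k::field) mpoly set) t = (n + t - 1) choose t"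
proof -
  have "{0} \<inter> forms n t = ({0} :: 'k mpoly set)" by auto
  moreover have "mpoly_space.dim ({0} :: 'k mpoly set) \<le> card ({} :: 'k mpoly set)"
    by (rule mpoly_space.dim_le_card) auto
  ultimately show ?thesis by (simp add: hilb_def dim_forms)
qed

text \<open>The polynomial ring has dimension at least \<open>n\<close>.\<close>

lemma growth_zero_ideal: "growth n ({0} :: ('k::field) mpoly set) D \<Longrightarrow> n \<le> D"
proof (rule ccontr)
  assume "growth n ({0} :: 'k mpoly set) D" and D: "\<not> n \<le> D"
  then obtain c where c: "\<And>t. (\<Sum>u\<le>t. n + u - 1 choose u) \<le> c * (t + 1) ^ D"
    by (auto simp: growth_def hilb_zero)
  obtain m where m: "n = Suc m" using D by (cases n) auto
  have "(n + t choose t) \<le> c * (1 * t + 1) ^ D" for t using c[of t] by (simp add: m sum_choose_diag)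
  moreover obtain t where "c * (1 * t + 1) ^ D < (n + t choose t)" using choose_exceeds[of D n c 1] D by auto
  ultimately show False using not_le by blast
qed

section \<open>Elimination of forms\<close>

text \<open>A nonzero polynomial over an infinite field does not vanish everywhere. The coordinates of the point
are nonzero so that the last one can be normalized to \<open>1\<close> when a form is eliminated.\<close>

lemma nonvanishing_point:
  fixes c :: "(nat \<Rightarrow>\<^sub>0 nat) \<Rightarrow> 'k::field"
  assumes inf: "infinite (UNIV :: 'k set)"
  shows "finite A \<Longrightarrow> A \<noteq> {} \<Longrightarrow> A \<subseteq> exponents s \<Longrightarrow> (\<forall>m\<in>A. c m \<noteq> 0) \<Longrightarrow>
    \<exists>b. (\<forall>i. b i \<noteq> 0) \<and> (\<Sum>m\<in>A. c m * (\<Prod>i<s. b i ^ cf m i)) \<noteq> 0"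
proof (induction s arbitrary: A c)
  case 0
  hence "A = {0}" by (auto simp: exponents_def)
  thus ?case using 0 by (intro exI[of _ "\<lambda>_. 1"]) simp
next
  case (Suc s)
  obtain m0 where m0: "m0 \<in> A" using Suc.prems by blast
  define strip where "strip m = m - Poly_Mapping.single s (cf m s)" for m :: "nat \<Rightarrow>\<^sub>0 nat"
  have strip_cf: "cf (strip m) i = (if i = s then 0 else cf m i)" for m i
    by (simp add: strip_def lookup_minus lookup_single when_def)
  define A0 where "A0 k = {m \<in> A. cf m s = k}" for k
  have inj: "inj_on strip (A0 k)" for k
  proof (rule inj_onI, rule poly_mapping_eqI)
    fix m m' i assume "m \<in> A0 k" "m' \<in> A0 k" "strip m = strip m'"
    thus "cf m i = cf m' i" using strip_cf[of m i] strip_cf[of m' i] by (auto simp: A0_def split: if_splits)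
  qed
  define k0 where "k0 = cf m0 s"
  define c' where "c' m = c (the_inv_into (A0 k0) strip m)" for m
  have c': "c' (strip m) = c m" if "m \<in> A0 k0" for m
    using that inj by (simp add: c'_def the_inv_into_f_f)
  have "strip ` A0 k0 \<subseteq> exponents s"
  proof
    fix m' assume "m' \<in> strip ` A0 k0"
    then obtain m where m: "m' = strip m" "m \<in> A" by (auto simp: A0_def)
    have "i < s" if "i \<in> supp m'" for i
    proof -
      have "i \<noteq> s" "cf m i \<noteq> 0" using that strip_cf[of m i] by (auto simp: m(1) in_keys_iff split: if_splits)
      moreover have "i \<in> supp m" using \<open>cf m i \<noteq> 0\<close> by (simp add: in_keys_iff)
      hence "i < Suc s" using m(2) Suc.prems(3) by (auto simp: exponents_def)
      ultimately show ?thesis by simp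
    qed
    thus "m' \<in> exponents s" by (auto simp: exponents_def)
  qed
  moreover have "strip ` A0 k0 \<noteq> {}" using m0 by (auto simp: A0_def k0_def)
  moreover have "\<forall>m\<in>strip ` A0 k0. c' m \<noteq> 0" using c' Suc.prems(4) by (auto simp: A0_def)
  moreover have "finite (strip ` A0 k0)" using Suc.prems(1) by (simp add: A0_def)
  ultimately obtain b where b: "\<And>i. b i \<noteq> 0" "(\<Sum>m\<in>strip ` A0 k0. c' m * (\<Prod>i<s. b i ^ cf m i)) \<noteq> 0"
    using Suc.IH[of "strip ` A0 k0" c'] by blast
  define v where "v k = (\<Sum>m\<in>A0 k. c m * (\<Prod>i<s. b i ^ cf m i))" for k
  have "v k0 \<noteq> 0"
  proof -
    have "(\<Sum>m\<in>strip ` A0 k0. c' m * (\<Prod>i<s. b i ^ cf m i)) = v k0"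
      unfolding v_def sum.reindex[OF inj] by (intro sum.cong) (auto simp: c' strip_cf)
    thus ?thesis using b(2) by simp
  qed
  define N where "N = (\<Sum>m\<in>A. cf m s)"
  have N: "cf m s \<le> N" if "m \<in> A" for m
    unfolding N_def using that Suc.prems(1) by (intro member_le_sum) auto
  \<comment> \<open>Fixing the first \<open>s\<close> coordinates leaves a nonzero polynomial in the last one.\<close>
  define p where "p = (\<Sum>k\<le>N. Polynomial.monom (v k) k)"
  have "Polynomial.coeff p k0 = v k0"
    using N[OF m0] by (simp add: p_def coeff_sum k0_def)
  hence "p \<noteq> 0" using \<open>v k0 \<noteq> 0\<close> by auto
  hence "finite (insert 0 {x. poly p x = 0})" using poly_roots_finite[of p] by simp
  then obtain y where "y \<notin> insert 0 {x. poly p x = 0}" using ex_new_if_finite[OF inf] by blast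
  hence y: "y \<noteq> 0" "poly p y \<noteq> 0" by auto
  have "(\<Sum>m\<in>A. c m * (\<Prod>i<Suc s. (b(s := y)) i ^ cf m i)) = (\<Sum>m\<in>A. c m * (\<Prod>i<s. b i ^ cf m i) * y ^ cf m s)"
    by (intro sum.cong) (auto simp: mult.assoc)
  also have "\<dots> = (\<Sum>k\<le>N. \<Sum>m\<in>A0 k. c m * (\<Prod>i<s. b i ^ cf m i) * y ^ cf m s)"
    unfolding A0_def using Suc.prems(1) N by (intro sum.group[symmetric]) auto
  also have "\<dots> = (\<Sum>k\<le>N. v k * y ^ k)"
    unfolding v_def sum_distrib_right by (intro sum.cong) (auto simp: A0_def)
  also have "\<dots> = poly p y" by (simp add: p_def poly_sum poly_monom)
  finally have "(\<Sum>m\<in>A. c m * (\<Prod>i<Suc s. (b(s := y)) i ^ cf m i)) \<noteq> 0" using y(2) by simp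
  moreover have "\<forall>i. (b(s := y)) i \<noteq> 0" using b(1) y(1) by simp
  ultimately show ?case by blast
qed

lemma cong_mult:
  assumes K: "ideal K (poly_ring n)" and "x - y \<in> K" "x' - y' \<in> K" "x \<in> polys n" "y' \<in> polys n"
  shows "x * x' - y * y' \<in> K"
proof -
  have "x * x' - y * y' = x * (x' - y') + y' * (x - y)" by (simp add: algebra_simps)
  thus ?thesis using assms by (simp add: ideal_add[OF K] ideal_mult[OF K])
qed

lemma power_polys: "f \<in> polys n \<Longrightarrow> f ^ k \<in> polys n"
  by (induction k) (auto intro: mult_polys)

lemma prod_polys: "(\<And>i. i \<in> A \<Longrightarrow> f i \<in> polys n) \<Longrightarrow> prod f A \<in> polys n"
  by (induction A rule: infinite_finite_induct) (auto intro: mult_polys)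

lemma cong_power:
  assumes K: "ideal K (poly_ring n)" and "x - y \<in> K" "x \<in> polys n" "y \<in> polys n"
  shows "x ^ k - y ^ k \<in> K"
  by (induction k) (auto simp: ideal_zero[OF K] assms intro!: cong_mult[OF K] power_polys)

lemma cong_prod:
  assumes K: "ideal K (poly_ring n)" and "\<And>i. i \<in> A \<Longrightarrow> f i - g i \<in> K"
    "\<And>i. i \<in> A \<Longrightarrow> f i \<in> polys n" "\<And>i. i \<in> A \<Longrightarrow> g i \<in> polys n"
  shows "prod f A - prod g A \<in> K"
  using assms(2-) by (induction A rule: infinite_finite_induct)
    (auto simp: ideal_zero[OF K] intro!: cong_mult[OF K] prod_polys)

lemma power_forms: "f \<in> forms n e \<Longrightarrow> f ^ k \<in> forms n (e * k)"
proof (induction k)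
  case 0
  show ?case by (simp add: forms_def)
next
  case (Suc k)
  thus ?case using mult_forms[of f n e "f ^ k" "e * k"] by simp
qed

lemma prod_forms: "finite A \<Longrightarrow> (\<And>i. i \<in> A \<Longrightarrow> f i \<in> forms n (e i)) \<Longrightarrow> prod f A \<in> forms n (sum e A)"
proof (induction A rule: finite_induct)
  case empty
  show ?case by (simp add: forms_def)
qed (auto intro: mult_forms)

lemma scale_power: "(scale c f) ^ k = scale (c ^ k) (f ^ k)"
  by (induction k) (simp_all add: scale_mult_left scale_mult_right mult.commute)

lemma scale_prod: "(\<Prod>i\<in>A. scale (c i) (f i)) = scale (\<Prod>i\<in>A. c i) (\<Prod>i\<in>A. f i)"
  by (induction A rule: infinite_finite_induct) (simp_all add: scale_mult_left scale_mult_right mult.commute)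

text \<open>In high degrees every form of \<open>R/K\<close> is a multiple of \<open>g\<close>, hence, after iteration, of any power
of \<open>g\<close>.\<close>

lemma nilpotent_finite_length:
  fixes K :: "('k::field) mpoly set"
  assumes K: "graded n K" and g: "g \<in> forms n e" "g ^ u \<in> K" and fin: "finite_length n (adj n K g)"
  shows "finite_length n K"
proof -
  note I = graded_ideal[OF K]
  have gp: "g \<in> polys n" using g forms_polys by blast
  obtain t0 where t0: "\<And>t. t \<ge> t0 \<Longrightarrow> forms n t \<subseteq> adj n K g"
    using fin finite_length_iff[OF adj_ideal[OF I gp]] by auto
  have "forms n t \<subseteq> adj n K (g ^ k)" if "t \<ge> t0 + k * e" for k t
    using that
  proof (induction k arbitrary: t)
    case 0
    show ?case using forms_polys ideal_zero[OF I] by (fastforce simp: adj_def)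
  next
    case (Suc k)
    show ?case
    proof
      fix f :: "'k mpoly" assume f: "f \<in> forms n t"
      then obtain j h where jh: "f = j + h * g" "j \<in> K" "h \<in> polys n"
        using t0[of t] Suc.prems by (auto simp: adj_def)
      have "f = hcomp t j + hcomp (t - e) h * g"
        using hcomp_homogeneous[of f t t] f hcomp_mult_homogeneous[of g e t h] g(1) Suc.prems
        by (simp add: jh(1) hcomp_add forms_def)
      moreover have "hcomp (t - e) h \<in> adj n K (g ^ k)"
        using subsetD[OF Suc.IH[of "t - e"] hcomp_forms[OF jh(3)]] Suc.prems by simp
      then obtain j' h' where jh': "hcomp (t - e) h = j' + h' * g ^ k" "j' \<in> K" "h' \<in> polys n"
        by (auto simp: adj_def)
      ultimately have "f = (hcomp t j + g * j') + h' * g ^ Suc k" by (simp add: algebra_simps)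
      moreover have "hcomp t j + g * j' \<in> K"
        using graded_hcomp[OF K jh(2)] ideal_mult[OF I jh'(2) gp] by (rule ideal_add[OF I])
      ultimately show "f \<in> adj n K (g ^ Suc k)" unfolding adj_def using jh'(3) by blast
    qed
  qed
  moreover have "adj n K (g ^ u) \<subseteq> K" using g by (intro adj_minimal I) auto
  ultimately have "\<forall>t\<ge>t0 + u * e. forms n t \<subseteq> K" by blast
  thus ?thesis unfolding finite_length_iff[OF I] by blast
qed

text \<open>There are more monomials of degree \<open>u\<close> in the \<open>s\<close> forms than dimensions in degree \<open>e u\<close> of
\<open>R/J\<close>, so that the forms satisfy a homogeneous relation modulo \<open>J\<close>.\<close>

lemma form_relation:
  fixes J :: "('k::field) mpoly set" and g :: "nat \<Rightarrow> 'k mpoly"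
  assumes J: "graded n J" and g: "\<And>i. i < s \<Longrightarrow> g i \<in> forms n e"
    and small: "hilb n J (e * u) < (s + u - 1 choose u)"
  obtains F :: "'k mpoly" where "F \<noteq> 0" "supp F \<subseteq> mons {..<s} u"
    "(\<Sum>m\<in>supp F. scale (cf F m) (\<Prod>i<s. g i ^ cf m i)) \<in> J"
proof -
  define M where "M = mons {..<s} u"
  have finM: "finite M" by (simp add: M_def finite_mons)
  define \<phi> where "\<phi> F = (\<Sum>m\<in>M. scale (cf F m) (\<Prod>i<s. g i ^ cf m i))" for F :: "'k mpoly"
  define U where "U = {F :: 'k mpoly. supp F \<subseteq> M}"
  define W where "W = J \<inter> forms n (e * u)"
  have W: "mpoly_space.subspace W" "fin_dim W" unfolding W_def
    by (intro mpoly_space.subspace_inter ideal_subspace[OF graded_ideal[OF J]] forms_subspace)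
       (rule fin_dim_mono[OF fin_dim_forms], blast)
  have U: "mpoly_space.subspace U" "fin_dim U" "mpoly_space.dim U = card M"
    unfolding U_def using dim_supp_subset[OF finM] by (auto simp: span_monomials[symmetric])
  have mon: "(\<Prod>i<s. g i ^ cf m i) \<in> forms n (e * u)" if "m \<in> M" for m
  proof -
    have "(\<Prod>i<s. g i ^ cf m i) \<in> forms n (\<Sum>i<s. e * cf m i)"
      using g by (intro prod_forms power_forms) auto
    moreover have "(\<Sum>i<s. cf m i) = u" using that mdeg_superset[of "{..<s}" m] by (simp add: M_def mons_def)
    ultimately show ?thesis by (simp add: sum_distrib_left[symmetric])
  qed
  have phi: "\<phi> F \<in> forms n (e * u)" for F unfolding \<phi>_def
    using mon by (intro mpoly_space.subspace_sum[OF forms_subspace] mpoly_space.subspace_scale[OF forms_subspace])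
  have dims: "mpoly_space.dim {w + \<phi> F | w F. w \<in> W \<and> F \<in> U} + mpoly_space.dim {F \<in> U. \<phi> F \<in> W}
      = mpoly_space.dim W + mpoly_space.dim U"
    by (rule dim_sum_image[OF W U(1,2)])
       (simp_all add: \<phi>_def lookup_add mpoly_space.scale_left_distrib sum.distrib mpoly_space.scale_sum_right)
  have "mpoly_space.dim {w + \<phi> F | w F. w \<in> W \<and> F \<in> U} \<le> mpoly_space.dim (forms n (e * u) :: 'k mpoly set)"
    using phi by (intro dim_mono_fin[OF fin_dim_forms]) (auto simp: W_def intro: mpoly_space.subspace_add[OF forms_subspace])
  moreover have "mpoly_space.dim (forms n (e * u) :: 'k mpoly set) < mpoly_space.dim W + card M"
    using small mons_card[of "{..<s}" u] by (simp add: hilb_def W_def M_def)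
  ultimately have "mpoly_space.dim {F \<in> U. \<phi> F \<in> W} \<noteq> 0" using dims U(3) by simp
  moreover have "mpoly_space.dim {F \<in> U. \<phi> F \<in> W} \<le> card ({} :: 'k mpoly set)" if "{F \<in> U. \<phi> F \<in> W} \<subseteq> {0}"
    using that by (intro mpoly_space.dim_le_card) auto
  ultimately obtain F where F: "F \<in> U" "\<phi> F \<in> W" "F \<noteq> 0" by auto
  have "\<phi> F = (\<Sum>m\<in>supp F. scale (cf F m) (\<Prod>i<s. g i ^ cf m i))"
    unfolding \<phi>_def using F(1) finM by (intro sum.mono_neutral_right) (auto simp: U_def in_keys_iff)
  thus ?thesis using F that by (auto simp: U_def W_def M_def)
qed

text \<open>Let \<open>F\<close> be a relation of degree \<open>u\<close> between the forms modulo \<open>J\<close>, and let \<open>\<beta>\<close> be a point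
with last coordinate \<open>1\<close> at which \<open>F\<close> does not vanish. Modulo the new forms \<open>g\<^sub>i - \<beta>\<^sub>i g\<^sub>s\<close> every
\<open>g\<^sub>i\<close> becomes \<open>\<beta>\<^sub>i g\<^sub>s\<close>, so the relation becomes \<open>F(\<beta>) g\<^sub>s\<^sup>u = 0\<close>. Hence \<open>g\<^sub>s\<close> is nilpotent
modulo the new forms and can be dropped.\<close>

lemma eliminate_form:
  fixes J :: "('k::field) mpoly set" and g :: "nat \<Rightarrow> 'k mpoly"
  assumes inf: "infinite (UNIV :: 'k set)" and J: "graded n J"
    and g: "\<And>i. i \<le> s \<Longrightarrow> g i \<in> forms n e"
    and small: "hilb n J (e * u) < (s + u choose u)"
    and fin: "finite_length n (ext n J (map g [0..<Suc s]))"
  shows "\<exists>b. finite_length n (ext n J (map (\<lambda>i. g i - scale (b i) (g s)) [0..<s]))"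
proof -
  obtain F :: "'k mpoly" where F: "F \<noteq> 0" "supp F \<subseteq> mons {..<Suc s} u"
    and rel: "(\<Sum>m\<in>supp F. scale (cf F m) (\<Prod>i<Suc s. g i ^ cf m i)) \<in> J"
    using form_relation[OF J, of "Suc s" g e u] g small by (auto simp: less_Suc_eq_le)
  obtain b where b: "\<And>i. b i \<noteq> 0" and nz: "(\<Sum>m\<in>supp F. cf F m * (\<Prod>i<Suc s. b i ^ cf m i)) \<noteq> 0"
    using nonvanishing_point[OF inf, of "supp F" "Suc s" "cf F"] F exponents_mons[of "Suc s"]
    by (auto simp: in_keys_iff)
  \<comment> \<open>By homogeneity \<open>F\<close> does not vanish at the normalized point either.\<close>
  define \<beta> where "\<beta> i = b i / b s" for i
  define hs where "hs = map (\<lambda>i. g i - scale (\<beta> i) (g s)) [0..<s]"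
  define K where "K = ext n J hs"
  have hsf: "set hs \<subseteq> forms n e"
    using g by (auto simp: hs_def intro!: mpoly_space.subspace_diff[OF forms_subspace] mpoly_space.subspace_scale[OF forms_subspace])
  have I: "ideal J (poly_ring n)" by (rule graded_ideal[OF J])
  have hsp: "set hs \<subseteq> polys n" using hsf forms_polys by blast
  have K: "graded n K" unfolding K_def using hsf by (intro graded_ext_list J) auto
  note KI = graded_ideal[OF K]
  have JK: "J \<subseteq> K" and hK: "set hs \<subseteq> K" unfolding K_def using ext_superset[OF I hsp] by auto
  have gp: "g i \<in> polys n" if "i \<le> s" for i using g[OF that] forms_polys by blast
  have cong: "g i - scale (\<beta> i) (g s) \<in> K" if "i < Suc s" for i
  proof (cases "i = s")
    case True
    thus ?thesis using b[of s] ideal_zero[OF KI] by (simp add: \<beta>_def)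
  next
    case False
    thus ?thesis using hK that by (auto simp: hs_def)
  qed
  define C where "C = (\<Sum>m\<in>supp F. cf F m * (\<Prod>i<Suc s. \<beta> i ^ cf m i))"
  have deg: "(\<Sum>i<Suc s. cf m i) = u" if "m \<in> supp F" for m
    using that F(2) mdeg_superset[of "{..<Suc s}" m] by (auto simp: mons_def)
  have mono: "(\<Prod>i<Suc s. g i ^ cf m i) - scale (\<Prod>i<Suc s. \<beta> i ^ cf m i) (g s ^ u) \<in> K" if "m \<in> supp F" for m
  proof -
    have "(\<Prod>i<Suc s. g i ^ cf m i) - (\<Prod>i<Suc s. scale (\<beta> i) (g s) ^ cf m i) \<in> K"
      using gp cong by (intro cong_prod[OF KI] cong_power[OF KI] power_polys scale_polys) auto
    moreover have "(\<Prod>i<Suc s. scale (\<beta> i) (g s) ^ cf m i) = scale (\<Prod>i<Suc s. \<beta> i ^ cf m i) (g s ^ u)"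
      by (simp only: scale_power scale_prod power_sum[symmetric] deg[OF that])
    ultimately show ?thesis by simp
  qed
  have "(\<Sum>m\<in>supp F. scale (cf F m) ((\<Prod>i<Suc s. g i ^ cf m i) - scale (\<Prod>i<Suc s. \<beta> i ^ cf m i) (g s ^ u))) \<in> K"
    using mono by (intro ideal_sum[OF KI] ideal_scale[OF KI])
  moreover have "(\<Sum>m\<in>supp F. scale (cf F m) ((\<Prod>i<Suc s. g i ^ cf m i) - scale (\<Prod>i<Suc s. \<beta> i ^ cf m i) (g s ^ u)))
      = (\<Sum>m\<in>supp F. scale (cf F m) (\<Prod>i<Suc s. g i ^ cf m i)) - scale C (g s ^ u)"
    unfolding C_def mpoly_space.scale_right_diff_distrib sum_subtractf mpoly_space.scale_sum_left
      mpoly_space.scale_scale ..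
  ultimately have "(\<Sum>m\<in>supp F. scale (cf F m) (\<Prod>i<Suc s. g i ^ cf m i)) - scale C (g s ^ u) \<in> K" by simp
  hence "scale C (g s ^ u) \<in> K"
    using ideal_diff[OF KI, of "\<Sum>m\<in>supp F. scale (cf F m) (\<Prod>i<Suc s. g i ^ cf m i)"
        "(\<Sum>m\<in>supp F. scale (cf F m) (\<Prod>i<Suc s. g i ^ cf m i)) - scale C (g s ^ u)"] rel JK by auto
  moreover have "C \<noteq> 0"
  proof -
    have "(\<Sum>m\<in>supp F. cf F m * (\<Prod>i<Suc s. b i ^ cf m i)) = (\<Sum>m\<in>supp F. b s ^ u * (cf F m * (\<Prod>i<Suc s. \<beta> i ^ cf m i)))"
    proof (rule sum.cong[OF refl])
      fix m assume m: "m \<in> supp F"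
      have "(\<Prod>i<Suc s. b i ^ cf m i) = (\<Prod>i<Suc s. b s ^ cf m i * \<beta> i ^ cf m i)"
        using b[of s] by (simp only: \<beta>_def power_mult_distrib[symmetric]) simp
      also have "\<dots> = b s ^ u * (\<Prod>i<Suc s. \<beta> i ^ cf m i)"
        by (simp only: prod.distrib power_sum[symmetric] deg[OF m])
      finally show "cf F m * (\<Prod>i<Suc s. b i ^ cf m i) = b s ^ u * (cf F m * (\<Prod>i<Suc s. \<beta> i ^ cf m i))"
        by (simp only: mult.left_commute)
    qed
    also have "\<dots> = b s ^ u * C" by (simp only: C_def sum_distrib_left)
    finally show ?thesis using nz by auto
  qed
  ultimately have "g s ^ u \<in> K" using ideal_scale[OF KI, of "scale C (g s ^ u)" "inverse C"] by simp
  moreover have "finite_length n (adj n K (g s))"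
  proof (rule finite_length_antimono[OF fin])
    have A: "ideal (adj n K (g s)) (poly_ring n)" using gp by (intro adj_ideal KI) auto
    have "g i \<in> adj n K (g s)" if "i < Suc s" for i
    proof -
      have "g i = (g i - scale (\<beta> i) (g s)) + Poly_Mapping.single 0 (\<beta> i) * g s" by (simp add: scale_def)
      thus ?thesis unfolding adj_def using cong[OF that] single_polys[OF exponents_0] by blast
    qed
    thus "ext n J (map g [0..<Suc s]) \<subseteq> adj n K (g s)"
      using JK adj_superset[of K n "g s"] by (intro ext_minimal A) (auto simp del: upt_Suc)
  qed
  ultimately have "finite_length n K" using g by (intro nilpotent_finite_length[OF K, of "g s" e u]) auto
  thus ?thesis unfolding K_def hs_def by blast
qed

text \<open>More than \<open>D\<close> forms cannot be independent modulo an ideal of growth \<open>D\<close>, so that elimination goes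
on until \<open>D\<close> forms are left. The last form is always the one that is eliminated. Therefore, for \<open>D \<ge> 1\<close>, the
first form changes only by combinations of the others, which is how \<open>choose_form\<close> keeps control of the
degrees of the remaining generators.\<close>

lemma eliminate_to_dimension:
  fixes J :: "('k::field) mpoly set"
  assumes inf: "infinite (UNIV :: 'k set)" and J: "graded n J" and e: "e \<ge> 1" and gr: "growth n J D"
  shows "set gs \<subseteq> forms n e \<Longrightarrow> finite_length n (ext n J gs) \<Longrightarrow>
    \<exists>ys. length ys = D \<and> set ys \<subseteq> forms n e \<and> finite_length n (ext n J ys) \<and>
      (D \<ge> 1 \<longrightarrow> gs \<noteq> [] \<longrightarrow> hd ys - hd gs \<in> mpoly_space.span (set (tl gs)))"
proof (induction "length gs" arbitrary: gs)
  case (0 gs)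
  have z: "set (replicate D (0 :: 'k mpoly)) \<subseteq> {0}" by auto
  have "ext n J gs \<subseteq> ext n J (replicate D 0)"
    unfolding ext_def using 0(1) z by (intro gen_mono) (use ideal_subset[OF graded_ideal[OF J]] in auto)
  hence "finite_length n (ext n J (replicate D 0))" using 0(3) finite_length_antimono by blast
  moreover have "set (replicate D 0) \<subseteq> forms n e" using z by auto
  moreover have "gs = []" using 0(1) by simp
  ultimately show ?case by (intro exI[of _ "replicate D 0"]) simp
next
  case (Suc s gs)
  have I: "ideal J (poly_ring n)" by (rule graded_ideal[OF J])
  show ?case
  proof (cases "length gs \<le> D")
    case True
    \<comment> \<open>A list that is too short is padded with zeros.\<close>
    define ys where "ys = gs @ replicate (D - length gs) 0"
    have yf: "set ys \<subseteq> forms n e" using Suc.prems(1) by (auto simp: ys_def)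
    hence yp: "set ys \<subseteq> polys n" using forms_polys by blast
    have "ext n J gs \<subseteq> ext n J ys"
      using ext_superset[OF I yp] by (intro ext_minimal ext_ideal I yp) (auto simp: ys_def)
    hence "finite_length n (ext n J ys)" using Suc.prems(2) finite_length_antimono by blast
    moreover have "hd ys - hd gs = 0" using Suc.hyps(2) by (cases gs) (auto simp: ys_def)
    hence "hd ys - hd gs \<in> mpoly_space.span (set (tl gs))" using mpoly_space.span_zero by metis
    moreover have "length ys = D" using True by (simp add: ys_def)
    ultimately show ?thesis using yf by blast
  next
    case False
    have D: "D < Suc s" using False Suc.hyps(2) by simp
    obtain c where c: "\<And>t. (\<Sum>u\<le>t. hilb n J u) \<le> c * (t + 1) ^ D" using gr by (auto simp: growth_def)
    have "\<exists>u. hilb n J (e * u) < (s + u choose u)"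
    proof (rule ccontr)
      assume "\<not> ?thesis"
      hence le: "(s + u choose u) \<le> hilb n J (e * u)" for u by (simp add: not_less)
      have "(Suc s + t choose t) \<le> c * (e * t + 1) ^ D" for t
      proof -
        have "(Suc s + t choose t) \<le> (\<Sum>u\<le>t. hilb n J (e * u))"
          unfolding sum_choose_diag[symmetric] by (intro sum_mono le)
        also have "\<dots> = (\<Sum>v\<in>(\<lambda>u. e * u) ` {..t}. hilb n J v)"
          using e by (subst sum.reindex) (auto simp: inj_on_def)
        also have "\<dots> \<le> (\<Sum>v\<le>e * t. hilb n J v)" by (rule sum_mono2) auto
        finally show ?thesis using c[of "e * t"] by simp
      qed
      moreover obtain t where "c * (e * t + 1) ^ D < (Suc s + t choose t)" using choose_exceeds[OF D, of c e] by blast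
      ultimately show False using not_le by blast
    qed
    then obtain u where u: "hilb n J (e * u) < (s + u choose u)" by blast
    have gs: "map (\<lambda>i. gs ! i) [0..<Suc s] = gs" using map_nth[of gs] Suc.hyps(2) by simp
    have gf: "gs ! i \<in> forms n e" if "i \<le> s" for i
    proof -
      have "gs ! i \<in> set gs" using that Suc.hyps(2) by (intro nth_mem) simp
      thus ?thesis using Suc.prems(1) by blast
    qed
    obtain b where b: "finite_length n (ext n J (map (\<lambda>i. gs ! i - scale (b i) (gs ! s)) [0..<s]))"
      using eliminate_form[OF inf J, of s "\<lambda>i. gs ! i" e u] gf u Suc.prems(2) unfolding gs by blast
    define hs where "hs = map (\<lambda>i. gs ! i - scale (b i) (gs ! s)) [0..<s]"
    have hf: "set hs \<subseteq> forms n e"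
      using gf by (auto simp: hs_def intro!: mpoly_space.subspace_diff[OF forms_subspace] mpoly_space.subspace_scale[OF forms_subspace])
    obtain ys where ys: "length ys = D" "set ys \<subseteq> forms n e" "finite_length n (ext n J ys)"
      "D \<ge> 1 \<longrightarrow> hs \<noteq> [] \<longrightarrow> hd ys - hd hs \<in> mpoly_space.span (set (tl hs))"
      using Suc.hyps(1)[of hs] hf b by (auto simp: hs_def)
    have "hd ys - hd gs \<in> mpoly_space.span (set (tl gs))" if D1: "D \<ge> 1"
    proof -
      have s1: "s \<ge> 1" using D1 D by simp
      have tl: "gs ! i \<in> set (tl gs)" if "1 \<le> i" "i \<le> s" for i
        using that Suc.hyps(2) nth_mem[of "i - 1" "tl gs"] by (simp add: nth_tl)
      have hd: "hd gs = gs ! 0" using Suc.hyps(2) by (cases gs) auto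
      have hdh: "hd hs = gs ! 0 - scale (b 0) (gs ! s)" using s1 by (simp add: hs_def hd_map)
      have "set (tl hs) \<subseteq> (\<lambda>i. gs ! i - scale (b i) (gs ! s)) ` {1..<s}"
        by (auto simp: hs_def map_tl[symmetric])
      also have "\<dots> \<subseteq> mpoly_space.span (set (tl gs))"
        using tl s1 by (auto intro!: mpoly_space.span_diff mpoly_space.span_scale intro: mpoly_space.span_base)
      finally have "mpoly_space.span (set (tl hs)) \<subseteq> mpoly_space.span (set (tl gs))"
        by (rule mpoly_space.span_minimal) (rule mpoly_space.subspace_span)
      moreover have "hs \<noteq> []" using s1 by (simp add: hs_def)
      ultimately have "hd ys - hd hs \<in> mpoly_space.span (set (tl gs))" using ys(4) D1 by blast
      moreover have "scale (b 0) (gs ! s) \<in> mpoly_space.span (set (tl gs))"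
        using tl[of s] s1 by (intro mpoly_space.span_scale mpoly_space.span_base) auto
      ultimately have "(hd ys - hd hs) - scale (b 0) (gs ! s) \<in> mpoly_space.span (set (tl gs))"
        by (rule mpoly_space.span_diff)
      thus ?thesis by (simp add: hd hdh)
    qed
    thus ?thesis using ys by blast
  qed
qed

definition var :: "nat \<Rightarrow> ('k::field) mpoly" where
  "var i = monomial (Poly_Mapping.single i 1)"

lemma var_forms: "i < n \<Longrightarrow> var i \<in> forms n 1"
  unfolding var_def by (rule monomial_forms) (simp add: mons_def)

lemma forms_subset_of_monomials:
  fixes K :: "('k::field) mpoly set"
  assumes K: "ideal K (poly_ring n)"
    and m: "\<And>m. m \<in> mons {..<n} t \<Longrightarrow> monomial m \<in> K"
  shows "forms n t \<subseteq> K"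
proof
  fix f :: "'k mpoly" assume "f \<in> forms n t"
  hence "(\<Sum>k\<in>supp f. scale (cf f k) (monomial k)) \<in> K"
    by (intro ideal_sum[OF K] ideal_scale[OF K] m) (auto simp: forms_iff)
  thus "f \<in> K" unfolding single_eq_scale[symmetric] poly_expansion[of f, symmetric] .
qed

lemma monomial_add: "(monomial (a + b) :: ('k::field) mpoly) = monomial a * monomial b"
  by (simp add: monomial_def mult_single)

lemma monomial_polys: "m \<in> exponents n \<Longrightarrow> monomial m \<in> polys n"
  by (simp add: monomial_def single_polys)

lemma forms_upward:
  fixes K :: "('k::field) mpoly set"
  assumes K: "ideal K (poly_ring n)" and s: "forms n s \<subseteq> K"
  shows "forms n (s + k) \<subseteq> K"
proof (induction k)
  case (Suc k)
  show ?case
  proof (rule forms_subset_of_monomials[OF K])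
    fix m assume m: "m \<in> mons {..<n} (s + Suc k)"
    hence "m \<noteq> 0" by (auto simp: mons_def)
    then obtain i where i: "cf m i \<noteq> 0" by (auto simp: poly_mapping_eq_iff fun_eq_iff)
    hence "i \<in> supp m" by (simp add: in_keys_iff)
    hence "i < n" using m by (auto simp: mons_def)
    hence v: "(var i :: 'k mpoly) \<in> polys n" using var_forms forms_polys by blast
    let ?m = "m - Poly_Mapping.single i 1"
    have eq: "?m + Poly_Mapping.single i 1 = m" by (rule add_minus_single[OF i])
    hence "mdeg ?m = s + k" using m mdeg_add[of ?m "Poly_Mapping.single i 1"] by (simp add: mons_def)
    moreover have "supp ?m \<subseteq> {..<n}"
      using m by (auto simp: mons_def in_keys_iff lookup_minus subset_iff)
    ultimately have "monomial ?m \<in> K" using Suc monomial_forms[of ?m n "s + k"] by (auto simp: mons_def)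
    hence "var i * monomial ?m \<in> K" by (rule ideal_mult[OF K _ v])
    hence "monomial (?m + Poly_Mapping.single i 1) \<in> K" by (simp add: monomial_add var_def mult.commute)
    thus "monomial m \<in> K" unfolding eq .
  qed
qed (use s in simp)

lemma forms_in_ideal_of_linear:
  fixes K :: "('k::field) mpoly set"
  assumes "ideal K (poly_ring n)" "forms n 1 \<subseteq> K" "t \<ge> 1"
  shows "forms n t \<subseteq> K"
  using forms_upward[OF assms(1,2), of "t - 1"] assms(3) by simp

text \<open>Noether normalization: the variables are eliminated down to \<open>D\<close> linear forms.\<close>

lemma exists_linear_reduction:
  fixes J :: "('k::field) mpoly set"
  assumes inf: "infinite (UNIV :: 'k set)" and J: "graded n J" and gr: "growth n J D"
  obtains zs where "length zs = D" "set zs \<subseteq> forms n 1" "finite_length n (ext n J zs)"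
proof -
  define xs where "xs = map (var :: nat \<Rightarrow> 'k mpoly) [0..<n]"
  have xf: "set xs \<subseteq> forms n 1" using var_forms[of _ n] by (auto simp: xs_def)
  have xp: "set xs \<subseteq> polys n" using xf forms_polys by blast
  have I: "ideal (ext n J xs) (poly_ring n)" by (intro ext_ideal graded_ideal J xp)
  have "monomial m \<in> ext n J xs" if m: "m \<in> mons {..<n} 1" for m
  proof -
    obtain i where i: "cf m i \<noteq> 0" using m by (force simp: mons_def poly_mapping_eq_iff fun_eq_iff mdeg_def)
    have "i \<in> supp m" using i by (simp add: in_keys_iff)
    hence i': "i < n" using m by (auto simp: mons_def)
    have eq: "m - Poly_Mapping.single i 1 + Poly_Mapping.single i 1 = m" by (rule add_minus_single[OF i])
    hence "mdeg (m - Poly_Mapping.single i 1) = 0"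
      using m mdeg_add[of "m - Poly_Mapping.single i 1" "Poly_Mapping.single i 1"] by (simp add: mons_def)
    hence "m = Poly_Mapping.single i 1" using eq by (simp add: mdeg_eq_0)
    hence "monomial m \<in> set xs" using i' by (auto simp: xs_def var_def)
    thus ?thesis using ext_superset(2)[OF graded_ideal[OF J] xp] by blast
  qed
  hence "forms n 1 \<subseteq> ext n J xs" by (rule forms_subset_of_monomials[OF I])
  hence "\<forall>t\<ge>1. forms n t \<subseteq> ext n J xs" using forms_in_ideal_of_linear[OF I] by blast
  hence "finite_length n (ext n J xs)" unfolding finite_length_iff[OF I] by blast
  thus ?thesis using eliminate_to_dimension[OF inf J _ gr xf] that by auto
qed

unbundle fps_syntax

section \<open>Hilbert series\<close>

definition hilbert_series :: "nat \<Rightarrow> ('k::field) mpoly set \<Rightarrow> int fps" where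
  "hilbert_series n J = Abs_fps (\<lambda>t. int (hilb n J t))"

text \<open>The coefficientwise order. Multiplication by a series with nonnegative coefficients preserves it.\<close>

definition fps_le :: "int fps \<Rightarrow> int fps \<Rightarrow> bool" where
  "fps_le f g \<longleftrightarrow> (\<forall>t. f $ t \<le> g $ t)"

text \<open>The series \<open>1 / (1 - X\<^sup>a)\<close>.\<close>

definition geo :: "nat \<Rightarrow> int fps" where
  "geo a = Abs_fps (\<lambda>t. if a dvd t then 1 else 0)"

lemma hs_nth [simp]: "hilbert_series n J $ t = int (hilb n J t)" by (simp add: hilbert_series_def)

lemma geo_inverse: "a \<ge> 1 \<Longrightarrow> (1 - fps_X ^ a) * geo a = 1"
  by (rule fps_ext) (auto simp: left_diff_distrib fps_X_power_mult_nth geo_def dvd_diff_nat intro: dvd_diffD)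

lemma fps_le_refl [simp]: "fps_le f f" by (simp add: fps_le_def)
lemma fps_le_trans: "fps_le f g \<Longrightarrow> fps_le g h \<Longrightarrow> fps_le f h"
  unfolding fps_le_def by (blast intro: order_trans)
lemma fps_le_antisym: "fps_le f g \<Longrightarrow> fps_le g f \<Longrightarrow> f = g"
  unfolding fps_le_def by (blast intro: fps_ext antisym)

lemma fps_le_mult_left: "fps_le 0 h \<Longrightarrow> fps_le f g \<Longrightarrow> fps_le (h * f) (h * g)"
  by (auto simp: fps_le_def fps_mult_nth intro!: sum_mono mult_left_mono)

lemma fps_nonneg_mult: "fps_le 0 f \<Longrightarrow> fps_le 0 g \<Longrightarrow> fps_le 0 (f * g)"
  by (auto simp: fps_le_def fps_mult_nth intro!: sum_nonneg)

lemma geo_nonneg: "fps_le 0 (geo a)" by (simp add: fps_le_def geo_def)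

lemma hs_nonneg: "fps_le 0 (hilbert_series n J)" by (simp add: fps_le_def)

lemma prod_geo_nonneg: "fps_le 0 (prod_list (map geo as))"
proof (induction as)
  case Nil
  show ?case by (simp add: fps_le_def fps_one_nth)
qed (auto intro: fps_nonneg_mult geo_nonneg)

lemma hs_exact:
  assumes "graded n J" "f \<in> forms n a"
  shows "hilbert_series n J = hilbert_series n (adj n J f) + fps_X ^ a * hilbert_series n (colon n J f)"
  by (rule fps_ext) (auto simp: fps_X_power_mult_nth hilb_exact[OF assms])

text \<open>The kernel term of the exact sequence is a quotient of \<open>R/J\<close>, so that \<open>(1 - X\<^sup>a) H(R/J)\<close> is at
most \<open>H(R/(J + (f)))\<close>, with equality if and only if \<open>f\<close> is a nonzerodivisor on \<open>R/J\<close>.\<close>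

lemma hs_adj_ge:
  assumes J: "graded n J" and f: "f \<in> forms n a" and a: "a \<ge> 1"
  shows "fps_le (hilbert_series n J) (geo a * hilbert_series n (adj n J f))"
proof -
  have mono: "hilb n (colon n J f) t \<le> hilb n J t" for t
    using colon_superset[OF graded_ideal[OF J] forms_polys[OF f]] by (intro hilb_antimono) auto
  have "((1 - fps_X ^ a) * hilbert_series n J) $ t \<le> hilbert_series n (adj n J f) $ t" for t
    using hilb_exact[OF J f, of t] mono[of "t - a"] by (simp add: left_diff_distrib fps_X_power_mult_nth)
  hence "fps_le ((1 - fps_X ^ a) * hilbert_series n J) (hilbert_series n (adj n J f))" by (simp add: fps_le_def)
  hence "fps_le (geo a * ((1 - fps_X ^ a) * hilbert_series n J)) (geo a * hilbert_series n (adj n J f))"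
    by (rule fps_le_mult_left[OF geo_nonneg])
  moreover have "geo a * ((1 - fps_X ^ a) * hilbert_series n J) = hilbert_series n J"
    using geo_inverse[OF a] by (simp add: mult.assoc[symmetric] mult.commute)
  ultimately show ?thesis by simp
qed

lemma hs_ext_ge:
  assumes "graded n J"
  shows "forms_of_degrees n as fs \<Longrightarrow> fps_le (hilbert_series n J) (prod_list (map geo as) * hilbert_series n (ext n J fs))"
proof (induction as fs rule: list_induct2')
  case 1
  show ?case using assms by (simp add: ext_Nil graded_ideal)
next
  case (4 a as f fs)
  have p: "set (f # fs) \<subseteq> polys n" using 4(2) forms_of_degrees_polys by blast
  have IH: "fps_le (hilbert_series n J) (prod_list (map geo as) * hilbert_series n (ext n J fs))" using 4 by simp
  have "fps_le (hilbert_series n (ext n J fs)) (geo a * hilbert_series n (ext n J (f # fs)))"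
    unfolding ext_Cons[OF graded_ideal[OF assms] p] using 4 assms by (intro hs_adj_ge graded_ext) auto
  from fps_le_trans[OF IH fps_le_mult_left[OF prod_geo_nonneg this]] show ?case
    by (simp add: mult_ac)
qed auto

lemma geo_1_Suc: "(geo 1 ^ Suc m) $ Suc t = (geo 1 ^ Suc m) $ t + (geo 1 ^ m) $ Suc t"
proof -
  have "(1 - fps_X) * geo 1 ^ Suc m = ((1 - fps_X ^ 1) * geo 1) * geo 1 ^ m"
    by (simp only: power_Suc mult.assoc power_one_right)
  hence "(1 - fps_X) * geo 1 ^ Suc m = geo 1 ^ m" by (simp only: geo_inverse[OF order_refl] mult_1_left)
  hence "((1 - fps_X) * geo 1 ^ Suc m) $ Suc t = (geo 1 ^ m) $ Suc t" by (simp only:)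
  thus ?thesis by (simp only: left_diff_distrib fps_sub_nth mult_1_left fps_X_mult_nth) simp
qed

lemma geo_1_power_nth: "(geo 1 ^ m) $ t = int ((m + t - 1) choose t)"
proof (induction m arbitrary: t)
  case 0
  show ?case by (cases t) (auto simp: fps_one_nth)
next
  case (Suc m)
  note IH = Suc.IH
  show ?case
  proof (induction t)
    case 0
    show ?case by (simp add: fps_power_zeroth geo_def)
  next
    case (Suc t)
    show ?case unfolding geo_1_Suc Suc IH by simp
  qed
qed

lemma hs_zero: "hilbert_series n {0} = geo 1 ^ n"
  by (rule fps_ext) (simp add: hilb_zero geo_1_power_nth[unfolded One_nat_def])

section \<open>Complete intersections\<close>

definition one_minus :: "nat list \<Rightarrow> int fps" where
  "one_minus as = prod_list (map (\<lambda>a. 1 - fps_X ^ a) as)"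

lemma one_minus_geo: "(\<forall>a\<in>set as. a \<ge> 1) \<Longrightarrow> one_minus as * prod_list (map geo as) = 1"
proof (induction as)
  case (Cons a as)
  have "one_minus (a # as) * prod_list (map geo (a # as))
      = ((1 - fps_X ^ a) * geo a) * (one_minus as * prod_list (map geo as))"
    by (simp add: one_minus_def mult_ac)
  also have "\<dots> = 1" using Cons geo_inverse[of a] by simp
  finally show ?case .
qed (simp add: one_minus_def)

lemma forms_of_degrees_pos: "forms_of_degrees n as fs \<Longrightarrow> \<forall>a\<in>set as. a \<ge> 1"
  by (induction as fs rule: list_induct2') auto

text \<open>For forms of degrees \<open>as\<close> this equality of Hilbert series characterizes regular sequences. It is
visibly independent of the order of the forms, and this replaces the theorem that homogeneous regular
sequences can be permuted.\<close>

definition complete_intersection :: "nat \<Rightarrow> nat list \<Rightarrow> ('k::field) mpoly list \<Rightarrow> bool" where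
  "complete_intersection n as fs \<longleftrightarrow> hilbert_series n (ext n {0} fs) = one_minus as * hilbert_series n ({0} :: 'k mpoly set)"

text \<open>In the chain of inequalities \<open>H(R) \<le> P H(R/(fs)) \<le> P H(R/(f, fs)) / (1 - X\<^sup>a)\<close>, where \<open>P\<close>
is the product of the \<open>1 / (1 - X\<^sup>b)\<close> for the degrees \<open>b\<close> of \<open>fs\<close>, the two ends agree by
assumption. So both steps are equalities.\<close>

lemma complete_intersection_Cons:
  fixes f :: "('k::field) mpoly"
  assumes f: "forms_of_degrees n (a # as) (f # fs)" and ci: "complete_intersection n (a # as) (f # fs)"
  shows "complete_intersection n as fs"
    and "hilbert_series n (adj n (ext n {0} fs) f) = (1 - fps_X ^ a) * hilbert_series n (ext n {0} fs)"
proof -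
  let ?P = "prod_list (map geo as)" and ?J = "ext n {0} fs"
  have p: "set (f # fs) \<subseteq> polys n" using f forms_of_degrees_polys by blast
  have f': "forms_of_degrees n as fs" "a \<ge> 1" "f \<in> forms n a" using f by auto
  have J: "graded n ?J" by (rule graded_ext[OF graded_zero f'(1)])
  have ext: "ext n {0} (f # fs) = adj n ?J f" by (rule ext_Cons[OF graded_ideal[OF graded_zero] p])
  have le1: "fps_le (hilbert_series n ({0} :: 'k mpoly set)) (?P * hilbert_series n ?J)" by (rule hs_ext_ge[OF graded_zero f'(1)])
  have "fps_le (?P * hilbert_series n ?J) (?P * (geo a * hilbert_series n (adj n ?J f)))"
    by (intro fps_le_mult_left prod_geo_nonneg hs_adj_ge J f')
  also have eq: "?P * (geo a * hilbert_series n (adj n ?J f)) = hilbert_series n ({0} :: 'k mpoly set)"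
  proof -
    have "?P * (geo a * hilbert_series n (adj n ?J f)) = (one_minus (a # as) * prod_list (map geo (a # as))) * hilbert_series n ({0} :: 'k mpoly set)"
      using ci unfolding complete_intersection_def ext by (simp add: mult_ac)
    thus ?thesis unfolding one_minus_geo[OF forms_of_degrees_pos[OF f]] by simp
  qed
  finally have e: "hilbert_series n ({0} :: 'k mpoly set) = ?P * hilbert_series n ?J" using le1 fps_le_antisym by blast
  have inv: "one_minus as * ?P = 1" by (rule one_minus_geo[OF forms_of_degrees_pos[OF f'(1)]])
  hence "one_minus as * hilbert_series n ({0} :: 'k mpoly set) = hilbert_series n ?J" unfolding e by (simp add: mult.assoc[symmetric])
  thus "complete_intersection n as fs" by (simp add: complete_intersection_def)
  have "?P * (geo a * hilbert_series n (adj n ?J f)) = ?P * hilbert_series n ?J" using eq e by simp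
  hence "one_minus as * (?P * (geo a * hilbert_series n (adj n ?J f))) = one_minus as * (?P * hilbert_series n ?J)" by simp
  hence "geo a * hilbert_series n (adj n ?J f) = hilbert_series n ?J" using inv by (simp add: mult.assoc[symmetric])
  hence "(1 - fps_X ^ a) * (geo a * hilbert_series n (adj n ?J f)) = (1 - fps_X ^ a) * hilbert_series n ?J" by simp
  thus "hilbert_series n (adj n ?J f) = (1 - fps_X ^ a) * hilbert_series n ?J"
    using geo_inverse[OF f'(2)] by (simp add: mult.assoc[symmetric])
qed

lemma hilb_ext_0:
  "forms_of_degrees n as fs \<Longrightarrow> hilb n (ext n {0} fs) 0 = 1"
proof (induction as fs rule: list_induct2')
  case 1
  show ?case by (simp add: ext_Nil graded_ideal[OF graded_zero] hilb_zero)
next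
  case (4 a as f fs)
  have p: "set (f # fs) \<subseteq> polys n" using 4(2) forms_of_degrees_polys by blast
  have "hilb n (ext n {0} fs) 0 = hilb n (adj n (ext n {0} fs) f) 0"
    using hilb_exact[of n "ext n {0} fs" f a 0] 4 graded_ext[OF graded_zero, of n as fs] by simp
  thus ?case using 4 ext_Cons[OF graded_ideal[OF graded_zero] p] by simp
qed auto

text \<open>The colon ideal is proper, so that its quotient has dimension \<open>1\<close> in degree \<open>0\<close>.\<close>

lemma hilb_adj_linear:
  fixes J :: "('k::field) mpoly set"
  assumes J: "graded n J" and z: "z \<in> forms n 1" "z \<notin> J"
  shows "hilb n J 1 = hilb n (adj n J z) 1 + 1"
proof -
  have C: "ideal (colon n J z) (poly_ring n)" using z by (intro colon_ideal graded_ideal J) (rule forms_polys)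
  have "hilb n (colon n J z) 0 \<noteq> 0"
  proof
    assume "hilb n (colon n J z) 0 = 0"
    hence "1 \<in> colon n J z" using hilb_eq_0_iff[OF C] power_forms[of "0 :: 'k mpoly" n 0 0] by auto
    thus False using z by (simp add: colon_def)
  qed
  moreover have "hilb n (colon n J z) 0 \<le> 1"
    using hilb_antimono[of "{0}" n 0 "colon n J z"] ideal_zero[OF C] by (auto simp: hilb_zero)
  ultimately show ?thesis using hilb_exact[OF J z(1), of 1] by simp
qed

text \<open>The list \<open>ws\<close> is obtained by dropping the forms that are redundant.\<close>

lemma linear_forms_rank:
  fixes zs :: "('k::field) mpoly list"
  assumes "set zs \<subseteq> forms n 1"
  shows "\<exists>ws. set ws \<subseteq> set zs \<and> ext n {0} ws = ext n {0} zs \<and> hilb n (ext n {0} zs) 1 + length ws = n \<and> length ws \<le> length zs"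
  using assms
proof (induction zs)
  case Nil
  show ?case by (intro exI[of _ "[]"]) (simp add: ext_Nil graded_ideal[OF graded_zero] hilb_zero)
next
  case (Cons z zs)
  then obtain ws where ws: "set ws \<subseteq> set zs" "ext n {0} ws = ext n {0} zs" "hilb n (ext n {0} zs) 1 + length ws = n"
    "length ws \<le> length zs" by auto
  let ?J = "ext n {0} zs"
  note Z = graded_ideal[OF graded_zero]
  have p: "set (z # zs) \<subseteq> polys n" using Cons.prems forms_polys by blast
  have zf: "z \<in> forms n 1" using Cons.prems by simp
  have J: "graded n ?J" using Cons.prems by (intro graded_ext_list graded_zero) auto
  have ext: "ext n {0} (z # zs) = adj n ?J z" by (rule ext_Cons[OF Z p])
  show ?case
  proof (cases "z \<in> ?J")
    case True
    have "adj n ?J z = ?J" using adj_minimal[OF graded_ideal[OF J] order_refl True] adj_superset by blast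
    thus ?thesis using ws ext by (intro exI[of _ ws]) auto
  next
    case False
    have pw: "set (z # ws) \<subseteq> polys n" using p ws by auto
    have "hilb n ?J 1 = hilb n (adj n ?J z) 1 + 1" by (rule hilb_adj_linear[OF J zf False])
    moreover have "ext n {0} (z # ws) = adj n ?J z" unfolding ext_Cons[OF Z pw] ws(2) ..
    ultimately show ?thesis using ws ext by (intro exI[of _ "z # ws"]) auto
  qed
qed

text \<open>If the forms were dependent, fewer than \<open>n\<close> of them would generate the same ideal, against the growth
of the polynomial ring. So they span all linear forms, and the quotient is the field.\<close>

lemma linear_system_of_parameters:
  fixes zs :: "('k::field) mpoly list"
  assumes z: "set zs \<subseteq> forms n 1" and len: "length zs = n" and fin: "finite_length n (ext n {0} zs)"
  shows "complete_intersection n (replicate n 1) zs" "forms n 1 \<subseteq> ext n {0} zs"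
proof -
  note Z = graded_ideal[OF graded_zero]
  have fd: "forms_of_degrees n (replicate n 1) zs" using forms_of_degrees_const[OF _ z] len by simp
  have I: "ideal (ext n {0} zs) (poly_ring n)" by (rule ext_ideal[OF Z forms_of_degrees_polys[OF fd]])
  obtain ws where ws: "set ws \<subseteq> set zs" "ext n {0} ws = ext n {0} zs" "hilb n (ext n {0} zs) 1 + length ws = n"
    using linear_forms_rank[OF z] by blast
  have "forms_of_degrees n (replicate (length ws) 1) ws" using ws z by (intro forms_of_degrees_const) auto
  from growth_ext[OF graded_zero this, of 0] have "growth n ({0} :: 'k mpoly set) (length ws)"
    using growth_of_finite_length[OF fin] ws(2) by simp
  hence "n \<le> length ws" by (rule growth_zero_ideal)
  hence "hilb n (ext n {0} zs) 1 = 0" using ws(3) by simp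
  thus f1: "forms n 1 \<subseteq> ext n {0} zs" using hilb_eq_0_iff[OF I] by blast
  have "hilb n (ext n {0} zs) t = (if t = 0 then 1 else 0)" for t
    using hilb_ext_0[OF fd] forms_in_ideal_of_linear[OF I f1, of t] hilb_eq_0_iff[OF I, of t] by auto
  hence "hilbert_series n (ext n {0} zs) = 1" by (intro fps_ext) (auto simp: fps_one_nth)
  moreover have "one_minus (replicate n 1) * hilbert_series n ({0} :: 'k mpoly set) = 1"
    using one_minus_geo[of "replicate n 1"] by (simp add: hs_zero prod_list_replicate)
  ultimately show "complete_intersection n (replicate n 1) zs" by (simp add: complete_intersection_def)
qed

lemma colon_stable_power:
  assumes J: "ideal J (poly_ring n)" and x: "x \<in> polys n" and st: "\<And>t. colon n J x \<inter> forms n t \<subseteq> J"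
    and xf: "x \<in> forms n 1"
  shows "u \<in> forms n s \<Longrightarrow> x ^ k * u \<in> J \<Longrightarrow> u \<in> J"
proof (induction k)
  case (Suc k)
  have "x ^ k * u \<in> forms n (1 * k + s)" using Suc.prems(1) by (intro mult_forms power_forms xf)
  moreover have "x ^ k * u \<in> colon n J x"
    using Suc.prems x forms_polys[OF Suc.prems(1)] by (auto simp: colon_def mult_ac intro!: mult_polys power_polys)
  ultimately have "x ^ k * u \<in> J" using st by blast
  thus ?case using Suc by simp
qed simp

text \<open>Write \<open>C = R/(fs)\<close>. By assumption the linear form \<open>x\<close> is a nonzerodivisor on \<open>C\<close> with \<open>C/xC\<close>
of finite length, so that the Hilbert function of \<open>C\<close> is eventually constant. As \<open>C/fC\<close> has finite
length too, multiplication by \<open>f\<close> is surjective in high degrees, hence injective there. An element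
killed by \<open>f\<close> in low degree can be moved to high degree by a power of \<open>x\<close>, so \<open>f\<close> is a
nonzerodivisor.\<close>

lemma system_of_parameters_Cons:
  fixes fs :: "('k::field) mpoly list"
  assumes fs: "forms_of_degrees n as fs" and f: "f \<in> forms n a" "a \<ge> 1" and x: "x \<in> forms n 1"
    and finf: "finite_length n (ext n {0} (f # fs))" and finx: "finite_length n (ext n {0} (x # fs))"
    and ci: "complete_intersection n (1 # as) (x # fs)"
  shows "complete_intersection n (a # as) (f # fs)"
proof -
  let ?J = "ext n {0} fs"
  note Z = graded_ideal[OF graded_zero]
  have p: "set fs \<subseteq> polys n" "f \<in> polys n" "x \<in> polys n"
    using fs f x forms_of_degrees_polys forms_polys by blast+
  have J: "graded n ?J" by (rule graded_ext[OF graded_zero fs])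
  note I = graded_ideal[OF J]
  have fx: "forms_of_degrees n (1 # as) (x # fs)" using fs x by simp
  have extf: "ext n {0} (f # fs) = adj n ?J f" and extx: "ext n {0} (x # fs) = adj n ?J x"
    using p by (auto intro!: ext_Cons[OF Z])
  have ciJ: "complete_intersection n as fs" and hx: "hilbert_series n (adj n ?J x) = (1 - fps_X ^ 1) * hilbert_series n ?J"
    using complete_intersection_Cons[OF fx ci] by auto
  have "fps_X ^ 1 * hilbert_series n (colon n ?J x) = fps_X ^ 1 * hilbert_series n ?J"
    using hs_exact[OF J x] unfolding hx by (simp add: left_diff_distrib)
  hence "(fps_X ^ 1 * hilbert_series n (colon n ?J x)) $ Suc t = (fps_X ^ 1 * hilbert_series n ?J) $ Suc t" for t by simp
  hence colx: "hilb n (colon n ?J x) t = hilb n ?J t" for t by (simp add: fps_X_power_mult_nth)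
  have stx: "colon n ?J x \<inter> forms n t \<subseteq> ?J" for t
  proof -
    have "?J \<inter> forms n t = colon n ?J x \<inter> forms n t"
      using colx colon_superset[OF I p(3)] by (intro hilb_eqD[OF I]) auto
    thus ?thesis by blast
  qed
  obtain t0 where t0: "\<And>t. t \<ge> t0 \<Longrightarrow> hilb n (adj n ?J x) t = 0"
    using finx unfolding extx finite_length_def by blast
  have step: "hilb n ?J (Suc t) = hilb n ?J t" if "t \<ge> t0" for t
    using hilb_exact[OF J x, of "Suc t"] t0[of "Suc t"] that by (simp add: colx)
  have const: "hilb n ?J (t0 + k) = hilb n ?J t0" for k
    by (induction k) (simp_all add: step)
  obtain t1 where t1: "\<And>t. t \<ge> t1 \<Longrightarrow> hilb n (adj n ?J f) t = 0"
    using finf unfolding extf finite_length_def by blast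
  have large: "colon n ?J f \<inter> forms n s = ?J \<inter> forms n s" if s: "s \<ge> t0 + t1" for s
  proof -
    have "hilb n ?J (s + a) = hilb n (colon n ?J f) s"
      using hilb_exact[OF J f(1), of "s + a"] t1[of "s + a"] s by simp
    moreover have "hilb n ?J (s + a) = hilb n ?J s"
      using const[of "s + a - t0"] const[of "s - t0"] s by simp
    ultimately show ?thesis using colon_superset[OF I p(2)] by (intro hilb_eqD[OF I, symmetric]) auto
  qed
  have "colon n ?J f \<inter> forms n s \<subseteq> ?J" for s
  proof
    fix u assume u: "u \<in> colon n ?J f \<inter> forms n s"
    \<comment> \<open>The power of \<open>x\<close> moves \<open>u\<close> to a degree where \<open>f\<close> is injective.\<close>
    let ?k = "t0 + t1"
    have "x ^ ?k * u \<in> forms n (1 * ?k + s)" using u by (intro mult_forms power_forms x) auto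
    moreover have "x ^ ?k * u \<in> colon n ?J f"
      using u p by (intro ideal_mult[OF colon_ideal[OF I p(2)]] power_polys) auto
    ultimately have "x ^ ?k * u \<in> ?J" using large[of "1 * ?k + s"] by auto
    thus "u \<in> ?J" using colon_stable_power[OF I p(3) stx x] u by blast
  qed
  hence "hilb n ?J s \<le> hilb n (colon n ?J f) s" for s by (rule hilb_antimono)
  moreover have "hilb n (colon n ?J f) s \<le> hilb n ?J s" for s
    using colon_superset[OF I p(2)] by (intro hilb_antimono) auto
  ultimately have ce: "hilbert_series n (colon n ?J f) = hilbert_series n ?J" by (intro fps_ext) (simp add: antisym)
  have "hilbert_series n ?J = hilbert_series n (adj n ?J f) + fps_X ^ a * hilbert_series n ?J"
    using hs_exact[OF J f(1)] unfolding ce .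
  hence "hilbert_series n (adj n ?J f) = (1 - fps_X ^ a) * hilbert_series n ?J"
    unfolding left_diff_distrib mult_1_left eq_diff_eq by (rule sym)
  thus ?thesis using ciJ by (simp add: complete_intersection_def extf one_minus_def mult_ac)
qed

lemma complete_intersection_perm:
  "set fs = set gs \<Longrightarrow> one_minus as = one_minus bs \<Longrightarrow> complete_intersection n as fs \<Longrightarrow> complete_intersection n bs gs"
  unfolding complete_intersection_def using ext_cong_set[of fs gs n "{0}"] by simp

text \<open>Systems of parameters of a polynomial ring are regular sequences. Leaving out \<open>f\<close>, the quotient has
growth \<open>1\<close>, so a linear form \<open>x\<close> can take the place of \<open>f\<close>. The induction on the number of forms
that are not known to be linear applies to the system with \<open>x\<close>, and
\<open>system_of_parameters_Cons\<close> brings \<open>f\<close> back.\<close>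

lemma system_of_parameters:
  fixes fs zs :: "('k::field) mpoly list"
  assumes inf: "infinite (UNIV :: 'k set)"
  shows "forms_of_degrees n as fs \<Longrightarrow> set zs \<subseteq> forms n 1 \<Longrightarrow> length fs + length zs = n \<Longrightarrow>
    finite_length n (ext n {0} (fs @ zs)) \<Longrightarrow> complete_intersection n (as @ replicate (length zs) 1) (fs @ zs)"
proof (induction as fs arbitrary: zs rule: list_induct2')
  case (1 zs)
  thus ?case using linear_system_of_parameters(1)[of zs n] by simp
next
  case (4 a as f fs zs)
  let ?J = "ext n {0} (fs @ zs)"
  note Z = graded_ideal[OF graded_zero]
  have zd: "forms_of_degrees n (replicate (length zs) 1) zs" using 4 by (intro forms_of_degrees_const) auto
  have fzd: "forms_of_degrees n (as @ replicate (length zs) 1) (fs @ zs)"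
    using 4(2) zd by (intro forms_of_degrees_append) auto
  have p: "set (fs @ zs) \<subseteq> polys n" "f \<in> polys n"
    using forms_of_degrees_polys[OF fzd] forms_of_degrees_polys[OF 4(2)] by auto
  have J: "graded n ?J" by (rule graded_ext[OF graded_zero fzd])
  have fin: "finite_length n (adj n ?J f)" using 4(5) ext_Cons[OF Z, of f "fs @ zs"] p by simp
  have gr: "growth n ?J 1"
    using growth_adj[OF J, of f a 0] growth_of_finite_length[OF fin] 4(2) by simp
  obtain xs where xs: "length xs = 1" "set xs \<subseteq> forms n 1" "finite_length n (ext n ?J xs)"
    by (rule exists_linear_reduction[OF inf J gr])
  then obtain x where x: "xs = [x]" "x \<in> forms n 1" by (cases xs) auto
  have xp: "x \<in> polys n" using x forms_polys by blast
  have finx: "finite_length n (ext n {0} (x # fs @ zs))"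
  proof -
    have "ext n ?J [x] = ext n {0} ((fs @ zs) @ [x])" using p xp by (intro ext_ext[OF Z]) auto
    also have "\<dots> = ext n {0} (x # fs @ zs)" by (rule ext_cong_set) auto
    finally show ?thesis using xs(3) x(1) by simp
  qed
  moreover have set_eq: "set (fs @ x # zs) = set (x # fs @ zs)" by auto
  ultimately have "finite_length n (ext n {0} (fs @ x # zs))" by (simp only: ext_cong_set[OF set_eq])
  moreover have "forms_of_degrees n as fs" "set (x # zs) \<subseteq> forms n 1" "length fs + length (x # zs) = n"
    using 4(2,3,4) x(2) by auto
  ultimately have ci0: "complete_intersection n (as @ replicate (length (x # zs)) 1) (fs @ x # zs)"
    by (intro 4(1))
  have om: "one_minus (as @ replicate (length (x # zs)) 1) = one_minus (1 # as @ replicate (length zs) 1)"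
    by (simp add: one_minus_def mult_ac)
  have ci: "complete_intersection n (1 # as @ replicate (length zs) 1) (x # fs @ zs)"
    by (rule complete_intersection_perm[OF set_eq om ci0])
  have f: "f \<in> forms n a" "a \<ge> 1" using 4(2) by auto
  have "finite_length n (ext n {0} (f # fs @ zs))" using 4(5) by simp
  hence "complete_intersection n (a # as @ replicate (length zs) 1) (f # fs @ zs)"
    by (rule system_of_parameters_Cons[OF fzd f x(2) _ finx ci])
  thus ?case by simp
qed auto

lemma complete_intersection_append:
  "forms_of_degrees n as fs \<Longrightarrow> forms_of_degrees n bs gs \<Longrightarrow>
    complete_intersection n (as @ bs) (fs @ gs) \<Longrightarrow> complete_intersection n bs gs"
proof (induction as fs rule: list_induct2')
  case (4 a as f fs)
  have "forms_of_degrees n (a # as @ bs) (f # fs @ gs)"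
    using forms_of_degrees_append[OF 4(2,3)] by simp
  hence "complete_intersection n (as @ bs) (fs @ gs)"
    using complete_intersection_Cons(1)[of n a "as @ bs" f "fs @ gs"] 4 by simp
  thus ?case using 4 by simp
qed auto

section \<open>Choosing forms of prescribed degrees in the ideal\<close>

lemma complete_linear_forms:
  fixes J :: "('k::field) mpoly set"
  assumes "graded n J"
  shows "\<exists>ys. length ys = hilb n J 1 \<and> set ys \<subseteq> forms n 1 \<and> forms n 1 \<subseteq> ext n J ys"
  using assms
proof (induction "hilb n J 1" arbitrary: J)
  case (0 J)
  hence "forms n 1 \<subseteq> J" using hilb_eq_0_iff[OF graded_ideal[OF 0(2)], of 1] by simp
  thus ?case using 0 by (intro exI[of _ "[]"]) (simp add: ext_Nil[OF graded_ideal[OF 0(2)]])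
next
  case (Suc h J)
  note I = graded_ideal[OF Suc.prems]
  obtain z where z: "z \<in> forms n 1" "z \<notin> J" using hilb_eq_0_iff[OF I, of 1] Suc.hyps(2) by auto
  have zp: "z \<in> polys n" using z forms_polys by blast
  have A: "graded n (adj n J z)" by (rule graded_adj[OF Suc.prems z(1)])
  have h: "h = hilb n (adj n J z) 1" using hilb_adj_linear[OF Suc.prems z] Suc.hyps(2) by simp
  obtain ys where ys: "length ys = h" "set ys \<subseteq> forms n 1" "forms n 1 \<subseteq> ext n (adj n J z) ys"
    using Suc.hyps(1)[OF h A] h by auto
  have yp: "set ys \<subseteq> polys n" using ys(2) forms_polys by blast
  have "adj n J z = ext n J [z]" using ext_Cons[OF I, of z "[]"] zp by (simp add: ext_Nil[OF I])
  hence "ext n (adj n J z) ys = ext n J (z # ys)"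
    using ext_ext[OF I, of "[z]" ys] zp yp by simp
  thus ?case using ys z Suc.hyps(2) by (intro exI[of _ "z # ys"]) auto
qed

lemma nilpotent_list_finite_length:
  fixes K :: "('k::field) mpoly set"
  assumes K: "graded n K"
  shows "(\<forall>h\<in>set gs. (\<exists>b. h \<in> forms n b) \<and> (\<exists>u. h ^ u \<in> K)) \<Longrightarrow> finite_length n (ext n K gs) \<Longrightarrow> finite_length n K"
proof (induction gs)
  case Nil
  thus ?case by (simp add: ext_Nil[OF graded_ideal[OF K]])
next
  case (Cons h gs)
  obtain b u where h: "h \<in> forms n b" "h ^ u \<in> K" using Cons.prems(1) by auto
  have gf: "set gs \<subseteq> (\<Union>b. forms n b)" using Cons.prems(1) by auto
  hence gp: "set (h # gs) \<subseteq> polys n" using h forms_polys by fastforce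
  have E: "graded n (ext n K gs)" by (rule graded_ext_list[OF K gf])
  have "h ^ u \<in> ext n K gs" using ext_superset(1)[OF graded_ideal[OF K], of gs] gp h by auto
  moreover have "finite_length n (adj n (ext n K gs) h)"
    using Cons.prems(2) ext_Cons[OF graded_ideal[OF K] gp] by simp
  ultimately have "finite_length n (ext n K gs)" using nilpotent_finite_length[OF E h(1)] by blast
  thus ?case using Cons by auto
qed

text \<open>Multiply the generators in \<open>rest\<close> by all monomials that raise their degree to \<open>a\<close>. Modulo these
products and \<open>g\<close> each of the generators is nilpotent, hence the quotient still has finite length. All
forms now have the same degree, and elimination turns \<open>g\<close> into the first of \<open>D + 1\<close> parameters.\<close>

lemma choose_form:
  fixes J :: "('k::field) mpoly set"
  assumes inf: "infinite (UNIV :: 'k set)" and J: "graded n J" and gr: "growth n J (Suc D)"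
    and g: "g \<in> forms n a" "a \<ge> 1" and rest: "\<forall>h\<in>set rest. \<exists>b\<in>{1..a}. h \<in> forms n b"
    and fin: "finite_length n (ext n J (g # rest))"
  shows "\<exists>y\<in>forms n a. growth n (adj n J y) D \<and> y - g \<in> gen n (set rest)"
proof -
  note I = graded_ideal[OF J]
  define S where "S = (\<Union>h\<in>set rest. \<Union>b\<in>{b\<in>{1..a}. h \<in> forms n b}. (\<lambda>m. monomial m * h) ` mons {..<n} (a - b))"
  have "finite S" unfolding S_def by (auto simp: finite_mons)
  then obtain G where G: "set G = S" using finite_list by blast
  have rp: "set rest \<subseteq> polys n" using rest forms_polys by blast
  have gp: "g \<in> polys n" using g forms_polys by blast
  have Sf: "S \<subseteq> forms n a"
  proof
    fix x assume "x \<in> S"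
    then obtain h b m where x: "x = monomial m * h" "b \<le> a" "h \<in> forms n b" "m \<in> mons {..<n} (a - b)"
      unfolding S_def by auto
    have "monomial m * h \<in> forms n (a - b + b)" using x by (intro mult_forms monomial_forms)
    thus "x \<in> forms n a" using x by simp
  qed
  have Gf: "set (g # G) \<subseteq> forms n a" using Sf g G by auto
  hence Gp: "set (g # G) \<subseteq> polys n" using forms_polys by blast
  define K where "K = ext n J (g # G)"
  have K: "graded n K" unfolding K_def using Gf by (intro graded_ext_list[OF J]) auto
  note KI = graded_ideal[OF K]
  have JK: "J \<subseteq> K" "set (g # G) \<subseteq> K" unfolding K_def by (rule ext_superset[OF I Gp])+
  have "finite_length n K"
  proof (rule nilpotent_list_finite_length[OF K])
    show "finite_length n (ext n K rest)"
    proof (rule finite_length_antimono[OF fin])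
      show "ext n J (g # rest) \<subseteq> ext n K rest"
        using JK ext_superset[OF KI rp] by (intro ext_minimal[OF ext_ideal[OF KI rp]]) auto
    qed
    show "\<forall>h\<in>set rest. (\<exists>b. h \<in> forms n b) \<and> (\<exists>u. h ^ u \<in> K)"
    proof
      fix h assume h: "h \<in> set rest"
      then obtain b where b: "1 \<le> b" "b \<le> a" "h \<in> forms n b" using bspec[OF rest h] by auto
      have hp: "h \<in> polys n" using rp h by blast
      have C: "ideal (colon n K h) (poly_ring n)" by (rule colon_ideal[OF KI hp])
      have "forms n (a - b) \<subseteq> colon n K h"
      proof (rule forms_subset_of_monomials[OF C])
        fix m assume m: "m \<in> mons {..<n} (a - b)"
        hence "monomial m * h \<in> S" using h b by (auto simp: S_def)
        hence "monomial m * h \<in> K" using JK(2) G by auto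
        thus "monomial m \<in> colon n K h" using monomial_forms[OF m] forms_polys by (auto simp: colon_def)
      qed
      hence "forms n (a - b + (b * (a - b) - (a - b))) \<subseteq> colon n K h" by (rule forms_upward[OF C])
      moreover have "a - b + (b * (a - b) - (a - b)) = b * (a - b)" using b(1) by (simp add: mult_le_mono1)
      ultimately have "h ^ (a - b) \<in> colon n K h" using power_forms[OF b(3), of "a - b"] by auto
      hence "h ^ Suc (a - b) \<in> K" by (simp add: colon_def mult.commute)
      thus "(\<exists>b. h \<in> forms n b) \<and> (\<exists>u. h ^ u \<in> K)" using b(3) by blast
    qed
  qed
  then obtain ys where ys: "length ys = Suc D" "set ys \<subseteq> forms n a" "finite_length n (ext n J ys)"
    "hd ys - g \<in> mpoly_space.span (set G)"
    using eliminate_to_dimension[OF inf J g(2) gr Gf] unfolding K_def by auto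
  then obtain y yt where y: "ys = y # yt" by (cases ys) auto
  have yf: "y \<in> forms n a" "set yt \<subseteq> forms n a" using ys y by auto
  hence yp: "y \<in> polys n" "set yt \<subseteq> polys n" using forms_polys by blast+
  have "adj n J y = ext n J [y]" using ext_Cons[OF I, of y "[]"] yp by (simp add: ext_Nil[OF I])
  hence "ext n (adj n J y) yt = ext n J ys"
    using ext_ext[OF I, of "[y]" yt] yp y by simp
  hence "finite_length n (ext n (adj n J y) yt)" using ys(3) by simp
  moreover have "forms_of_degrees n (replicate (length yt) a) yt" using yf(2) g(2) by (intro forms_of_degrees_const)
  ultimately have "growth n (adj n J y) (length yt + 0)"
    by (intro growth_ext[OF graded_adj[OF J yf(1)]] growth_of_finite_length)
  moreover have "length yt = D" using ys(1) y by simp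
  moreover have "S \<subseteq> gen n (set rest)"
  proof
    fix x assume "x \<in> S"
    then obtain h b m where x: "x = monomial m * h" "h \<in> set rest" "m \<in> mons {..<n} (a - b)"
      unfolding S_def by auto
    have "monomial m * h \<in> gen n (set rest)"
      using gen_superset[OF rp] x forms_polys[OF monomial_forms[OF x(3)]] by (intro ideal_mult[OF gen_ideal[OF rp]]) auto
    thus "x \<in> gen n (set rest)" using x by simp
  qed
  hence "mpoly_space.span (set G) \<subseteq> gen n (set rest)" unfolding G
    by (rule mpoly_space.span_minimal) (rule ideal_subspace[OF gen_ideal[OF rp]])
  ultimately show ?thesis using ys(4) y yf(1) by auto
qed

text \<open>Replace the generators \<open>gs\<close> one after the other by forms \<open>fs\<close> that lower the dimension. At step
\<open>i\<close> the generator \<open>gs ! i\<close> changes by multiples of the later generators only, whose degrees are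
not larger; so the degrees are those of \<open>gs\<close>, and together with the later generators the new forms
generate an ideal that contains the old ones. The generators cannot be exhausted before step
\<open>n - d\<close>, because fewer than \<open>n\<close> forms cannot cut \<open>R\<close> down to finite length.\<close>

lemma choose_forms:
  fixes gs zs :: "('k::field) mpoly list"
  assumes inf: "infinite (UNIV :: 'k set)" and g: "forms_of_degrees n as gs" and sorted: "sorted_wrt (\<ge>) as"
    and z: "set zs \<subseteq> forms n 1" and len: "length zs = d" "d \<le> n" and gz: "growth n (ext n {0} zs) (n - d)"
    and fin: "finite_length n (ext n {0} (gs @ zs))"
  shows "i \<le> n - d \<Longrightarrow> i \<le> length gs \<and> (\<exists>fs. forms_of_degrees n (take i as) fs \<and> set fs \<subseteq> gen n (set gs) \<and>
     growth n (ext n {0} (fs @ zs)) (n - d - i) \<and> finite_length n (ext n {0} (fs @ zs @ drop i gs)))"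
proof (induction i)
  case 0
  have "ext n {0} (zs @ gs) = ext n {0} (gs @ zs)" by (rule ext_cong_set) auto
  thus ?case using gz fin by (intro conjI exI[of _ "[]"]) auto
next
  case (Suc i)
  then obtain fs where il: "i \<le> length gs" and fs: "forms_of_degrees n (take i as) fs" "set fs \<subseteq> gen n (set gs)"
    and gr: "growth n (ext n {0} (fs @ zs)) (n - d - i)"
    and fn: "finite_length n (ext n {0} (fs @ zs @ drop i gs))" by auto
  note Z = graded_ideal[OF graded_zero]
  have lenas: "length as = length gs" by (rule forms_of_degrees_length[OF g])
  have zd: "forms_of_degrees n (replicate d 1) zs" using forms_of_degrees_const[OF _ z] len by simp
  have fzd: "forms_of_degrees n (take i as @ replicate d 1) (fs @ zs)" by (rule forms_of_degrees_append[OF fs(1) zd])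
  have lenfs: "length fs = i" using forms_of_degrees_length[OF fs(1)] il lenas by simp
  \<comment> \<open>Otherwise \<open>i + d < n\<close> forms would give a quotient of finite length.\<close>
  have il': "i < length gs"
  proof (rule ccontr)
    assume "\<not> ?thesis"
    hence "drop i gs = []" by simp
    hence "finite_length n (ext n {0} (fs @ zs))" using fn by simp
    hence "growth n ({0} :: 'k mpoly set) (length (fs @ zs) + 0)"
      by (intro growth_ext[OF graded_zero fzd] growth_of_finite_length)
    hence "n \<le> length (fs @ zs) + 0" by (rule growth_zero_ideal)
    thus False using Suc.prems len lenfs by simp
  qed
  let ?J = "ext n {0} (fs @ zs)"
  let ?g = "gs ! i" and ?a = "as ! i" and ?rest = "drop (Suc i) gs"
  have drop: "drop i gs = ?g # ?rest" using il' by (simp add: Cons_nth_drop_Suc)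
  have J: "graded n ?J" by (rule graded_ext[OF graded_zero fzd])
  have gj: "gs ! j \<in> forms n (as ! j) \<and> 1 \<le> as ! j" if "j < length gs" for j
    using g that list_all2_nthD2[of _ as gs j] by (auto simp: forms_of_degrees_def)
  have gsp: "set gs \<subseteq> polys n" by (rule forms_of_degrees_polys[OF g])
  have rp: "set ?rest \<subseteq> polys n" "?g \<in> polys n" using gsp il' set_drop_subset[of "Suc i" gs] by auto
  have fzp: "set (fs @ zs) \<subseteq> polys n" by (rule forms_of_degrees_polys[OF fzd])
  have rest: "\<forall>h\<in>set ?rest. \<exists>b\<in>{1..?a}. h \<in> forms n b"
  proof
    fix h assume "h \<in> set ?rest"
    then obtain k where k: "k < length ?rest" "h = ?rest ! k" by (metis in_set_conv_nth)
    hence "h = gs ! (Suc i + k)" "Suc i + k < length gs" by auto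
    moreover have "as ! (Suc i + k) \<le> ?a"
      using sorted_wrt_nth_less[OF sorted, of i "Suc i + k"] calculation lenas by simp
    ultimately show "\<exists>b\<in>{1..?a}. h \<in> forms n b" using gj[of "Suc i + k"] by auto
  qed
  have "ext n ?J (?g # ?rest) = ext n {0} ((fs @ zs) @ (?g # ?rest))"
    using rp by (intro ext_ext[OF Z fzp]) auto
  hence fin': "finite_length n (ext n ?J (?g # ?rest))" using fn drop by simp
  have gr': "growth n ?J (Suc (n - d - Suc i))" using gr Suc.prems by (simp add: Suc_diff_Suc)
  obtain y where y: "y \<in> forms n ?a" "growth n (adj n ?J y) (n - d - Suc i)" "y - ?g \<in> gen n (set ?rest)"
    using choose_form[OF inf J gr' _ _ rest fin'] gj[OF il'] by blast
  have yp: "y \<in> polys n" using y forms_polys by blast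
  have fs': "forms_of_degrees n (take (Suc i) as) (fs @ [y])"
    using forms_of_degrees_append[OF fs(1), of "[?a]" "[y]"] y gj[OF il'] il' lenas
    by (simp add: take_Suc_conv_app_nth)
  have "gen n (set ?rest) \<subseteq> gen n (set gs)" by (rule gen_mono[OF gsp set_drop_subset])
  hence "(y - ?g) + ?g \<in> gen n (set gs)"
    using y(3) gen_superset[OF gsp] il' by (intro ideal_add[OF gen_ideal[OF gsp]]) auto
  hence yI: "y \<in> gen n (set gs)" by simp
  have "ext n {0} (y # fs @ zs) = ext n {0} ((fs @ [y]) @ zs)" by (rule ext_cong_set) auto
  moreover have "ext n {0} (y # fs @ zs) = adj n ?J y" using fzp yp by (intro ext_Cons[OF Z]) auto
  ultimately have gr2: "growth n (ext n {0} ((fs @ [y]) @ zs)) (n - d - Suc i)" using y(2) by simp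
  define L where "L = (fs @ [y]) @ zs @ ?rest"
  have Lp: "set L \<subseteq> polys n" using fzp yp rp by (auto simp: L_def)
  have LI: "ideal (ext n {0} L) (poly_ring n)" by (rule ext_ideal[OF Z Lp])
  have sup: "set L \<subseteq> ext n {0} L" "{0} \<subseteq> ext n {0} L" using ext_superset[OF Z Lp] by auto
  have "gen n (set ?rest) \<subseteq> ext n {0} L" using sup by (intro gen_minimal[OF LI]) (auto simp: L_def)
  hence "y - ?g \<in> ext n {0} L" using y(3) by blast
  moreover have "y \<in> ext n {0} L" using sup(1) by (auto simp: L_def)
  ultimately have "y - (y - ?g) \<in> ext n {0} L" using ideal_diff[OF LI] by blast
  hence gL: "?g \<in> ext n {0} L" by simp
  have "set fs \<union> set zs \<union> set ?rest \<subseteq> ext n {0} L" using sup(1) by (auto simp: L_def)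
  hence "ext n {0} (fs @ zs @ drop i gs) \<subseteq> ext n {0} L"
    using sup(2) gL unfolding drop by (intro ext_minimal[OF LI]) auto
  hence "finite_length n (ext n {0} L)" using fn finite_length_antimono by blast
  thus ?case using fs' gr2 yI fs(2) il' unfolding L_def by (intro conjI exI[of _ "fs @ [y]"]) auto
qed

text \<open>If the \<open>d\<close> linear forms were dependent, \<open>d - 1\<close> of them would suffice and \<open>I\<close> would have growth
\<open>d - 1\<close>. So they can be completed to a basis of the linear forms.\<close>

lemma reduction_independent:
  fixes I :: "('k::field) mpoly set"
  assumes I: "graded n I" and z: "set zs \<subseteq> forms n 1" "length zs = d" and d: "d \<ge> 1" "\<not> growth n I (d - 1)"
    and fin: "finite_length n (ext n I zs)"
  shows "d \<le> n" "growth n (ext n {0} zs) (n - d)" "hilbert_series n (ext n {0} zs) = geo 1 ^ (n - d)"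
proof -
  note Z = graded_ideal[OF graded_zero]
  have zp: "set zs \<subseteq> polys n" using z forms_polys by blast
  obtain ws where ws: "set ws \<subseteq> set zs" "ext n {0} ws = ext n {0} zs" "hilb n (ext n {0} zs) 1 + length ws = n"
    "length ws \<le> length zs" using linear_forms_rank[OF z(1)] by blast
  have wp: "set ws \<subseteq> polys n" using ws zp by blast
  have "ext n I zs \<subseteq> ext n I ws"
  proof (rule ext_minimal)
    show "ideal (ext n I ws) (poly_ring n)" by (rule ext_ideal[OF graded_ideal[OF I] wp])
    show "I \<subseteq> ext n I ws" by (rule ext_superset(1)[OF graded_ideal[OF I] wp])
    have "ext n {0} ws \<subseteq> ext n I ws" unfolding ext_def
      using ideal_zero[OF graded_ideal[OF I]] ideal_subset[OF graded_ideal[OF I]] wp by (intro gen_mono) auto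
    thus "set zs \<subseteq> ext n I ws" using ext_superset(2)[OF Z zp] ws(2) by simp
  qed
  hence "finite_length n (ext n I ws)" using fin finite_length_antimono by blast
  moreover have "forms_of_degrees n (replicate (length ws) 1) ws" using ws z by (intro forms_of_degrees_const) auto
  ultimately have gw: "growth n I (length ws + 0)" by (intro growth_ext[OF I] growth_of_finite_length)
  have "length ws = d"
  proof (rule ccontr)
    assume "length ws \<noteq> d"
    hence "length ws + 0 \<le> d - 1" using ws(4) z(2) by simp
    thus False using growth_mono[OF gw] d(2) by blast
  qed
  hence h: "hilb n (ext n {0} zs) 1 = n - d" and dn: "d \<le> n" using ws(3) by auto
  show "d \<le> n" by (rule dn)
  have G: "graded n (ext n {0} zs)" using z by (intro graded_ext_list[OF graded_zero]) auto
  obtain ys where ys: "length ys = n - d" "set ys \<subseteq> forms n 1" "forms n 1 \<subseteq> ext n (ext n {0} zs) ys"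
    using complete_linear_forms[OF G] h by auto
  have yp: "set ys \<subseteq> polys n" using ys forms_polys by blast
  have yd: "forms_of_degrees n (replicate (n - d) 1) ys" using forms_of_degrees_const[OF _ ys(2)] ys(1) by simp
  have EI: "ideal (ext n (ext n {0} zs) ys) (poly_ring n)" by (rule ext_ideal[OF graded_ideal[OF G] yp])
  have "\<forall>t\<ge>1. forms n t \<subseteq> ext n (ext n {0} zs) ys" using forms_in_ideal_of_linear[OF EI ys(3)] by blast
  hence fl: "finite_length n (ext n (ext n {0} zs) ys)" unfolding finite_length_iff[OF EI] by blast
  have "growth n (ext n {0} zs) (length ys + 0)"
    by (intro growth_ext[OF G yd] growth_of_finite_length fl)
  thus "growth n (ext n {0} zs) (n - d)" using ys(1) by simp
  have "ext n (ext n {0} zs) ys = ext n {0} (ys @ zs)"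
    using ext_ext[OF Z zp yp] ext_cong_set[of "zs @ ys" "ys @ zs" n "{0}"] by auto
  hence fl': "finite_length n (ext n {0} (ys @ zs))" using fl by simp
  have "complete_intersection n (replicate n 1) (ys @ zs)"
    using ys z dn fl' by (intro linear_system_of_parameters) auto
  moreover have "replicate n (1::nat) = replicate (n - d) 1 @ replicate d 1" using dn by (simp add: replicate_add[symmetric])
  moreover have zd: "forms_of_degrees n (replicate d 1) zs" using forms_of_degrees_const[OF _ z(1)] z(2) by simp
  ultimately have ci: "complete_intersection n (replicate d 1) zs"
    using complete_intersection_append[OF yd zd] by simp
  have "one_minus (replicate d 1) * geo 1 ^ d = 1"
    using one_minus_geo[of "replicate d 1"] by (simp add: prod_list_replicate)
  moreover have "geo 1 ^ n = geo 1 ^ d * geo 1 ^ (n - d)" using dn by (simp add: power_add[symmetric])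
  ultimately show "hilbert_series n (ext n {0} zs) = geo 1 ^ (n - d)"
    using ci by (simp add: complete_intersection_def hs_zero mult.assoc[symmetric])
qed

lemma hcomp_1_ext:
  fixes I Y :: "('k::field) mpoly set"
  assumes I: "graded n I" and Y: "ideal Y (poly_ring n)" "I \<inter> forms n 1 \<subseteq> Y"
  shows "set zs \<subseteq> forms n 1 \<Longrightarrow> f \<in> ext n I zs \<Longrightarrow> hcomp 1 f \<in> ext n Y zs"
proof (induction zs arbitrary: f)
  case Nil
  have "f \<in> I" using Nil ext_Nil[OF graded_ideal[OF I]] by simp
  hence "hcomp 1 f \<in> I \<inter> forms n 1" using graded_hcomp[OF I] hcomp_forms[of f n 1] ideal_subset[OF graded_ideal[OF I]] by auto
  thus ?case using Y ext_Nil[OF Y(1)] by auto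
next
  case (Cons z zs)
  have p: "set (z # zs) \<subseteq> polys n" using Cons.prems(1) forms_polys by blast
  have zf: "z \<in> forms n 1" using Cons.prems by simp
  have "f \<in> adj n (ext n I zs) z" using Cons.prems(2) ext_Cons[OF graded_ideal[OF I] p] by simp
  then obtain j h where jh: "f = j + h * z" "j \<in> ext n I zs" "h \<in> polys n" unfolding adj_def by blast
  have "hcomp 1 f = hcomp 1 j + hcomp 0 h * z"
    using zf hcomp_mult_homogeneous[of z 1 1 h] by (simp add: jh(1) hcomp_add forms_def)
  moreover have "hcomp 1 j \<in> ext n Y zs" using Cons jh(2) by simp
  moreover have "hcomp 0 h \<in> polys n" by (rule forms_polys[OF hcomp_forms[OF jh(3)]])
  ultimately show ?case unfolding ext_Cons[OF Y(1) p] adj_def by blast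
qed

text \<open>Let \<open>Y\<close> be the ideal generated by the linear forms of \<open>I\<close>. As \<open>Y\<close> and \<open>zs\<close> contain all linear
forms, the Hilbert function of \<open>R/Y\<close> is at most that of a polynomial ring in \<open>d\<close> variables. The
Hilbert function of \<open>R/I\<close> is at least that, since otherwise one of the linear forms \<open>zs\<close> could be
eliminated. So \<open>R/Y\<close> and \<open>R/I\<close> have the same Hilbert function.\<close>

lemma linear_ideal_of_reduction_zero:
  fixes I :: "('k::field) mpoly set"
  assumes inf: "infinite (UNIV :: 'k set)" and I: "graded n I" and z: "set zs \<subseteq> forms n 1" "length zs = d"
    and d: "d \<ge> 1" "\<not> growth n I (d - 1)" and lin: "forms n 1 \<subseteq> ext n I zs"
  shows "I \<subseteq> gen n (I \<inter> forms n 1)"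
proof -
  define Y where "Y = gen n (I \<inter> forms n 1)"
  have sub: "I \<inter> forms n 1 \<subseteq> polys n" using forms_polys by blast
  have Y: "graded n Y" unfolding Y_def by (rule graded_gen) auto
  note YI = graded_ideal[OF Y] and II = graded_ideal[OF I]
  have IY: "I \<inter> forms n 1 \<subseteq> Y" unfolding Y_def by (rule gen_superset[OF sub])
  have YsubI: "Y \<subseteq> I" unfolding Y_def by (rule gen_minimal[OF II]) auto
  have zp: "set zs \<subseteq> polys n" using z forms_polys by blast
  have EI: "ideal (ext n I zs) (poly_ring n)" by (rule ext_ideal[OF II zp])
  have EY: "ideal (ext n Y zs) (poly_ring n)" by (rule ext_ideal[OF YI zp])
  have linY: "forms n 1 \<subseteq> ext n Y zs"
  proof
    fix f :: "'k mpoly" assume f: "f \<in> forms n 1"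
    hence "hcomp 1 f \<in> ext n Y zs" using lin by (intro hcomp_1_ext[OF I YI IY z(1)]) auto
    thus "f \<in> ext n Y zs" using f hcomp_homogeneous[of f 1 1] by (simp add: forms_def)
  qed
  have zd: "forms_of_degrees n (replicate d 1) zs" using forms_of_degrees_const[OF _ z(1)] z(2) by simp
  have le1: "hilbert_series n (ext n Y zs) $ t \<le> 1 $ t" for t
  proof (cases "t = 0")
    case True
    have "hilb n (ext n Y zs) 0 \<le> hilb n ({0} :: 'k mpoly set) 0"
      using ideal_zero[OF EY] by (intro hilb_antimono) auto
    thus ?thesis using True by (simp add: hilb_zero)
  next
    case False
    thus ?thesis using forms_in_ideal_of_linear[OF EY linY, of t] hilb_eq_0_iff[OF EY, of t]
      by (simp add: fps_one_nth)
  qed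
  hence "fps_le (hilbert_series n (ext n Y zs)) 1" by (simp only: fps_le_def) blast
  hence "fps_le (geo 1 ^ d * hilbert_series n (ext n Y zs)) (geo 1 ^ d * 1)"
    using prod_geo_nonneg[of "replicate d 1"] by (intro fps_le_mult_left) (simp_all add: prod_list_replicate)
  moreover have "fps_le (hilbert_series n Y) (geo 1 ^ d * hilbert_series n (ext n Y zs))"
    using hs_ext_ge[OF Y zd] by (simp add: prod_list_replicate)
  ultimately have "fps_le (hilbert_series n Y) (geo 1 ^ d)" using fps_le_trans by fastforce
  hence upper: "hilb n Y t \<le> (d + t - 1 choose t)" for t
    by (simp add: fps_le_def geo_1_power_nth[unfolded One_nat_def])
  have fin: "finite_length n (ext n I zs)"
    unfolding finite_length_iff[OF EI] using forms_in_ideal_of_linear[OF EI lin] by blast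
  obtain s where s: "d = Suc s" using d by (cases d) auto
  have lower: "(d + t - 1 choose t) \<le> hilb n I t" for t
  proof (rule ccontr)
    assume "\<not> ?thesis"
    hence small: "hilb n I (1 * t) < (s + t choose t)" by (simp add: s)
    have zs: "map (\<lambda>i. zs ! i) [0..<Suc s] = zs" using map_nth[of zs] z(2) s by simp
    have zf: "zs ! i \<in> forms n 1" if "i \<le> s" for i
    proof -
      have "zs ! i \<in> set zs" using that z(2) s by (intro nth_mem) simp
      thus ?thesis using z(1) by blast
    qed
    have "finite_length n (ext n I (map (\<lambda>i. zs ! i) [0..<Suc s]))" using fin unfolding zs .
    then obtain b where b: "finite_length n (ext n I (map (\<lambda>i. zs ! i - scale (b i) (zs ! s)) [0..<s]))"
      using eliminate_form[OF inf I, of s "\<lambda>i. zs ! i" 1 t] zf small by blast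
    let ?ws = "map (\<lambda>i. zs ! i - scale (b i) (zs ! s)) [0..<s]"
    have "set ?ws \<subseteq> forms n 1"
      using zf by (auto intro!: mpoly_space.subspace_diff[OF forms_subspace] mpoly_space.subspace_scale[OF forms_subspace])
    hence "forms_of_degrees n (replicate (length ?ws) 1) ?ws" by (intro forms_of_degrees_const) auto
    hence "growth n I (length ?ws + 0)" by (intro growth_ext[OF I] growth_of_finite_length b)
    thus False using d(2) s by simp
  qed
  have "Y \<inter> forms n t = I \<inter> forms n t" for t
    using order_trans[OF upper[of t] lower[of t]] YsubI by (intro hilb_eqD[OF YI]) auto
  hence "I \<subseteq> Y" by (intro graded_eqI[OF I YI]) blast
  thus ?thesis by (simp add: Y_def)
qed

section \<open>Numerical bounds\<close>

text \<open>With \<open>A\<close> and \<open>B\<close> the coefficients of \<open>1/(1 - X)\<^sup>d\<close> at \<open>t\<close> and \<open>t - 1\<close> and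
\<open>T = (t + d) choose d\<close>, the coefficient in question is at most \<open>A + (e - 1) B\<close>. From
\<open>t A = (d + t - 1) B\<close> and \<open>d T = (d + t) A\<close> the claim becomes \<open>d (e - 1) < d + t - 1\<close>.\<close>

lemma coefficient_bound:
  fixes p :: "int fps" and e :: int
  assumes d: "d \<ge> 1" and t: "t \<ge> 1" "int t > int d * (e - 2) + 1"
    and p: "fps_le 0 p" "p $ 0 = 1" and e: "(\<Sum>j\<le>t. p $ j) \<le> e"
  shows "(p * geo 1 ^ d) $ t < int ((t + d) choose d)"
proof -
  define A where "A = int ((d + t - 1) choose t)"
  define B where "B = int ((d + t - 2) choose (t - 1))"
  define T where "T = int ((t + d) choose d)"
  obtain d' where d': "d = Suc d'" using d by (cases d) auto
  obtain t' where t': "t = Suc t'" using t by (cases t) auto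
  have "Suc t' * (Suc (d' + t') choose Suc t') = Suc (d' + t') * (d' + t' choose t')"
    using Suc_times_binomial_eq[of "d' + t'" t'] by (simp only: mult.commute)
  hence "t * ((d + t - 1) choose t) = (d + t - 1) * ((d + t - 2) choose (t - 1))"
    unfolding d' t' by (simp only: add_Suc add_Suc_right diff_Suc_1 diff_Suc_Suc numeral_2_eq_2 minus_nat.diff_0)
  hence "int (t * ((d + t - 1) choose t)) = int ((d + t - 1) * ((d + t - 2) choose (t - 1)))" by (simp only:)
  hence "int t * A = int (d + t - 1) * B" unfolding A_def B_def of_nat_mult .
  hence AB: "int t * A = (int d + int t - 1) * B" using d' by (simp add: algebra_simps)
  have "Suc d' * (Suc (t + d') choose Suc d') = Suc (t + d') * (t + d' choose d')"
    using Suc_times_binomial_eq[of "t + d'" d'] by (simp only: mult.commute)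
  moreover have "(t + d' choose d') = (d + t - 1 choose t)"
    using binomial_symmetric[of d' "t + d'"] by (simp add: d' add.commute)
  ultimately have "d * ((t + d) choose d) = (t + d) * ((d + t - 1) choose t)"
    unfolding d' by (simp only: add_Suc add_Suc_right)
  hence "int (d * ((t + d) choose d)) = int ((t + d) * ((d + t - 1) choose t))" by (simp only:)
  hence AT: "int d * T = (int d + int t) * A"
    unfolding A_def T_def of_nat_mult of_nat_add by (simp only: add.commute)
  have Apos: "A > 0" unfolding A_def by (simp add: d')
  have Bpos: "B > 0" unfolding B_def by (simp add: d' t')
  \<comment> \<open>The coefficients of \<open>1/(1 - X)\<^sup>d\<close> increase, so all of \<open>p\<close> except \<open>p(0)\<close> may be moved to
  degree \<open>1\<close>.\<close>
  have mono: "int ((d + (t - j) - 1) choose (t - j)) \<le> B" if "1 \<le> j" "j \<le> t" for j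
  proof -
    have "((d' + (t - j)) choose (t - j)) = ((d' + (t - j)) choose d')"
      using binomial_symmetric[of d' "d' + (t - j)"] by simp
    also have "\<dots> \<le> ((d' + (t - 1)) choose d')" using that by (intro binomial_right_mono) auto
    also have "\<dots> = ((d' + (t - 1)) choose (t - 1))"
      using binomial_symmetric[of d' "d' + (t - 1)"] by simp
    finally show ?thesis using d' t' by (simp add: B_def)
  qed
  define S where "S = (\<Sum>j\<in>{1..t}. p $ j)"
  have split: "{..t} = insert 0 {1..t}" by auto
  have S: "S \<le> e - 1" using e p(2) unfolding split S_def by simp
  have "(p * geo 1 ^ d) $ t = (\<Sum>j\<le>t. p $ j * int ((d + (t - j) - 1) choose (t - j)))"
    by (simp add: fps_mult_nth geo_1_power_nth[unfolded One_nat_def] atMost_atLeast0)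
  also have "\<dots> = A + (\<Sum>j\<in>{1..t}. p $ j * int ((d + (t - j) - 1) choose (t - j)))"
    unfolding split using p(2) by (simp add: A_def)
  also have "(\<Sum>j\<in>{1..t}. p $ j * int ((d + (t - j) - 1) choose (t - j))) \<le> (\<Sum>j\<in>{1..t}. p $ j * B)"
    using mono p(1) by (intro sum_mono mult_left_mono) (auto simp: fps_le_def)
  also have "\<dots> = S * B" by (simp add: S_def sum_distrib_right)
  also have "\<dots> \<le> (e - 1) * B" using S Bpos by simp
  finally have le: "(p * geo 1 ^ d) $ t \<le> A + (e - 1) * B" by simp
  have dt: "int d + int t - 1 > 0" using d t by simp
  have "(int d * (int d + int t - 1)) * (A + (e - 1) * B)
      = int d * (int d + int t - 1) * A + int d * (e - 1) * ((int d + int t - 1) * B)"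
    by (simp add: algebra_simps)
  also have "\<dots> = int d * (int d + int t - 1) * A + (int d * (e - 1)) * int t * A"
    unfolding AB[symmetric] by (simp add: algebra_simps)
  also have "\<dots> < int d * (int d + int t - 1) * A + (int d + int t - 1) * int t * A"
  proof -
    have "int d * (e - 1) < int d + int t - 1" using t(2) by (simp add: algebra_simps)
    thus ?thesis using Apos t(1) by (simp add: mult_strict_right_mono)
  qed
  also have "\<dots> = (int d + int t - 1) * ((int d + int t) * A)" by (simp add: algebra_simps)
  also have "\<dots> = (int d * (int d + int t - 1)) * T" unfolding AT[symmetric] by (simp add: algebra_simps)
  finally have "A + (e - 1) * B < T" using d dt by (simp add: mult_less_cancel_left)
  thus ?thesis using le by (simp add: T_def)
qed

lemma partial_sum_mult:
  fixes f g :: "int fps"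
  assumes f: "fps_le 0 f" and g: "fps_le 0 g"
  shows "(\<Sum>j\<le>N. (f * g) $ j) \<le> (\<Sum>j\<le>N. f $ j) * (\<Sum>j\<le>N. g $ j)"
proof -
  have "(\<Sum>j\<le>N. (f * g) $ j) = (\<Sum>j\<le>N. \<Sum>i\<le>j. f $ i * g $ (j - i))"
    by (simp add: fps_mult_nth atMost_atLeast0)
  also have "\<dots> = (\<Sum>(i, k)\<in>{(i, k). i + k \<le> N}. f $ i * g $ k)"
    by (rule sum.triangle_reindex_eq[symmetric])
  also have "{(i, k). i + k \<le> N} = (SIGMA i:{..N}. {..N - i})" by auto
  also have "(\<Sum>(i, k)\<in>(SIGMA i:{..N}. {..N - i}). f $ i * g $ k) = (\<Sum>i\<le>N. \<Sum>k\<le>N - i. f $ i * g $ k)"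
    by (rule sum.Sigma[symmetric]) auto
  also have "\<dots> \<le> (\<Sum>i\<le>N. \<Sum>k\<le>N. f $ i * g $ k)"
    using f g by (intro sum_mono sum_mono2) (auto simp: fps_le_def)
  finally show ?thesis by (simp add: sum_product)
qed

text \<open>The polynomial \<open>1 + X + \<dots> + X\<^bsup>a - 1\<^esup>\<close>.\<close>

definition truncated_geo :: "nat \<Rightarrow> int fps" where
  "truncated_geo a = Abs_fps (\<lambda>t. if t < a then 1 else 0)"

lemma truncated_geo_eq: "truncated_geo a = (1 - fps_X ^ a) * geo 1"
  by (rule fps_ext) (simp add: left_diff_distrib fps_X_power_mult_nth truncated_geo_def geo_def)

lemma truncated_geo_prod:
  assumes "\<forall>a\<in>set as. a \<ge> 1"
  shows "fps_le 0 (prod_list (map truncated_geo as))" "prod_list (map truncated_geo as) $ 0 = 1"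
    "(\<Sum>j\<le>N. prod_list (map truncated_geo as) $ j) \<le> int (prod_list as)"
proof -
  have "fps_le 0 (prod_list (map truncated_geo as)) \<and> prod_list (map truncated_geo as) $ 0 = 1 \<and>
    (\<Sum>j\<le>N. prod_list (map truncated_geo as) $ j) \<le> int (prod_list as)"
    using assms
  proof (induction as)
    case Nil
    show ?case by (simp add: fps_le_def fps_one_nth sum.delta)
  next
    case (Cons a as)
    have n: "fps_le 0 (truncated_geo a)" by (simp add: fps_le_def truncated_geo_def)
    have s: "(\<Sum>j\<le>N. truncated_geo a $ j) \<le> int a"
    proof -
      have "(\<Sum>j\<le>N. truncated_geo a $ j) = (\<Sum>j\<in>{..N} \<inter> {..<a}. 1)"
        unfolding truncated_geo_def by (simp add: sum.If_cases Int_def lessThan_def)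
      also have "\<dots> \<le> int a" using card_mono[of "{..<a}" "{..N} \<inter> {..<a}"] by simp
      finally show ?thesis .
    qed
    have "(\<Sum>j\<le>N. (truncated_geo a * prod_list (map truncated_geo as)) $ j)
        \<le> (\<Sum>j\<le>N. truncated_geo a $ j) * (\<Sum>j\<le>N. prod_list (map truncated_geo as) $ j)"
      using Cons n by (intro partial_sum_mult) auto
    also have "\<dots> \<le> int a * int (prod_list as)"
      using Cons s by (intro mult_mono) (auto simp: fps_le_def intro!: sum_nonneg)
    finally have "(\<Sum>j\<le>N. (truncated_geo a * prod_list (map truncated_geo as)) $ j) \<le> int a * int (prod_list as)" .
    moreover have "truncated_geo a $ 0 = 1" using Cons.prems by (simp add: truncated_geo_def)
    ultimately show ?case using Cons n by (simp add: fps_nonneg_mult)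
  qed
  thus "fps_le 0 (prod_list (map truncated_geo as))" "prod_list (map truncated_geo as) $ 0 = 1"
    "(\<Sum>j\<le>N. prod_list (map truncated_geo as) $ j) \<le> int (prod_list as)" by auto
qed

lemma truncated_geo_one_minus: "prod_list (map truncated_geo as) = one_minus as * geo 1 ^ length as"
  by (induction as) (simp_all add: one_minus_def truncated_geo_eq mult_ac)

lemma sum_choose_le: "(\<Sum>j\<le>r. int ((m + j - 1) choose j)) = int ((r + m) choose m)"
proof (cases m)
  case 0
  have "(\<Sum>j\<le>r. int ((0 + j - 1) choose j)) = (\<Sum>j\<in>{0}. int ((0 + j - 1) choose j))"
    by (intro sum.mono_neutral_right) auto
  thus ?thesis using 0 by simp
next
  case (Suc m')
  have "(\<Sum>j\<le>r. int ((m + j - 1) choose j)) = int (\<Sum>j\<le>r. (m' + j) choose j)" by (simp add: Suc)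
  also have "\<dots> = int ((Suc m' + r) choose r)" by (simp only: sum_choose_diag)
  also have "(Suc m' + r) choose r = (r + m) choose m"
    using binomial_symmetric[of r "Suc m' + r"] by (simp add: Suc add.commute)
  finally show ?thesis .
qed

text \<open>The series \<open>p\<close> of \<open>R/(I + (zs))\<close> vanishes above degree \<open>r\<close> and is at most the series of the
polynomial ring \<open>R/(zs)\<close> in \<open>n - d\<close> variables. So its coefficients add up to at most the number of
monomials of degree at most \<open>r\<close> in \<open>n - d\<close> variables.\<close>

lemma hilb_bound_of_reduction_number:
  fixes I :: "('k::field) mpoly set"
  assumes I: "graded n I" and h0: "hilb n (ext n I zs) 0 = 1"
    and z: "set zs \<subseteq> forms n 1" "length zs = d" and d: "d \<ge> 1" "\<not> growth n I (d - 1)"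
    and red: "forms n (Suc r) \<subseteq> ext n I zs"
    and t: "t \<ge> 1" "int t > int d * (int ((r + n - d) choose (n - d)) - 2) + 1"
  shows "hilb n I t < (t + d) choose d"
proof -
  note II = graded_ideal[OF I] and Z = graded_ideal[OF graded_zero]
  have zp: "set zs \<subseteq> polys n" using z forms_polys by blast
  have EI: "ideal (ext n I zs) (poly_ring n)" by (rule ext_ideal[OF II zp])
  have zero: "hilb n (ext n I zs) t = 0" if "t > r" for t
  proof -
    have "forms n (Suc r + (t - Suc r)) \<subseteq> ext n I zs" by (rule forms_upward[OF EI red])
    thus ?thesis using that hilb_eq_0_iff[OF EI, of t] by simp
  qed
  hence fin: "finite_length n (ext n I zs)" unfolding finite_length_def by (intro exI[of _ "Suc r"]) auto
  note ind = reduction_independent[OF I z d fin]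
  have zd: "forms_of_degrees n (replicate d 1) zs" using forms_of_degrees_const[OF _ z(1)] z(2) by simp
  let ?p = "hilbert_series n (ext n I zs)"
  have "(\<Sum>j\<le>t. ?p $ j) \<le> (\<Sum>j\<le>r. int ((n - d + j - 1) choose j))"
  proof -
    have le: "?p $ j \<le> int ((n - d + j - 1) choose j)" for j
    proof -
      have "ext n {0} zs \<subseteq> ext n I zs" unfolding ext_def
        using ideal_zero[OF II] ideal_subset[OF II] zp by (intro gen_mono) auto
      hence "?p $ j \<le> hilbert_series n (ext n {0} zs) $ j" by (auto intro!: hilb_antimono)
      thus ?thesis unfolding ind(3) geo_1_power_nth .
    qed
    have "(\<Sum>j\<le>t. ?p $ j) \<le> (\<Sum>j\<le>max t r. ?p $ j)" by (rule sum_mono2) auto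
    also have "\<dots> = (\<Sum>j\<le>r. ?p $ j)" using zero by (intro sum.mono_neutral_right) auto
    also have "\<dots> \<le> (\<Sum>j\<le>r. int ((n - d + j - 1) choose j))" by (rule sum_mono) (rule le)
    finally show ?thesis .
  qed
  also have "\<dots> = int ((r + n - d) choose (n - d))" using ind(1) by (simp only: sum_choose_le) simp
  finally have "(?p * geo 1 ^ d) $ t < int ((t + d) choose d)"
    using h0 by (intro coefficient_bound[OF d(1) t hs_nonneg]) auto
  moreover have "fps_le (hilbert_series n I) (geo 1 ^ d * ?p)"
    using hs_ext_ge[OF I zd] by (simp add: prod_list_replicate)
  hence "int (hilb n I t) \<le> (?p * geo 1 ^ d) $ t" by (simp add: fps_le_def mult.commute)
  ultimately show ?thesis by simp
qed

lemma hilb_bound_of_degrees: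
  fixes I :: "('k::field) mpoly set"
  assumes inf: "infinite (UNIV :: 'k set)" and gs: "forms_of_degrees n as gs" and I: "I = gen n (set gs)"
    and sorted: "sorted_wrt (\<ge>) as"
    and z: "set zs \<subseteq> forms n 1" "length zs = d" and d: "d \<ge> 1" "\<not> growth n I (d - 1)"
    and fin: "finite_length n (ext n I zs)"
  shows "n - d \<le> length as"
    and "t \<ge> 1 \<Longrightarrow> int t > int d * (int (prod_list (take (n - d) as)) - 2) + 1 \<Longrightarrow> hilb n I t < (t + d) choose d"
proof -
  have gp: "set gs \<subseteq> polys n" by (rule forms_of_degrees_polys[OF gs])
  note Z = graded_ideal[OF graded_zero]
  have zp: "set zs \<subseteq> polys n" using z forms_polys by blast
  have Ie: "I = ext n {0} gs"
  proof
    show "I \<subseteq> ext n {0} gs" unfolding I by (intro gen_minimal ext_ideal[OF Z gp] ext_superset(2)[OF Z gp])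
    show "ext n {0} gs \<subseteq> I" unfolding I
      using ideal_zero[OF gen_ideal[OF gp]] gen_superset[OF gp] by (intro ext_minimal gen_ideal[OF gp]) auto
  qed
  have G: "graded n I" unfolding Ie by (rule graded_ext[OF graded_zero gs])
  note ind = reduction_independent[OF G z d fin]
  have fin': "finite_length n (ext n {0} (gs @ zs))" using fin ext_ext[OF Z gp zp] by (simp add: Ie)
  note ch = choose_forms[OF inf gs sorted z ind(1,2) fin' order_refl]
  have lenas: "length as = length gs" by (rule forms_of_degrees_length[OF gs])
  show "n - d \<le> length as" using ch lenas by simp
  obtain fs where fs: "forms_of_degrees n (take (n - d) as) fs" "set fs \<subseteq> gen n (set gs)"
    "growth n (ext n {0} (fs @ zs)) 0" using ch by auto
  have zd: "forms_of_degrees n (replicate d 1) zs" using forms_of_degrees_const[OF _ z(1)] z(2) by simp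
  have fzd: "forms_of_degrees n (take (n - d) as @ replicate d 1) (fs @ zs)" by (rule forms_of_degrees_append[OF fs(1) zd])
  have fp: "set fs \<subseteq> polys n" by (rule forms_of_degrees_polys[OF fs(1)])
  have J: "graded n (ext n {0} (fs @ zs))" by (rule graded_ext[OF graded_zero fzd])
  obtain xs where "length xs = 0" "finite_length n (ext n (ext n {0} (fs @ zs)) xs)"
    by (rule exists_linear_reduction[OF inf J fs(3)])
  hence fl: "finite_length n (ext n {0} (fs @ zs))" by (simp add: ext_Nil[OF graded_ideal[OF J]])
  have lenfs: "length fs = n - d" using forms_of_degrees_length[OF fs(1)] \<open>n - d \<le> length as\<close> by simp
  have "complete_intersection n (take (n - d) as @ replicate (length zs) 1) (fs @ zs)"
    using lenfs z ind(1) fl by (intro system_of_parameters[OF inf fs(1)]) auto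
  hence "complete_intersection n (replicate d 1 @ take (n - d) as) (zs @ fs)"
  proof (rule complete_intersection_perm[rotated 2])
    show "one_minus (take (n - d) as @ replicate (length zs) 1) = one_minus (replicate d 1 @ take (n - d) as)"
      using z(2) by (simp add: one_minus_def mult.commute)
  qed auto
  hence ci: "complete_intersection n (take (n - d) as) fs" by (rule complete_intersection_append[OF zd fs(1)])
  let ?q = "prod_list (map truncated_geo (take (n - d) as))"
  have q: "hilbert_series n (ext n {0} fs) = ?q * geo 1 ^ d"
  proof -
    have "geo 1 ^ n = geo 1 ^ (n - d) * geo 1 ^ d" using ind(1) by (simp add: power_add[symmetric])
    thus ?thesis using ci \<open>n - d \<le> length as\<close>
      by (simp add: complete_intersection_def hs_zero truncated_geo_one_minus mult.assoc)
  qed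
  show "hilb n I t < (t + d) choose d"
    if t: "t \<ge> 1" "int t > int d * (int (prod_list (take (n - d) as)) - 2) + 1"
  proof -
    have "(?q * geo 1 ^ d) $ t < int ((t + d) choose d)"
      by (intro coefficient_bound[OF d(1) t] truncated_geo_prod forms_of_degrees_pos[OF fs(1)])
    moreover have "ext n {0} fs \<subseteq> I"
      using fs(2) ideal_zero[OF graded_ideal[OF G]] I by (intro ext_minimal graded_ideal[OF G]) auto
    hence "hilb n I t \<le> hilb n (ext n {0} fs) t" by (intro hilb_antimono) auto
    hence "int (hilb n I t) \<le> hilbert_series n (ext n {0} fs) $ t" by simp
    ultimately show ?thesis unfolding q by simp
  qed
qed

section \<open>Filtered Hilbert functions and chains of primes\<close>

definition polys_upto :: "nat \<Rightarrow> nat \<Rightarrow> ('k::field) mpoly set" where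
  "polys_upto n t = {f. supp f \<subseteq> (\<Union>u\<le>t. mons {..<n} u)}"

text \<open>The prime ideals in a chain need not be homogeneous. Therefore the dimensions of the spaces of
polynomials of degree at most \<open>t\<close> are used for them.\<close>

definition filtered_hilb :: "nat \<Rightarrow> ('k::field) mpoly set \<Rightarrow> nat \<Rightarrow> nat" where
  "filtered_hilb n P t = mpoly_space.dim (polys_upto n t :: 'k mpoly set) - mpoly_space.dim (P \<inter> polys_upto n t)"

lemma fin_dim_upto: "fin_dim (polys_upto n t)"
  unfolding polys_upto_def by (rule dim_supp_subset) (simp add: finite_mons)

lemma subspace_upto: "mpoly_space.subspace (polys_upto n t)"
  unfolding polys_upto_def span_monomials[symmetric] by (rule mpoly_space.subspace_span)

lemma upto_polys: "f \<in> polys_upto n t \<Longrightarrow> f \<in> polys n"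
  by (auto simp: polys_upto_def polys_iff exponents_mons)

lemma upto_mono: "s \<le> t \<Longrightarrow> polys_upto n s \<subseteq> polys_upto n t"
  unfolding polys_upto_def by (force simp: subset_iff)

lemma upto_exists: assumes "f \<in> polys n" shows "\<exists>a\<ge>1. f \<in> polys_upto n a"
proof -
  have "f \<in> polys_upto n (Suc (\<Sum>m\<in>supp f. mdeg m))" unfolding polys_upto_def
  proof (intro CollectI subsetI)
    fix m assume m: "m \<in> supp f"
    hence "mdeg m \<le> (\<Sum>m\<in>supp f. mdeg m)" by (intro member_le_sum) auto
    moreover have "m \<in> exponents n" using assms m by (auto simp: polys_iff)
    ultimately show "m \<in> (\<Union>u\<le>Suc (\<Sum>m\<in>supp f. mdeg m). mons {..<n} u)"
      by (auto simp: mons_def exponents_def)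
  qed
  thus ?thesis by (intro exI[of _ "Suc (\<Sum>m\<in>supp f. mdeg m)"]) simp
qed

lemma upto_mult:
  assumes "f \<in> polys_upto n a" "g \<in> polys_upto n b" shows "f * g \<in> polys_upto n (a + b)"
  unfolding polys_upto_def
proof (intro CollectI subsetI)
  fix m assume "m \<in> supp (f * g)"
  then obtain u v where uv: "m = u + v" "u \<in> supp f" "v \<in> supp g" using keys_mult[of f g] by blast
  have u: "u \<in> exponents n" "mdeg u \<le> a" and v: "v \<in> exponents n" "mdeg v \<le> b"
    using uv assms by (auto simp: polys_upto_def mons_def exponents_def)
  have "m \<in> exponents n" "mdeg m \<le> a + b" using u v by (auto simp: uv(1) mdeg_add exponents_add)
  thus "m \<in> (\<Union>u\<le>a + b. mons {..<n} u)" by (auto simp: mons_def exponents_def)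
qed

lemma dim_Int_upto_le: "mpoly_space.dim ((P :: ('k::field) mpoly set) \<inter> polys_upto n t) \<le> mpoly_space.dim (polys_upto n t :: 'k mpoly set)"
  by (intro dim_mono_fin[OF fin_dim_upto]) blast

lemma ideal_upto:
  assumes "ideal P (poly_ring n)"
  shows "mpoly_space.subspace (P \<inter> polys_upto n t)" "fin_dim (P \<inter> polys_upto n t)"
  by (intro mpoly_space.subspace_inter ideal_subspace[OF assms] subspace_upto)
     (rule fin_dim_mono[OF fin_dim_upto], blast)

lemma dim_zero: "mpoly_space.dim ({0} :: ('k::field) mpoly set) = 0"
  using mpoly_space.dim_le_card[of "{0}" "{}"] by auto

lemma filt_le_sum:
  fixes I :: "('k::field) mpoly set"
  assumes I: "ideal I (poly_ring n)" shows "filtered_hilb n I t \<le> (\<Sum>u\<le>t. hilb n I u)"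
proof (induction t)
  case 0
  have "polys_upto n 0 = (forms n 0 :: 'k mpoly set)" by (simp add: polys_upto_def forms_eq)
  thus ?case by (simp add: filtered_hilb_def hilb_def)
next
  case (Suc t)
  let ?U = "\<Union>u\<le>t. mons {..<n} u"
  have "(\<Union>u\<le>Suc t. mons {..<n} u) = ?U \<union> mons {..<n} (Suc t)" by (auto simp: atMost_Suc)
  moreover have "?U \<inter> mons {..<n} (Suc t) = {}" by (auto simp: mons_def)
  ultimately have "card (\<Union>u\<le>Suc t. mons {..<n} u) = card ?U + card (mons {..<n} (Suc t))"
    by (simp add: card_Un_disjoint finite_mons)
  hence d: "mpoly_space.dim (polys_upto n (Suc t) :: 'k mpoly set)
      = mpoly_space.dim (polys_upto n t :: 'k mpoly set) + mpoly_space.dim (forms n (Suc t) :: 'k mpoly set)"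
    unfolding polys_upto_def forms_eq by (simp add: dim_supp_subset(2) finite_mons)
  define W where "W = I \<inter> polys_upto n t"
  define U where "U = I \<inter> forms n (Suc t)"
  have W: "mpoly_space.subspace W" "fin_dim W" unfolding W_def by (rule ideal_upto[OF I])+
  have U: "mpoly_space.subspace U" "fin_dim U" unfolding U_def
    by (intro mpoly_space.subspace_inter ideal_subspace[OF I] forms_subspace)
       (rule fin_dim_mono[OF fin_dim_forms], blast)
  have sub: "polys_upto n t \<subseteq> (polys_upto n (Suc t) :: 'k mpoly set)" "forms n (Suc t) \<subseteq> (polys_upto n (Suc t) :: 'k mpoly set)"
    by (rule upto_mono) (auto simp: polys_upto_def forms_eq)
  have "mpoly_space.dim {w + u | w u. w \<in> W \<and> u \<in> U} + mpoly_space.dim {u \<in> U. u \<in> W}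
      = mpoly_space.dim W + mpoly_space.dim U"
    using dim_sum_image[OF W U, of "\<lambda>x. x"] by simp
  moreover have "{u \<in> U. u \<in> W} = {0}"
  proof (intro equalityI subsetI)
    fix f assume "f \<in> {u \<in> U. u \<in> W}"
    hence "supp f \<subseteq> mons {..<n} (Suc t)" "supp f \<subseteq> ?U" by (auto simp: U_def W_def polys_upto_def forms_eq)
    hence "supp f = {}" using \<open>?U \<inter> mons {..<n} (Suc t) = {}\<close> by blast
    thus "f \<in> {0}" by (metis poly_expansion sum.empty singletonI)
  qed (auto simp: mpoly_space.subspace_0[OF W(1)] mpoly_space.subspace_0[OF U(1)])
  moreover have "mpoly_space.dim {w + u | w u. w \<in> W \<and> u \<in> U} \<le> mpoly_space.dim (I \<inter> polys_upto n (Suc t))"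
  proof (rule dim_mono_fin[OF ideal_upto(2)[OF I]])
    show "{w + u | w u. w \<in> W \<and> u \<in> U} \<subseteq> I \<inter> polys_upto n (Suc t)"
      using sub by (auto simp: W_def U_def intro!: ideal_add[OF I] mpoly_space.subspace_add[OF subspace_upto])
  qed
  ultimately have "mpoly_space.dim W + mpoly_space.dim U \<le> mpoly_space.dim (I \<inter> polys_upto n (Suc t))"
    by (simp add: dim_zero)
  thus ?case using Suc d dim_Int_upto_le[of I n t] dim_Int_forms_le[of I n "Suc t"]
    by (simp add: filtered_hilb_def hilb_def W_def U_def)
qed

lemma filt_mono:
  fixes P :: "('k::field) mpoly set"
  assumes P: "ideal P (poly_ring n)" and st: "s \<le> t" shows "filtered_hilb n P s \<le> filtered_hilb n P t"
proof -
  define W where "W = P \<inter> polys_upto n t"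
  define U where "U = (polys_upto n s :: 'k mpoly set)"
  have W: "mpoly_space.subspace W" "fin_dim W" unfolding W_def by (rule ideal_upto[OF P])+
  have U: "mpoly_space.subspace U" "fin_dim U" unfolding U_def by (rule subspace_upto, rule fin_dim_upto)
  have "mpoly_space.dim {w + u | w u. w \<in> W \<and> u \<in> U} + mpoly_space.dim {u \<in> U. u \<in> W}
      = mpoly_space.dim W + mpoly_space.dim U"
    using dim_sum_image[OF W U, of "\<lambda>x. x"] by simp
  moreover have "{u \<in> U. u \<in> W} = P \<inter> polys_upto n s" using upto_mono[OF st, of n] by (auto simp: U_def W_def)
  moreover have "mpoly_space.dim {w + u | w u. w \<in> W \<and> u \<in> U} \<le> mpoly_space.dim (polys_upto n t :: 'k mpoly set)"
    using upto_mono[OF st, of n]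
    by (intro dim_mono_fin[OF fin_dim_upto]) (auto simp: W_def U_def intro!: mpoly_space.subspace_add[OF subspace_upto])
  ultimately show ?thesis using dim_Int_upto_le[of P n t] by (simp add: filtered_hilb_def W_def U_def)
qed

lemma filt_antimono:
  fixes P Q :: "('k::field) mpoly set"
  assumes "P \<subseteq> Q" shows "filtered_hilb n Q t \<le> filtered_hilb n P t"
proof -
  have "mpoly_space.dim (P \<inter> polys_upto n t) \<le> mpoly_space.dim (Q \<inter> polys_upto n t)"
    by (rule dim_mono_fin[OF fin_dim_mono[OF fin_dim_upto]]) (use assms in auto)
  thus ?thesis by (simp add: filtered_hilb_def)
qed

lemma filt_proper:
  fixes P :: "('k::field) mpoly set"
  assumes P: "ideal P (poly_ring n)" and "1 \<notin> P" shows "filtered_hilb n P t \<ge> 1"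
proof (rule ccontr)
  assume "\<not> ?thesis"
  hence "mpoly_space.dim (polys_upto n t :: 'k mpoly set) \<le> mpoly_space.dim (P \<inter> polys_upto n t)" by (simp add: filtered_hilb_def)
  hence "P \<inter> polys_upto n t = polys_upto n t" by (intro subspace_eq_fin ideal_upto[OF P] fin_dim_upto) auto
  moreover have "1 \<in> (polys_upto n t :: 'k mpoly set)" by (auto simp: polys_upto_def mons_def)
  ultimately show False using assms by blast
qed

text \<open>An element of \<open>Q\<close> outside the prime \<open>P\<close> is a nonzerodivisor on \<open>R/P\<close>. This is the exact sequence
for multiplication by it, with an inequality only, since degrees can drop.\<close>

lemma filt_prime_step:
  fixes P Q :: "('k::field) mpoly set"
  assumes P: "primeideal P (poly_ring n)" and Q: "ideal Q (poly_ring n)" and PQ: "P \<subseteq> Q"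
    and f: "f \<in> Q" "f \<notin> P" "f \<in> polys_upto n a" and t: "a \<le> t"
  shows "filtered_hilb n Q t + filtered_hilb n P (t - a) \<le> filtered_hilb n P t"
proof -
  have PI: "ideal P (poly_ring n)" using P by (simp add: primeideal_def)
  have fp: "f \<in> polys n" using f upto_polys by blast
  define W where "W = P \<inter> polys_upto n t"
  define U where "U = (polys_upto n (t - a) :: 'k mpoly set)"
  have W: "mpoly_space.subspace W" "fin_dim W" unfolding W_def by (rule ideal_upto[OF PI])+
  have U: "mpoly_space.subspace U" "fin_dim U" unfolding U_def by (rule subspace_upto, rule fin_dim_upto)
  have deg: "u * f \<in> polys_upto n t" if "u \<in> U" for u using upto_mult[OF that[unfolded U_def] f(3)] t by simp
  have "mpoly_space.dim {w + u * f | w u. w \<in> W \<and> u \<in> U} + mpoly_space.dim {u \<in> U. u * f \<in> W}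
      = mpoly_space.dim W + mpoly_space.dim U"
    by (rule dim_sum_image[OF W U]) (simp_all add: distrib_right scale_mult_left)
  moreover have "{u \<in> U. u * f \<in> W} = P \<inter> U"
  proof (intro equalityI subsetI)
    fix u assume u: "u \<in> {u \<in> U. u * f \<in> W}"
    hence "u * f \<in> P" "u \<in> polys n" by (auto simp: W_def U_def upto_polys)
    hence "u \<in> P" using primeideal.I_prime[OF P, of u f] fp f(2) by simp
    thus "u \<in> P \<inter> U" using u by simp
  next
    fix u assume u: "u \<in> P \<inter> U"
    hence "u * f \<in> P" using ideal_mult[OF PI _ fp, of u] by (simp add: mult.commute)
    thus "u \<in> {u \<in> U. u * f \<in> W}" using u deg by (simp add: W_def)
  qed
  moreover have "mpoly_space.dim {w + u * f | w u. w \<in> W \<and> u \<in> U} \<le> mpoly_space.dim (Q \<inter> polys_upto n t)"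
  proof (rule dim_mono_fin[OF ideal_upto(2)[OF Q]])
    have "u * f \<in> Q" if "u \<in> U" for u using ideal_mult[OF Q f(1)] upto_polys that by (auto simp: U_def)
    thus "{w + u * f | w u. w \<in> W \<and> u \<in> U} \<subseteq> Q \<inter> polys_upto n t"
      using PQ deg by (auto simp: W_def intro!: ideal_add[OF Q] mpoly_space.subspace_add[OF subspace_upto])
  qed
  ultimately have "mpoly_space.dim W + mpoly_space.dim U \<le> mpoly_space.dim (Q \<inter> polys_upto n t) + mpoly_space.dim (P \<inter> U)"
    by simp
  thus ?thesis using dim_Int_upto_le[of P n t] dim_Int_upto_le[of P n "t - a"] dim_Int_upto_le[of Q n t]
    by (simp add: filtered_hilb_def W_def U_def)
qed

text \<open>Adding up \<open>t + 1\<close> such steps shows that the order of growth for \<open>Q\<close> is at least one less than that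
for \<open>P\<close>.\<close>

lemma filt_prime_drop:
  fixes P Q :: "('k::field) mpoly set"
  assumes P: "primeideal P (poly_ring n)" and Q: "ideal Q (poly_ring n)" and PQ: "P \<subset> Q"
  shows "\<exists>a. \<forall>t. (t + 1) * filtered_hilb n Q t \<le> filtered_hilb n P (t + (t + 1) * a)"
proof -
  obtain f where f: "f \<in> Q" "f \<notin> P" using PQ by blast
  obtain a where a: "a \<ge> 1" "f \<in> polys_upto n a" using upto_exists[of f n] ideal_subset[OF Q] f(1) by blast
  have "k * filtered_hilb n Q t \<le> filtered_hilb n P (t + k * a)" for t k
  proof (induction k)
    case (Suc k)
    have "filtered_hilb n Q t \<le> filtered_hilb n Q (t + Suc k * a)" by (rule filt_mono[OF Q]) simp
    moreover have "filtered_hilb n Q (t + Suc k * a) + filtered_hilb n P (t + Suc k * a - a) \<le> filtered_hilb n P (t + Suc k * a)"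
      using PQ by (intro filt_prime_step[OF P Q _ f a(2)]) auto
    moreover have "t + Suc k * a - a = t + k * a" by simp
    ultimately show ?case using Suc by simp
  qed simp
  thus ?thesis by blast
qed

definition prime_chain :: "nat \<Rightarrow> ('k::field) mpoly set \<Rightarrow> nat \<Rightarrow> bool" where
  "prime_chain n I l \<longleftrightarrow> (\<exists>P. (\<forall>i\<le>l. primeideal (P i) (poly_ring n) \<and> I \<subseteq> P i) \<and> (\<forall>i<l. P i \<subset> P (Suc i)))"

lemma prime_chain_le_growth:
  fixes I :: "('k::field) mpoly set"
  assumes I: "ideal I (poly_ring n)" and gr: "growth n I D" and ch: "prime_chain n I l"
  shows "l \<le> D"
proof (rule ccontr)
  assume "\<not> l \<le> D"
  hence lD: "D < l" by simp
  obtain P where P: "\<And>i. i \<le> l \<Longrightarrow> primeideal (P i) (poly_ring n)" "\<And>i. i \<le> l \<Longrightarrow> I \<subseteq> P i" "\<And>i. i < l \<Longrightarrow> P i \<subset> P (Suc i)"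
    using ch unfolding prime_chain_def by blast
  have PI: "ideal (P i) (poly_ring n)" if "i \<le> l" for i using P(1)[OF that] by (simp add: primeideal_def)
  obtain c where c: "\<And>t. (\<Sum>u\<le>t. hilb n I u) \<le> c * (t + 1) ^ D" using gr by (auto simp: growth_def)
  have "\<exists>c. \<forall>t. filtered_hilb n (P i) t \<le> c * (t + 1) ^ (D - i)" if "i \<le> D" for i
    using that
  proof (induction i)
    case 0
    have "filtered_hilb n (P 0) t \<le> c * (t + 1) ^ D" for t
      using filt_antimono[OF P(2), of 0 n t] filt_le_sum[OF I, of t] c[of t] by simp
    thus ?case by auto
  next
    case (Suc i)
    then obtain c where c: "\<And>t. filtered_hilb n (P i) t \<le> c * (t + 1) ^ (D - i)" by auto
    obtain a where a: "\<And>t. (t + 1) * filtered_hilb n (P (Suc i)) t \<le> filtered_hilb n (P i) (t + (t + 1) * a)"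
      using filt_prime_drop[OF P(1) PI P(3), of i] Suc.prems lD by auto
    have D: "D - i = Suc (D - Suc i)" using Suc.prems by simp
    have "filtered_hilb n (P (Suc i)) t \<le> (c * (a + 1) ^ (D - i)) * (t + 1) ^ (D - Suc i)" for t
    proof -
      have "(t + 1) * filtered_hilb n (P (Suc i)) t \<le> c * (t + (t + 1) * a + 1) ^ (D - i)"
        using order_trans[OF a[of t] c] .
      also have "t + (t + 1) * a + 1 = (a + 1) * (t + 1)" by (simp add: algebra_simps)
      also have "c * ((a + 1) * (t + 1)) ^ (D - i) = (t + 1) * ((c * (a + 1) ^ (D - i)) * (t + 1) ^ (D - Suc i))"
        unfolding power_mult_distrib by (simp only: D power_Suc mult_ac)
      finally show ?thesis by (simp only: mult_le_cancel1)
    qed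
    thus ?case by blast
  qed
  from this[of D] obtain c where c: "\<And>t. filtered_hilb n (P D) t \<le> c" by auto
  obtain a where a: "\<And>t. (t + 1) * filtered_hilb n (P (Suc D)) t \<le> filtered_hilb n (P D) (t + (t + 1) * a)"
    using filt_prime_drop[OF P(1) PI P(3), of D] lD by auto
  have "1 \<notin> P (Suc D)"
  proof
    assume "1 \<in> P (Suc D)"
    hence "P (Suc D) = polys n"
      using ideal.one_imp_carrier[OF PI[of "Suc D"]] lD by simp
    thus False using primeideal.I_notcarr[OF P(1), of "Suc D"] lD by auto
  qed
  hence "1 \<le> filtered_hilb n (P (Suc D)) c" using lD by (intro filt_proper PI) auto
  hence "(c + 1) * 1 \<le> (c + 1) * filtered_hilb n (P (Suc D)) c" by (rule mult_le_mono2)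
  also have "\<dots> \<le> c" using order_trans[OF a c] .
  finally show False by simp
qed

section \<open>Construction of chains of primes\<close>

lemma hcomp_mult: "hcomp t (f * g) = (\<Sum>i\<le>t. hcomp i f * hcomp (t - i) g)"
proof -
  define T where "T = {..max t (\<Sum>m\<in>supp f. mdeg m)}"
  have "mdeg ` supp f \<subseteq> T"
  proof
    fix d assume "d \<in> mdeg ` supp f"
    then obtain m where m: "m \<in> supp f" "d = mdeg m" by auto
    have "mdeg m \<le> (\<Sum>m\<in>supp f. mdeg m)" using m by (intro member_le_sum) auto
    thus "d \<in> T" by (simp add: T_def m)
  qed
  hence dec: "(\<Sum>i\<in>T. hcomp i f) = f" by (intro hcomp_decomposition[symmetric]) (auto simp: T_def)
  have "f * g = (\<Sum>i\<in>T. hcomp i f) * g" unfolding dec ..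
  also have "\<dots> = (\<Sum>i\<in>T. g * hcomp i f)" by (simp only: mult.commute[of _ g] sum_distrib_left)
  finally have "f * g = (\<Sum>i\<in>T. g * hcomp i f)" .
  hence "hcomp t (f * g) = (\<Sum>i\<in>T. hcomp t (g * hcomp i f))" by (simp add: hcomp_sum)
  also have "\<dots> = (\<Sum>i\<in>T. if i \<le> t then hcomp (t - i) g * hcomp i f else 0)"
    by (intro sum.cong refl hcomp_mult_homogeneous) (auto simp: in_keys_iff hcomp_lookup split: if_splits)
  also have "\<dots> = (\<Sum>i\<le>t. hcomp i f * hcomp (t - i) g)"
    by (rule sum.mono_neutral_cong_right) (auto simp: T_def mult.commute)
  finally show ?thesis .
qed

text \<open>For a homogeneous ideal primality can be tested on forms: consider the lowest components outside
\<open>P\<close> of both factors.\<close>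

lemma graded_primeI:
  fixes P :: "('k::field) mpoly set"
  assumes P: "graded n P" and one: "1 \<notin> P"
    and pr: "\<And>f g a b. f \<in> forms n a \<Longrightarrow> g \<in> forms n b \<Longrightarrow> f * g \<in> P \<Longrightarrow> f \<in> P \<or> g \<in> P"
  shows "primeideal P (poly_ring n)"
proof (rule primeidealI[OF graded_ideal[OF P] poly_ring_cring])
  note I = graded_ideal[OF P]
  show "carrier (poly_ring n) \<noteq> P" using one one_polys by blast
  fix f g assume fg: "f \<in> polys n" "g \<in> polys n" "f \<otimes>\<^bsub>poly_ring n\<^esub> g \<in> P"
  show "f \<in> P \<or> g \<in> P"
  proof (rule ccontr)
    assume "\<not> ?thesis"
    hence nf: "f \<notin> P" and ng: "g \<notin> P" by auto
    have ex: "\<exists>a. hcomp a f \<notin> P" if "f \<notin> P" for f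
    proof (rule ccontr)
      assume "\<not> ?thesis"
      hence "(\<Sum>t\<in>mdeg ` supp f. hcomp t f) \<in> P" by (intro ideal_sum[OF I]) auto
      thus False using that hcomp_decomposition[of "mdeg ` supp f" f] by simp
    qed
    define a where "a = (LEAST a. hcomp a f \<notin> P)"
    define b where "b = (LEAST b. hcomp b g \<notin> P)"
    have a: "hcomp a f \<notin> P" "\<And>i. i < a \<Longrightarrow> hcomp i f \<in> P"
      unfolding a_def using LeastI_ex[OF ex[OF nf]] not_less_Least by blast+
    have b: "hcomp b g \<notin> P" "\<And>i. i < b \<Longrightarrow> hcomp i g \<in> P"
      unfolding b_def using LeastI_ex[OF ex[OF ng]] not_less_Least by blast+
    have fp: "hcomp i f \<in> polys n" "hcomp i g \<in> polys n" for i
      using fg by (auto intro: forms_polys[OF hcomp_forms])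
    have "hcomp (a + b) (f * g) \<in> P" using graded_hcomp[OF P] fg(3) by simp
    moreover have "hcomp (a + b) (f * g)
        = hcomp a f * hcomp b g + (\<Sum>i\<in>{..a + b} - {a}. hcomp i f * hcomp (a + b - i) g)"
      unfolding hcomp_mult by (subst sum.remove[of _ a]) auto
    moreover have "(\<Sum>i\<in>{..a + b} - {a}. hcomp i f * hcomp (a + b - i) g) \<in> P"
    proof (rule ideal_sum[OF I])
      fix i assume i: "i \<in> {..a + b} - {a}"
      show "hcomp i f * hcomp (a + b - i) g \<in> P"
      proof (cases "i < a")
        case True
        thus ?thesis using ideal_mult[OF I a(2)[OF True] fp(2)[of "a + b - i"]] by (simp add: mult.commute)
      next
        case False
        hence "a + b - i < b" using i by auto
        thus ?thesis using ideal_mult[OF I b(2) fp(1)[of i]] by simp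
      qed
    qed
    ultimately have "hcomp a f * hcomp b g \<in> P"
      using ideal_diff[OF I, of "hcomp a f * hcomp b g + (\<Sum>i\<in>{..a + b} - {a}. hcomp i f * hcomp (a + b - i) g)"
          "\<Sum>i\<in>{..a + b} - {a}. hcomp i f * hcomp (a + b - i) g"] by simp
    thus False using pr[OF hcomp_forms[OF fg(1)] hcomp_forms[OF fg(2)]] a b by blast
  qed
qed

text \<open>This is the negation of growth \<open>D - 1\<close>. For \<open>D = 0\<close> it is to say that \<open>R/J\<close> is not zero, which
growth with an exponent in the natural numbers cannot express.\<close>

definition dim_at_least :: "nat \<Rightarrow> ('k::field) mpoly set \<Rightarrow> nat \<Rightarrow> bool" where
  "dim_at_least n J D \<longleftrightarrow> (if D = 0 then 1 \<notin> J else \<not> growth n J (D - 1))"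

lemma chain_Union_ideal:
  assumes ne: "C \<noteq> {}" and ch: "\<And>J K. J \<in> C \<Longrightarrow> K \<in> C \<Longrightarrow> J \<subseteq> K \<or> K \<subseteq> J"
    and I: "\<And>J. J \<in> C \<Longrightarrow> ideal J (poly_ring n)"
  shows "ideal (\<Union>C) (poly_ring n)"
  unfolding ideal_iff
proof (intro conjI ballI)
  show "\<Union>C \<subseteq> polys n" using I ideal_subset by blast
  show "0 \<in> \<Union>C" using ne I ideal_zero by blast
  show "a + b \<in> \<Union>C" if ab: "a \<in> \<Union>C" "b \<in> \<Union>C" for a b
  proof -
    obtain J K where JK: "J \<in> C" "K \<in> C" "a \<in> J" "b \<in> K" using ab by blast
    hence "(a \<in> J \<and> b \<in> J) \<or> (a \<in> K \<and> b \<in> K)" using ch[of J K] by blast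
    thus ?thesis using I JK ideal_add by blast
  qed
  show "x * a \<in> \<Union>C" if "a \<in> \<Union>C" "x \<in> polys n" for a x using that I ideal_mult by blast
qed

text \<open>Small growth of the union is witnessed by \<open>D - 1\<close> linear forms and the finitely many monomials of one
degree, hence by a single member of the chain. This replaces the ascending chain condition.\<close>

lemma chain_Union_dim:
  fixes C :: "('k::field) mpoly set set"
  assumes inf: "infinite (UNIV :: 'k set)" and ne: "C \<noteq> {}" and ch: "\<And>J K. J \<in> C \<Longrightarrow> K \<in> C \<Longrightarrow> J \<subseteq> K \<or> K \<subseteq> J"
    and C: "\<And>J. J \<in> C \<Longrightarrow> graded n J" "\<And>J. J \<in> C \<Longrightarrow> dim_at_least n J D"
  shows "graded n (\<Union>C)" "dim_at_least n (\<Union>C) D"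
proof -
  have CI: "\<And>J. J \<in> C \<Longrightarrow> ideal J (poly_ring n)" using C graded_ideal by blast
  have UI: "ideal (\<Union>C) (poly_ring n)" by (rule chain_Union_ideal[OF ne ch CI])
  show U: "graded n (\<Union>C)" using UI C(1) by (auto simp: graded_def)
  show "dim_at_least n (\<Union>C) D"
  proof (cases "D = 0")
    case True
    thus ?thesis using C(2) by (auto simp: dim_at_least_def)
  next
    case False
    have "\<not> growth n (\<Union>C) (D - 1)"
    proof
      assume "growth n (\<Union>C) (D - 1)"
      then obtain zs where zs: "length zs = D - 1" "set zs \<subseteq> forms n 1" "finite_length n (ext n (\<Union>C) zs)"
        by (rule exists_linear_reduction[OF inf U])
      have zp: "set zs \<subseteq> polys n" using zs forms_polys by blast
      let ?B = "(\<lambda>J. ext n J zs) ` C"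
      have mono: "ext n J zs \<subseteq> ext n K zs" if "J \<subseteq> K" "K \<in> C" for J K
        unfolding ext_def using that zp ideal_subset[OF CI] by (intro gen_mono) auto
      have chB: "J \<subseteq> K \<or> K \<subseteq> J" if JK: "J \<in> ?B" "K \<in> ?B" for J K
      proof -
        obtain J' K' where "J' \<in> C" "J = ext n J' zs" "K' \<in> C" "K = ext n K' zs" using JK by blast
        thus ?thesis using ch[of J' K'] mono[of J' K'] mono[of K' J'] by auto
      qed
      have BI: "ideal (\<Union>?B) (poly_ring n)"
      proof (rule chain_Union_ideal)
        show "?B \<noteq> {}" using ne by simp
        show "ideal J (poly_ring n)" if "J \<in> ?B" for J using that ext_ideal[OF CI zp] by auto
      qed (rule chB)
      have "ext n (\<Union>C) zs \<subseteq> \<Union>?B"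
      proof (rule ext_minimal[OF BI])
        show "\<Union>C \<subseteq> \<Union>?B"
        proof (rule Union_least)
          fix J assume "J \<in> C"
          thus "J \<subseteq> \<Union>?B" using ext_superset(1)[OF CI zp, of J] by auto
        qed
        obtain J where "J \<in> C" using ne by blast
        thus "set zs \<subseteq> \<Union>?B" using ext_superset(2)[OF CI zp, of J] by auto
      qed
      moreover obtain t0 where "forms n t0 \<subseteq> ext n (\<Union>C) zs"
        using zs(3) unfolding finite_length_iff[OF ext_ideal[OF UI zp]] by blast
      moreover have "monomial ` mons {..<n} t0 \<subseteq> (forms n t0 :: 'k mpoly set)" using monomial_forms by blast
      ultimately have sub: "monomial ` mons {..<n} t0 \<subseteq> \<Union>?B" by simp
      have fin: "finite (monomial ` mons {..<n} t0 :: 'k mpoly set)" by (simp add: finite_mons)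
      have chain: "subset.chain UNIV ?B" unfolding subset_chain_def using chB by blast
      have "?B \<noteq> {}" using ne by simp
      then obtain B where B: "B \<in> ?B" "monomial ` mons {..<n} t0 \<subseteq> B"
        using finite_subset_Union_chain[OF fin sub _ chain] by metis
      then obtain J where J: "J \<in> C" "B = ext n J zs" by blast
      have BI: "ideal B (poly_ring n)" unfolding J by (rule ext_ideal[OF CI[OF J(1)] zp])
      have "forms n t0 \<subseteq> B" using B(2) by (intro forms_subset_of_monomials[OF BI]) auto
      hence "forms n (t0 + k) \<subseteq> B" for k by (rule forms_upward[OF BI])
      hence "forms n t \<subseteq> B" if "t \<ge> t0" for t using that le_add_diff_inverse[of t0 t] by metis
      hence "finite_length n B" unfolding finite_length_iff[OF BI] by blast
      hence "finite_length n (ext n J zs)" unfolding J(2) .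
      hence "growth n J (length zs + 0)"
        using zs(2) by (intro growth_ext[OF C(1)[OF J(1)] forms_of_degrees_const] growth_of_finite_length) auto
      thus False using C(2)[OF J(1)] False zs(1) by (simp add: dim_at_least_def)
    qed
    thus ?thesis using False by (simp add: dim_at_least_def)
  qed
qed

text \<open>A homogeneous ideal that is maximal among those of dimension at least \<open>D\<close> is prime: if \<open>f g \<in> P\<close>,
then \<open>P : f\<close> contains \<open>P + (g)\<close>, and by the exact sequence the growth of \<open>R/P\<close> is bounded by those
of \<open>R/(P + (f))\<close> and \<open>R/(P + (g))\<close>.\<close>

lemma prime_of_large_dim:
  fixes I :: "('k::field) mpoly set"
  assumes inf: "infinite (UNIV :: 'k set)" and I: "graded n I" and D: "dim_at_least n I D"
  shows "\<exists>P. I \<subseteq> P \<and> graded n P \<and> primeideal P (poly_ring n) \<and> dim_at_least n P D"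
proof -
  define A where "A = {J. graded n J \<and> I \<subseteq> J \<and> dim_at_least n J D}"
  have "\<exists>P\<in>A. \<forall>X\<in>A. P \<subseteq> X \<longrightarrow> X = P"
  proof (rule subset_Zorn_nonempty)
    show "A \<noteq> {}" using I D by (auto simp: A_def)
    fix C assume ne: "C \<noteq> {}" and ch: "subset.chain A C"
    have CA: "C \<subseteq> A" and ch': "\<And>J K. J \<in> C \<Longrightarrow> K \<in> C \<Longrightarrow> J \<subseteq> K \<or> K \<subseteq> J"
      using ch unfolding subset_chain_def by blast+
    have "graded n (\<Union>C)" "dim_at_least n (\<Union>C) D"
      using CA by (auto intro!: chain_Union_dim[OF inf ne ch'] simp: A_def)
    moreover have "I \<subseteq> \<Union>C" using ne CA by (auto simp: A_def)
    ultimately show "\<Union>C \<in> A" by (simp add: A_def)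
  qed
  then obtain P where P: "graded n P" "I \<subseteq> P" "dim_at_least n P D"
    and max: "\<And>X. graded n X \<Longrightarrow> P \<subseteq> X \<Longrightarrow> dim_at_least n X D \<Longrightarrow> X = P"
    by (auto simp: A_def)
  note PI = graded_ideal[OF P(1)]
  have one: "1 \<notin> P"
  proof
    assume 1: "1 \<in> P"
    have "forms n t \<subseteq> P" for t using ideal_mult[OF PI 1] forms_polys by fastforce
    hence "finite_length n P" using finite_length_iff[OF PI] by blast
    hence "growth n P (D - 1)" using growth_mono[OF growth_of_finite_length] by blast
    thus False using P(3) 1 by (auto simp: dim_at_least_def split: if_splits)
  qed
  have "primeideal P (poly_ring n)"
  proof (rule graded_primeI[OF P(1) one])
    fix f g a b assume f: "f \<in> forms n a" and g: "g \<in> forms n b" and fg: "f * g \<in> P"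
    show "f \<in> P \<or> g \<in> P"
    proof (rule ccontr)
      assume "\<not> ?thesis"
      hence nf: "f \<notin> P" and ng: "g \<notin> P" by auto
      have fp: "f \<in> polys n" "g \<in> polys n" using f g forms_polys by blast+
      have small: "\<not> dim_at_least n (adj n P h) D" if "h \<in> forms n c" "h \<notin> P" for h c
        using max[OF graded_adj[OF P(1) that(1)] adj_superset] adj_self[OF PI, of h] that(2) by auto
      have f': "\<not> dim_at_least n (adj n P f) D" and g': "\<not> dim_at_least n (adj n P g) D"
        using small[OF f nf] small[OF g ng] by auto
      show False
      proof (cases "D = 0")
        case True
        have "1 \<in> adj n P f" "1 \<in> adj n P g" using f' g' True by (auto simp: dim_at_least_def)
        then obtain p h p' h' where 1: "1 = p + h * f" "p \<in> P" "h \<in> polys n" "1 = p' + h' * g" "p' \<in> P" "h' \<in> polys n"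
          unfolding adj_def by blast
        have "h * f * (h' * g) \<in> P"
          using ideal_mult[OF PI fg mult_polys[OF 1(3,6)]] by (simp add: mult_ac)
        moreover have "(1::'k mpoly) = p + h * f * (p' + h' * g)" using 1(1) 1(4)[symmetric] by simp
        hence "(1::'k mpoly) = p + ((h * f) * p' + h * f * (h' * g))" by (simp add: algebra_simps)
        moreover have "(h * f) * p' \<in> P" by (rule ideal_mult[OF PI 1(5) mult_polys[OF 1(3) fp(1)]])
        hence "p + ((h * f) * p' + h * f * (h' * g)) \<in> P"
          using calculation(1) 1(2) by (intro ideal_add[OF PI])
        ultimately show False using one by simp
      next
        case False
        obtain c1 where c1: "\<And>t. (\<Sum>u\<le>t. hilb n (adj n P f) u) \<le> c1 * (t + 1) ^ (D - 1)"
          using f' False by (auto simp: dim_at_least_def growth_def)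
        obtain c2 where c2: "\<And>t. (\<Sum>u\<le>t. hilb n (adj n P g) u) \<le> c2 * (t + 1) ^ (D - 1)"
          using g' False by (auto simp: dim_at_least_def growth_def)
        have "adj n P g \<subseteq> colon n P f"
          using fg fp by (intro adj_minimal colon_ideal[OF PI] colon_superset[OF PI]) (auto simp: colon_def mult.commute)
        hence le: "hilb n (colon n P f) u \<le> hilb n (adj n P g) u" for u by (intro hilb_antimono) auto
        have "(\<Sum>u\<le>t. hilb n P u) \<le> (c1 + c2) * (t + 1) ^ (D - 1)" for t
        proof -
          have "(\<Sum>u\<le>t. hilb n P u) = (\<Sum>u\<le>t. hilb n (adj n P f) u) + (\<Sum>u\<le>t. if a \<le> u then hilb n (colon n P f) (u - a) else 0)"
            by (simp add: hilb_exact[OF P(1) f] sum.distrib)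
          also have "(\<Sum>u\<le>t. if a \<le> u then hilb n (colon n P f) (u - a) else 0) = (\<Sum>u\<in>{a..t}. hilb n (colon n P f) (u - a))"
            by (rule sum.mono_neutral_cong_right) auto
          also have "\<dots> \<le> (\<Sum>u\<in>{a..t}. hilb n (adj n P g) (u - a))" by (rule sum_mono) (rule le)
          also have "\<dots> = (\<Sum>v\<in>(\<lambda>u. u - a) ` {a..t}. hilb n (adj n P g) v)"
            by (subst sum.reindex) (auto simp: inj_on_def)
          also have "\<dots> \<le> (\<Sum>v\<le>t. hilb n (adj n P g) v)" by (rule sum_mono2) auto
          finally show ?thesis using c1[of t] c2[of t] by (simp add: algebra_simps)
        qed
        hence "growth n P (D - 1)" unfolding growth_def by blast
        thus False using P(3) False by (simp add: dim_at_least_def)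
      qed
    qed
  qed
  thus ?thesis using P by blast
qed

text \<open>Start with a homogeneous prime \<open>P\<close> of dimension at least \<open>D + 1\<close> and continue above \<open>P + (f)\<close>
for a form \<open>f\<close> of positive degree outside \<open>P\<close>, which lowers the dimension by at most one.\<close>

lemma prime_chain_exists:
  fixes I :: "('k::field) mpoly set"
  assumes inf: "infinite (UNIV :: 'k set)"
  shows "graded n I \<Longrightarrow> dim_at_least n I D \<Longrightarrow> prime_chain n I D"
proof (induction D arbitrary: I)
  case 0
  obtain P where "I \<subseteq> P" "primeideal P (poly_ring n)" using prime_of_large_dim[OF inf 0] by blast
  thus ?case unfolding prime_chain_def by (intro exI[of _ "\<lambda>_. P"]) auto
next
  case (Suc D)
  obtain P where P: "I \<subseteq> P" "graded n P" "primeideal P (poly_ring n)" "dim_at_least n P (Suc D)"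
    using prime_of_large_dim[OF inf Suc.prems] by blast
  note PI = graded_ideal[OF P(2)]
  have ng: "\<not> growth n P D" using P(4) by (simp add: dim_at_least_def)
  have "\<exists>a\<ge>1. \<not> forms n a \<subseteq> P"
  proof (rule ccontr)
    assume "\<not> ?thesis"
    hence "finite_length n P" unfolding finite_length_iff[OF PI] by blast
    thus False using ng growth_mono[OF growth_of_finite_length] by blast
  qed
  then obtain a f where f: "a \<ge> 1" "f \<in> forms n a" "f \<notin> P" by blast
  have A: "graded n (adj n P f)" by (rule graded_adj[OF P(2) f(2)])
  have "dim_at_least n (adj n P f) D"
  proof (cases "D = 0")
    case True
    have "1 \<notin> adj n P f"
    proof
      assume "1 \<in> adj n P f"
      then obtain p h where 1: "1 = p + h * f" "p \<in> P" "h \<in> polys n" unfolding adj_def by blast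
      have "hcomp 0 1 = hcomp 0 p" using hcomp_mult_homogeneous[of f a 0 h] f by (simp add: 1(1) hcomp_add forms_def)
      moreover have "hcomp 0 (1 :: 'k mpoly) = 1" using hcomp_homogeneous[of "1 :: 'k mpoly" 0 0] by simp
      ultimately have "1 \<in> P" using graded_hcomp[OF P(2) 1(2), of 0] by simp
      hence "P = polys n" using ideal.one_imp_carrier[OF PI] by simp
      thus False using primeideal.I_notcarr[OF P(3)] by simp
    qed
    thus ?thesis using True by (simp add: dim_at_least_def)
  next
    case False
    hence "\<not> growth n (adj n P f) (D - 1)" using growth_adj[OF P(2) f(2,1), of "D - 1"] ng by auto
    thus ?thesis using False by (simp add: dim_at_least_def)
  qed
  then obtain Q where Q: "\<And>i. i \<le> D \<Longrightarrow> primeideal (Q i) (poly_ring n) \<and> adj n P f \<subseteq> Q i" "\<And>i. i < D \<Longrightarrow> Q i \<subset> Q (Suc i)"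
    using Suc.IH[OF A] unfolding prime_chain_def by blast
  define R where "R i = (case i of 0 \<Rightarrow> P | Suc j \<Rightarrow> Q j)" for i
  have sub: "P \<subset> adj n P f" using adj_superset[of P n f] adj_self[OF PI, of f] f(3) by blast
  have "primeideal (R i) (poly_ring n) \<and> I \<subseteq> R i" if "i \<le> Suc D" for i
    using that P Q(1) sub by (cases i) (auto simp: R_def)
  moreover have "R i \<subset> R (Suc i)" if "i < Suc D" for i
  proof (cases i)
    case 0
    have "adj n P f \<subseteq> Q 0" using Q(1)[of 0] by simp
    thus ?thesis using sub by (simp add: R_def 0 psubset_subset_trans)
  next
    case (Suc j)
    thus ?thesis using Q(2)[of j] that by (simp add: R_def)
  qed
  ultimately show ?case unfolding prime_chain_def by blast
qed

section \<open>Krull dimension of graded quotients\<close>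

lemma coset_eq_set: "I +>\<^bsub>poly_ring n\<^esub> a = {i + a | i. i \<in> I}"
  by (auto simp: a_r_coset_def' )

lemma coset_eq_iff:
  assumes I: "ideal I (poly_ring n)"
  shows "I +>\<^bsub>poly_ring n\<^esub> a = I +>\<^bsub>poly_ring n\<^esub> b \<longleftrightarrow> a - b \<in> I"
proof
  assume "I +>\<^bsub>poly_ring n\<^esub> a = I +>\<^bsub>poly_ring n\<^esub> b"
  moreover have "0 + a \<in> I +>\<^bsub>poly_ring n\<^esub> a" unfolding coset_eq_set using ideal_zero[OF I] by blast
  ultimately obtain i where "0 + a = i + b" "i \<in> I" unfolding coset_eq_set by blast
  thus "a - b \<in> I" by simp
next
  assume ab: "a - b \<in> I"
  have "i + a = (i + (a - b)) + b" "i + b = (i - (a - b)) + a" for i by simp_all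
  thus "I +>\<^bsub>poly_ring n\<^esub> a = I +>\<^bsub>poly_ring n\<^esub> b"
    unfolding coset_eq_set using ideal_add[OF I _ ab] ideal_diff[OF I _ ab] by blast
qed

lemma quot_chain_iff:
  fixes I :: "('k::field) mpoly set"
  assumes I: "ideal I (poly_ring n)"
  shows "(\<exists>P :: nat \<Rightarrow> 'k mpoly set set. (\<forall>i\<le>l. primeideal (P i) (poly_ring n Quot I)) \<and> (\<forall>i<l. P i \<subset> P (Suc i)))
    \<longleftrightarrow> prime_chain n I l"
proof
  let ?R = "poly_ring n :: 'k mpoly ring"
  interpret ideal I ?R by (rule I)
  interpret h: ring_hom_ring ?R "?R Quot I" "(+>\<^bsub>?R\<^esub>) I" by (rule rcos_ring_hom_ring)
  have carr: "carrier (?R Quot I) = (\<lambda>r. I +>\<^bsub>?R\<^esub> r) ` polys n"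
    by (auto simp: FactRing_def A_RCOSETS_def' )
  {
    assume "\<exists>P :: nat \<Rightarrow> 'k mpoly set set. (\<forall>i\<le>l. primeideal (P i) (?R Quot I)) \<and> (\<forall>i<l. P i \<subset> P (Suc i))"
    then obtain P :: "nat \<Rightarrow> 'k mpoly set set" where P: "\<And>i. i \<le> l \<Longrightarrow> primeideal (P i) (?R Quot I)" "\<And>i. i < l \<Longrightarrow> P i \<subset> P (Suc i)"
      by blast
    define Q where "Q i = {r \<in> polys n. I +>\<^bsub>?R\<^esub> r \<in> P i}" for i
    have "primeideal (Q i) ?R \<and> I \<subseteq> Q i" if "i \<le> l" for i
    proof
      show "primeideal (Q i) ?R" unfolding Q_def
        by (rule h.primeideal_vimage[OF poly_ring_cring P(1)[OF that]])
      have PI: "ideal (P i) (?R Quot I)" using P(1)[OF that] by (simp add: primeideal_def)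
      have "I +>\<^bsub>?R\<^esub> r \<in> P i" if "r \<in> I" for r
      proof -
        have "I +>\<^bsub>?R\<^esub> r = I +>\<^bsub>?R\<^esub> 0" using that by (simp add: coset_eq_iff[OF I])
        also have "\<dots> = \<zero>\<^bsub>?R Quot I\<^esub>" by (simp add: FactRing_def coset_eq_set)
        finally show ?thesis using additive_subgroup.zero_closed[OF ideal.axioms(1)[OF PI]] by simp
      qed
      thus "I \<subseteq> Q i" using ideal_subset[OF I] by (auto simp: Q_def)
    qed
    moreover have "Q i \<subset> Q (Suc i)" if i: "i < l" for i
    proof -
      obtain x where x: "x \<in> P (Suc i)" "x \<notin> P i" using P(2)[OF i] by blast
      have PI: "ideal (P (Suc i)) (?R Quot I)" using P(1)[of "Suc i"] i by (simp add: primeideal_def)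
      have "x \<in> carrier (?R Quot I)" by (rule ideal.Icarr[OF PI x(1)])
      then obtain r where "r \<in> polys n" "x = I +>\<^bsub>?R\<^esub> r" unfolding carr by (elim imageE)
      hence "r \<in> Q (Suc i)" "r \<notin> Q i" using x by (simp_all add: Q_def)
      moreover have "Q i \<subseteq> Q (Suc i)" using psubset_imp_subset[OF P(2)[OF i]] by (auto simp: Q_def)
      ultimately show ?thesis by (intro psubsetI) auto
    qed
    ultimately show "prime_chain n I l" unfolding prime_chain_def by (intro exI[of _ Q]) simp
  }
  {
    assume "prime_chain n I l"
    then obtain Q where Q: "\<And>i. i \<le> l \<Longrightarrow> primeideal (Q i) ?R" "\<And>i. i \<le> l \<Longrightarrow> I \<subseteq> Q i" "\<And>i. i < l \<Longrightarrow> Q i \<subset> Q (Suc i)"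
      unfolding prime_chain_def by blast
    define P where "P i = (\<lambda>r. I +>\<^bsub>?R\<^esub> r) ` Q i" for i
    have QI: "ideal (Q i) ?R" if "i \<le> l" for i using Q(1)[OF that] by (simp add: primeideal_def)
    have mem: "I +>\<^bsub>?R\<^esub> r \<in> P i \<longleftrightarrow> r \<in> Q i" if "i \<le> l" for i r
    proof
      assume "I +>\<^bsub>?R\<^esub> r \<in> P i"
      then obtain q where q: "q \<in> Q i" "r - q \<in> I" using coset_eq_iff[OF I, of r] by (auto simp: P_def)
      hence "(r - q) + q \<in> Q i" using Q(2)[OF that] by (intro ideal_add[OF QI[OF that]]) auto
      thus "r \<in> Q i" by simp
    qed (auto simp: P_def)
    have "primeideal (P i) (?R Quot I)" if i: "i \<le> l" for i
    proof (rule primeidealI)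
      show "ideal (P i) (?R Quot I)" unfolding P_def by (rule ring_ideal_imp_quot_ideal[OF I QI[OF i]])
      show "cring (?R Quot I)" by (rule quotient_is_cring[OF poly_ring_cring])
      have "1 \<notin> Q i"
        using ideal.one_imp_carrier[OF QI[OF i]] primeideal.I_notcarr[OF Q(1)[OF i]] by auto
      hence "I +>\<^bsub>?R\<^esub> 1 \<notin> P i" using mem[OF i] by simp
      moreover have "I +>\<^bsub>?R\<^esub> 1 \<in> carrier (?R Quot I)" unfolding carr by (rule imageI) simp
      ultimately show "carrier (?R Quot I) \<noteq> P i" by metis
      fix x y assume xy: "x \<in> carrier (?R Quot I)" "y \<in> carrier (?R Quot I)" "x \<otimes>\<^bsub>?R Quot I\<^esub> y \<in> P i"
      obtain a where a: "a \<in> polys n" "x = I +>\<^bsub>?R\<^esub> a" using xy(1) unfolding carr by (elim imageE)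
      obtain b where b: "b \<in> polys n" "y = I +>\<^bsub>?R\<^esub> b" using xy(2) unfolding carr by (elim imageE)
      note ab = a b
      have "I +>\<^bsub>?R\<^esub> (a * b) \<in> P i" using xy(3) h.hom_mult[OF ab(1,3)] ab by simp
      hence "a * b \<in> Q i" using mem[OF i] by simp
      hence "a \<in> Q i \<or> b \<in> Q i" using primeideal.I_prime[OF Q(1)[OF i] ab(1,3)] by simp
      thus "x \<in> P i \<or> y \<in> P i" using mem[OF i] ab by simp
    qed
    moreover have "P i \<subset> P (Suc i)" if i: "i < l" for i
    proof -
      obtain q where "q \<in> Q (Suc i)" "q \<notin> Q i" using Q(3)[OF i] by blast
      hence "I +>\<^bsub>?R\<^esub> q \<in> P (Suc i)" "I +>\<^bsub>?R\<^esub> q \<notin> P i" using mem[of "Suc i"] mem[of i] i by auto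
      moreover have "P i \<subseteq> P (Suc i)" unfolding P_def by (rule image_mono[OF psubset_imp_subset[OF Q(3)[OF i]]])
      ultimately show ?thesis by (intro psubsetI) auto
    qed
    ultimately show "\<exists>P :: nat \<Rightarrow> 'k mpoly set set. (\<forall>i\<le>l. primeideal (P i) (?R Quot I)) \<and> (\<forall>i<l. P i \<subset> P (Suc i))"
      by (intro exI[of _ P]) simp
  }
qed

lemma krull_dim_quot:
  assumes "ideal I (poly_ring n)"
  shows "krull_dim (poly_ring n Quot I) = Sup {enat l | l. prime_chain n I l}"
  unfolding krull_dim_def quot_chain_iff[OF assms] ..

lemma krull_dim_eqI:
  fixes I :: "('k::field) mpoly set"
  assumes inf: "infinite (UNIV :: 'k set)" and I: "graded n I" and gr: "growth n I D" and D: "dim_at_least n I D"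
  shows "krull_dim (poly_ring n Quot I) = enat D"
  unfolding krull_dim_quot[OF graded_ideal[OF I]]
proof (rule antisym)
  show "Sup {enat l | l. prime_chain n I l} \<le> enat D"
    by (rule Sup_least) (auto dest: prime_chain_le_growth[OF graded_ideal[OF I] gr])
  show "enat D \<le> Sup {enat l | l. prime_chain n I l}"
    by (rule Sup_upper) (use prime_chain_exists[OF inf I D] in blast)
qed

lemma growth_top: "growth n ({0} :: ('k::field) mpoly set) n"
proof -
  note Z = graded_ideal[OF graded_zero]
  obtain ys :: "'k mpoly list" where ys: "length ys = n" "set ys \<subseteq> forms n 1" "forms n 1 \<subseteq> ext n {0} ys"
    using complete_linear_forms[OF graded_zero, of n] by (auto simp: hilb_zero)
  have yp: "set ys \<subseteq> polys n" using ys forms_polys by blast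
  have EI: "ideal (ext n {0} ys) (poly_ring n)" by (rule ext_ideal[OF Z yp])
  have "finite_length n (ext n {0} ys)"
    unfolding finite_length_iff[OF EI] using forms_in_ideal_of_linear[OF EI ys(3)] by blast
  hence "growth n ({0} :: 'k mpoly set) (length ys + 0)"
    using ys(2) by (intro growth_ext[OF graded_zero forms_of_degrees_const] growth_of_finite_length) auto
  thus ?thesis using ys(1) by simp
qed

text \<open>The least exponent of growth satisfies the assumptions of \<open>krull_dim_eqI\<close> unless it is \<open>0\<close>, and in
that case the Krull dimension would be \<open>0\<close>.\<close>

lemma growth_of_krull_dim:
  fixes I :: "('k::field) mpoly set"
  assumes inf: "infinite (UNIV :: 'k set)" and I: "graded n I"
    and d: "krull_dim (poly_ring n Quot I) = enat d" "d \<ge> 1"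
  shows "growth n I d" "\<not> growth n I (d - 1)"
proof -
  have "growth n I n" using growth_antimono[OF growth_top] ideal_zero[OF graded_ideal[OF I]] by blast
  define D where "D = (LEAST D. growth n I D)"
  have gD: "growth n I D" unfolding D_def by (rule LeastI[of _ n]) fact
  have "D \<noteq> 0"
  proof
    assume "D = 0"
    have "krull_dim (poly_ring n Quot I) \<le> enat D"
      unfolding krull_dim_quot[OF graded_ideal[OF I]]
      by (rule Sup_least) (auto dest: prime_chain_le_growth[OF graded_ideal[OF I] gD])
    thus False using d \<open>D = 0\<close> by simp
  qed
  moreover have ng: "\<not> growth n I (D - 1)" using not_less_Least[of "D - 1" "growth n I"] calculation by (simp add: D_def)
  ultimately have "krull_dim (poly_ring n Quot I) = enat D"
    by (intro krull_dim_eqI[OF inf I gD]) (simp add: dim_at_least_def)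
  hence "D = d" using d by simp
  thus "growth n I d" "\<not> growth n I (d - 1)" using gD ng by auto
qed

section \<open>Lexicographic segments\<close>

abbreviation unit :: "nat \<Rightarrow> (nat \<Rightarrow>\<^sub>0 nat)" where "unit i \<equiv> Poly_Mapping.single i 1"

text \<open>For \<open>A\<close> the set of all monomials of one degree these are the lex segments.\<close>

definition up_closed :: "'a::linorder set \<Rightarrow> 'a set \<Rightarrow> bool" where
  "up_closed A U \<longleftrightarrow> U \<subseteq> A \<and> (\<forall>x\<in>U. \<forall>y\<in>A. x \<le> y \<longrightarrow> y \<in> U)"

lemma up_closed_exists:
  assumes "finite A" shows "k \<le> card A \<Longrightarrow> \<exists>U. up_closed A U \<and> card U = k"
proof (induction k)
  case 0
  show ?case by (intro exI[of _ "{}"]) (simp add: up_closed_def)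
next
  case (Suc k)
  then obtain U where U: "up_closed A U" "card U = k" by auto
  have fU: "finite U" using U(1) assms finite_subset by (auto simp: up_closed_def)
  have "A - U \<noteq> {}" using U Suc.prems card_mono[OF fU, of A] by auto
  hence M: "Max (A - U) \<in> A - U" using assms by (intro Max_in) auto
  have "up_closed A (insert (Max (A - U)) U)" unfolding up_closed_def
  proof (intro conjI ballI impI)
    show "insert (Max (A - U)) U \<subseteq> A" using M U(1) by (auto simp: up_closed_def)
    fix x y assume xy: "x \<in> insert (Max (A - U)) U" "y \<in> A" "x \<le> y"
    show "y \<in> insert (Max (A - U)) U"
    proof (cases "y \<in> U")
      case False
      hence "x = Max (A - U)" using xy U(1) by (auto simp: up_closed_def)
      moreover have "y \<le> Max (A - U)" using xy(2) False assms by (intro Max_ge) auto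
      ultimately show ?thesis using xy(3) by simp
    qed simp
  qed
  thus ?case using U(2) M fU by (intro exI[of _ "insert (Max (A - U)) U"]) simp
qed

lemma up_closed_comparable: "up_closed A U \<Longrightarrow> up_closed A V \<Longrightarrow> U \<subseteq> V \<or> V \<subseteq> U"
  unfolding up_closed_def by (meson linear subset_iff)

lemma up_closed_card_subset:
  assumes "finite A" "up_closed A U" "up_closed A V" "card U \<le> card V" shows "U \<subseteq> V"
proof -
  have "finite U" "finite V" using assms finite_subset by (auto simp: up_closed_def)
  thus ?thesis using up_closed_comparable[OF assms(2,3)] assms(4) card_seteq by blast
qed

definition seg :: "nat \<Rightarrow> nat \<Rightarrow> nat \<Rightarrow> (nat \<Rightarrow>\<^sub>0 nat) set" where
  "seg n t k = (SOME U. up_closed (mons {..<n} t) U \<and> card U = k)"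

lemma seg:
  assumes "k \<le> card (mons {..<n} t)" shows "up_closed (mons {..<n} t) (seg n t k)" "card (seg n t k) = k"
  using someI_ex[OF up_closed_exists[OF finite_mons assms]] by (auto simp: seg_def)

text \<open>The shadow of \<open>M\<close>: all products of an element of \<open>M\<close> with a variable.\<close>

definition shad :: "nat \<Rightarrow> (nat \<Rightarrow>\<^sub>0 nat) set \<Rightarrow> (nat \<Rightarrow>\<^sub>0 nat) set" where
  "shad n M = {m + unit i | m i. m \<in> M \<and> i < n}"

lemma mons_add: "a \<in> mons V s \<Longrightarrow> b \<in> mons V t \<Longrightarrow> a + b \<in> mons V (s + t)"
  using keys_add[of a b] by (auto simp: mons_def mdeg_add)

lemma unit_mons: "i \<in> V \<Longrightarrow> unit i \<in> mons V 1" by (simp add: mons_def)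

lemma shad_mons: "M \<subseteq> mons {..<n} t \<Longrightarrow> shad n M \<subseteq> mons {..<n} (Suc t)"
  using mons_add[of _ "{..<n}" t "unit _" 1] unit_mons[of _ "{..<n}"] by (fastforce simp: shad_def)

lemma unit_lookup:
  "cf (unit i) k = (if k = i then 1 else 0)"
  "cf (Poly_Mapping.single i (Suc 0)) k = (if k = i then 1 else 0)"
  by (simp_all add: lookup_single when_def)

lemma minus_unit_mons:
  assumes "m \<in> mons V (Suc t)" "cf m i \<noteq> 0" shows "m - unit i \<in> mons V t"
proof -
  have eq: "m - unit i + unit i = m" by (rule add_minus_single[OF assms(2)])
  have "supp (m - unit i) \<subseteq> supp m" by (auto simp: in_keys_iff lookup_minus)
  moreover have "mdeg (m - unit i) + 1 = Suc t" using mdeg_add[of "m - unit i" "unit i"] eq assms(1) by (simp add: mons_def)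
  ultimately show ?thesis using assms(1) by (auto simp: mons_def)
qed

lemma lex_lessI: "cf a k < cf b k \<Longrightarrow> (\<And>j. j < k \<Longrightarrow> cf a j = cf b j) \<Longrightarrow> a < (b :: nat \<Rightarrow>\<^sub>0 nat)"
  unfolding lex_order_exponents by blast

section \<open>Strongly stable sets\<close>

definition strongly_stable :: "nat \<Rightarrow> (nat \<Rightarrow>\<^sub>0 nat) set \<Rightarrow> bool" where
  "strongly_stable n M \<longleftrightarrow> (\<forall>m\<in>M. \<forall>i j. i < j \<longrightarrow> j < n \<longrightarrow> cf m j \<noteq> 0 \<longrightarrow> m - unit j + unit i \<in> M)"

lemma up_closed_strongly_stable:
  assumes U: "up_closed (mons {..<n} t) U" shows "strongly_stable n U"
  unfolding strongly_stable_def
proof (intro ballI allI impI)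
  fix m i j assume m: "m \<in> U" and ij: "i < j" "j < n" "cf m j \<noteq> 0"
  have mm: "m \<in> mons {..<n} t" using U m by (auto simp: up_closed_def)
  have "t \<noteq> 0"
  proof
    assume "t = 0"
    hence "m = 0" using mm by (simp add: mons_0)
    thus False using ij by simp
  qed
  then obtain s where s: "t = Suc s" by (cases t) auto
  have "m - unit j \<in> mons {..<n} s" using mm ij unfolding s by (intro minus_unit_mons)
  hence "m - unit j + unit i \<in> mons {..<n} (s + 1)" using ij by (intro mons_add unit_mons) auto
  moreover have "m < m - unit j + unit i"
    using ij by (intro lex_lessI[of _ i]) (auto simp: lookup_add lookup_minus unit_lookup)
  ultimately show "m - unit j + unit i \<in> U" using U m s by (auto simp: up_closed_def)
qed

definition upto_var :: "(nat \<Rightarrow>\<^sub>0 nat) set \<Rightarrow> nat \<Rightarrow> (nat \<Rightarrow>\<^sub>0 nat) set" where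
  "upto_var M i = {m \<in> M. supp m \<subseteq> {..i}}"

text \<open>Dividing an element of the shadow by its last variable leads back to \<open>M\<close>, by stability. So each
element of the shadow arises exactly once as \<open>m + unit i\<close> with \<open>m\<close> in \<open>upto_var M i\<close>.\<close>

lemma shad_strongly_stable:
  assumes M: "M \<subseteq> mons {..<n} t" and st: "strongly_stable n M"
  shows "u \<in> shad n M \<Longrightarrow> \<exists>i<n. i = Max (supp u) \<and> cf u i \<noteq> 0 \<and> u - unit i \<in> upto_var M i"
    and "card (shad n M) = (\<Sum>i<n. card (upto_var M i))"
proof -
  show max: "\<exists>i<n. i = Max (supp u) \<and> cf u i \<noteq> 0 \<and> u - unit i \<in> upto_var M i" if u: "u \<in> shad n M" for u
  proof -
    obtain m l where ml: "u = m + unit l" "m \<in> M" "l < n" using u by (auto simp: shad_def)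
    have l: "l \<in> supp u" by (simp add: ml in_keys_iff lookup_add)
    define i where "i = Max (supp u)"
    have i: "i \<in> supp u" unfolding i_def using l by (intro Max_in) auto
    have li: "l \<le> i" unfolding i_def using l by (intro Max_ge) auto
    have sub: "supp u \<subseteq> {..i}" unfolding i_def by (auto intro: Max_ge)
    have un: "supp u \<subseteq> {..<n}" using shad_mons[OF M] u by (auto simp: mons_def)
    hence iN: "i < n" using i by auto
    have "u - unit i \<in> M"
    proof (cases "i = l")
      case True
      thus ?thesis using ml by simp
    next
      case False
      hence "cf m i \<noteq> 0" using i by (auto simp: ml in_keys_iff lookup_add unit_lookup)
      hence "m - unit i + unit l \<in> M" using st ml(2) li False iN by (auto simp: strongly_stable_def)
      moreover have "m - unit i + unit l = u - unit i"
        using \<open>cf m i \<noteq> 0\<close> False by (intro poly_mapping_eqI) (auto simp: ml lookup_add lookup_minus unit_lookup)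
      ultimately show ?thesis by simp
    qed
    moreover have "supp (u - unit i) \<subseteq> {..i}" using sub by (auto simp: in_keys_iff lookup_minus subset_iff)
    ultimately show ?thesis using iN i by (intro exI[of _ i]) (auto simp: upto_var_def i_def in_keys_iff)
  qed
  define T where "T i = (\<lambda>m. m + unit i) ` upto_var M i" for i
  have finM: "finite M" using M finite_mons finite_subset by blast
  have Tmax: "Max (supp u) = i" if uT: "u \<in> T i" for u i
  proof -
    obtain m where m: "u = m + unit i" "supp m \<subseteq> {..i}" using uT by (auto simp: T_def upto_var_def)
    show ?thesis
    proof (rule Max_eqI)
      show "i \<in> supp u" by (simp add: m in_keys_iff lookup_add)
      show "y \<le> i" if "y \<in> supp u" for y using that m(2) keys_add[of m "unit i"] by (auto simp: m(1) split: if_splits)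
    qed simp
  qed
  have "shad n M = (\<Union>i<n. T i)"
  proof (intro equalityI subsetI)
    fix u assume "u \<in> shad n M"
    then obtain i where i: "i < n" "cf u i \<noteq> 0" "u - unit i \<in> upto_var M i" using max by blast
    have "u - unit i + unit i = u" by (rule add_minus_single[OF i(2)])
    hence "u \<in> T i" unfolding T_def using i(3) by (metis image_eqI)
    thus "u \<in> (\<Union>i<n. T i)" using i(1) by blast
  next
    fix u assume "u \<in> (\<Union>i<n. T i)"
    thus "u \<in> shad n M" by (auto simp: T_def shad_def upto_var_def)
  qed
  moreover have "card (\<Union>i<n. T i) = (\<Sum>i<n. card (T i))"
  proof (rule card_UN_disjoint)
    show "\<forall>i\<in>{..<n}. finite (T i)" using finM by (auto simp: T_def upto_var_def)
    show "\<forall>i\<in>{..<n}. \<forall>j\<in>{..<n}. i \<noteq> j \<longrightarrow> T i \<inter> T j = {}" using Tmax by blast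
  qed simp
  moreover have "card (T i) = card (upto_var M i)" for i
    unfolding T_def by (rule card_image) (auto simp: inj_on_def)
  ultimately show "card (shad n M) = (\<Sum>i<n. card (upto_var M i))" by simp
qed

lemma degree_tail:
  assumes "a \<in> mons {..<n} t" "b \<in> mons {..<n} t" "\<And>j. j < k \<Longrightarrow> cf a j = cf b j" "k \<le> n"
  shows "(\<Sum>j\<in>{k..<n}. cf a j) = (\<Sum>j\<in>{k..<n}. cf b j)"
proof -
  have "(\<Sum>j<n. cf a j) = (\<Sum>j<n. cf b j)"
    using assms mdeg_superset[of "{..<n}" a] mdeg_superset[of "{..<n}" b] by (simp add: mons_def)
  moreover have split: "(\<Sum>j<n. cf m j) = (\<Sum>j<k. cf m j) + (\<Sum>j\<in>{k..<n}. cf m j)" for m :: "nat \<Rightarrow>\<^sub>0 nat"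
  proof -
    have "{..<n} = {..<k} \<union> {k..<n}" using assms(4) by auto
    moreover have "(\<Sum>j\<in>{..<k} \<union> {k..<n}. cf m j) = (\<Sum>j<k. cf m j) + (\<Sum>j\<in>{k..<n}. cf m j)"
      by (rule sum.union_disjoint) auto
    ultimately show ?thesis by (rule ssubst)
  qed
  moreover have "(\<Sum>j<k. cf a j) = (\<Sum>j<k. cf b j)" using assms(3) by (intro sum.cong) auto
  ultimately show ?thesis using split[of a] split[of b] by linarith
qed

text \<open>It suffices that division by the last variable is monotone: if \<open>u < v\<close> have the same degree, then
\<open>u\<close> divided by its last variable is at most \<open>v\<close> divided by its last variable.\<close>

lemma shad_up_closed:
  assumes U: "up_closed (mons {..<n} t) U" shows "up_closed (mons {..<n} (Suc t)) (shad n U)"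
  unfolding up_closed_def
proof (intro conjI ballI impI)
  have UM: "U \<subseteq> mons {..<n} t" using U by (simp add: up_closed_def)
  show "shad n U \<subseteq> mons {..<n} (Suc t)" by (rule shad_mons[OF UM])
  fix u v assume u: "u \<in> shad n U" and v: "v \<in> mons {..<n} (Suc t)" and uv: "u \<le> v"
  show "v \<in> shad n U"
  proof (cases "u = v")
    case False
    hence "u < v" using uv by simp
    then obtain k where k: "cf u k < cf v k" "\<And>j. j < k \<Longrightarrow> cf u j = cf v j"
      unfolding lex_order_exponents by blast
    have um: "u \<in> mons {..<n} (Suc t)" using shad_mons[OF UM] u by blast
    obtain i where i: "i < n" "i = Max (supp u)" "cf u i \<noteq> 0" "u - unit i \<in> U"
      using shad_strongly_stable(1)[OF UM up_closed_strongly_stable[OF U] u] by (auto simp: upto_var_def)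
    define i' where "i' = Max (supp v)"
    have kv: "k \<in> supp v" using k(1) by (simp add: in_keys_iff)
    hence kn: "k < n" using v by (auto simp: mons_def)
    have i': "i' \<in> supp v" unfolding i'_def using kv by (intro Max_in) auto
    have ki': "k \<le> i'" unfolding i'_def using kv by (intro Max_ge) auto
    have iv: "cf v i' \<noteq> 0" using i' by (simp add: in_keys_iff)
    have i'n: "i' < n" using i' v by (auto simp: mons_def)
    have tail: "(\<Sum>j\<in>{k..<n}. cf u j) = (\<Sum>j\<in>{k..<n}. cf v j)" using degree_tail[OF um v k(2)] kn by simp
    have ki: "k < i"
    proof (rule ccontr)
      assume "\<not> k < i"
      have "cf u j = 0" if "j > k" for j
      proof (rule ccontr)
        assume "cf u j \<noteq> 0"
        hence "j \<le> i" unfolding i(2) by (intro Max_ge) (auto simp: in_keys_iff)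
        thus False using that \<open>\<not> k < i\<close> by simp
      qed
      hence "(\<Sum>j\<in>{k..<n}. cf u j) = (\<Sum>j\<in>{k}. cf u j)" using kn by (intro sum.mono_neutral_right) auto
      also have "\<dots> < (\<Sum>j\<in>{k}. cf v j)" using k(1) by simp
      also have "\<dots> \<le> (\<Sum>j\<in>{k..<n}. cf v j)" using kn by (intro sum_mono2) auto
      finally show False using tail by simp
    qed
    have um': "u - unit i \<in> mons {..<n} t" using um i(3) by (rule minus_unit_mons)
    have vm': "v - unit i' \<in> mons {..<n} t" using v iv by (rule minus_unit_mons)
    have "u - unit i \<le> v - unit i'"
    proof (cases "k < i' \<or> cf u k < cf v k - 1")
      case True
      have "u - unit i < v - unit i'"
        using k True ki ki' by (intro lex_lessI[of _ k]) (auto simp: lookup_minus unit_lookup)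
      thus ?thesis by simp
    next
      case False
      hence e: "i' = k" "cf v k = Suc (cf u k)" using k(1) ki' by auto
      have low: "cf (u - unit i) j = cf (v - unit i') j" if "j < Suc k" for j
        using that k(2)[of j] e ki by (auto simp: lookup_minus unit_lookup less_Suc_eq)
      have zero: "cf (v - unit i') j = 0" if "j > k" for j
      proof -
        have "j \<notin> supp v"
        proof
          assume "j \<in> supp v"
          hence "j \<le> i'" unfolding i'_def by (intro Max_ge) auto
          thus False using that e by simp
        qed
        thus ?thesis by (simp add: lookup_minus in_keys_iff)
      qed
      have "(\<Sum>j\<in>{Suc k..<n}. cf (u - unit i) j) = (\<Sum>j\<in>{Suc k..<n}. cf (v - unit i') j)"
        using degree_tail[OF um' vm' low] kn by simp
      also have "\<dots> = 0" using zero by simp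
      finally have "cf (u - unit i) j = 0" if "j \<in> {Suc k..<n}" for j using that by simp
      moreover have "cf (u - unit i) j = 0" if "j \<ge> n" for j
      proof -
        have "j \<notin> supp (u - unit i)" using um' that by (auto simp: mons_def)
        thus ?thesis by (simp add: in_keys_iff)
      qed
      ultimately have "cf (u - unit i) j = cf (v - unit i') j" for j
        using low[of j] zero[of j] by (cases "j < Suc k"; cases "j < n") auto
      hence "u - unit i = v - unit i'" by (rule poly_mapping_eqI)
      thus ?thesis by simp
    qed
    hence "v - unit i' \<in> U" using U i(4) vm' by (auto simp: up_closed_def)
    hence "v - unit i' + unit i' \<in> shad n U" using i'n unfolding shad_def by blast
    thus ?thesis unfolding add_minus_single[OF iv] .
  qed (use u in simp)
qed

section \<open>Bayer's comparison of lex segments with strongly stable sets\<close>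

lemma mons_Suc_0: "{m \<in> mons {..<Suc n} t. cf m n = 0} = mons {..<n} t"
proof (intro equalityI subsetI)
  fix m assume m: "m \<in> {m \<in> mons {..<Suc n} t. cf m n = 0}"
  hence "n \<notin> supp m" by (simp add: in_keys_iff)
  thus "m \<in> mons {..<n} t" using m by (auto simp: mons_def less_Suc_eq subset_iff)
next
  fix m assume m: "m \<in> mons {..<n} t"
  hence "n \<notin> supp m" by (auto simp: mons_def)
  thus "m \<in> {m \<in> mons {..<Suc n} t. cf m n = 0}" using m by (auto simp: mons_def in_keys_iff less_Suc_eq)
qed

text \<open>The elements of \<open>M\<close> with exponent \<open>j\<close> in the last variable, with this variable removed.\<close>

definition layer :: "nat \<Rightarrow> (nat \<Rightarrow>\<^sub>0 nat) set \<Rightarrow> nat \<Rightarrow> (nat \<Rightarrow>\<^sub>0 nat) set" where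
  "layer n M j = {m. cf m n = 0 \<and> m + Poly_Mapping.single n j \<in> M}"

lemma layer_mons: "M \<subseteq> mons {..<Suc n} t \<Longrightarrow> layer n M j \<subseteq> mons {..<n} (t - j)"
proof
  fix m assume M: "M \<subseteq> mons {..<Suc n} t" and m: "m \<in> layer n M j"
  have mm: "m + Poly_Mapping.single n j \<in> mons {..<Suc n} t" using m M by (auto simp: layer_def)
  have "supp m \<subseteq> supp (m + Poly_Mapping.single n j)" by (auto simp: in_keys_iff lookup_add)
  moreover have "mdeg m + j = t" using mm by (simp add: mons_def mdeg_add)
  hence "mdeg m = t - j" by simp
  ultimately have "m \<in> {m \<in> mons {..<Suc n} (t - j). cf m n = 0}" using mm m by (auto simp: mons_def layer_def)
  thus "m \<in> mons {..<n} (t - j)" unfolding mons_Suc_0 .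
qed

lemma layer_empty: "M \<subseteq> mons {..<Suc n} t \<Longrightarrow> j > t \<Longrightarrow> layer n M j = {}"
proof (rule ccontr)
  assume M: "M \<subseteq> mons {..<Suc n} t" "j > t" and "layer n M j \<noteq> {}"
  then obtain m where "m + Poly_Mapping.single n j \<in> M" by (auto simp: layer_def)
  hence "mdeg (m + Poly_Mapping.single n j) = t" using M by (auto simp: mons_def)
  thus False using M(2) mdeg_add[of m "Poly_Mapping.single n j"] by simp
qed

lemma card_layers:
  assumes M: "M \<subseteq> mons {..<Suc n} t" shows "card M = (\<Sum>j\<le>t. card (layer n M j))"
proof -
  define T where "T j = (\<lambda>m. m + Poly_Mapping.single n j) ` layer n M j" for j
  have fin: "finite (layer n M j)" for j using layer_mons[OF M] finite_mons finite_subset by blast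
  have Tn: "cf u n = j" if "u \<in> T j" for u j using that by (auto simp: T_def layer_def lookup_add)
  have "M = (\<Union>j\<le>t. T j)"
  proof (intro equalityI subsetI)
    fix u assume u: "u \<in> M"
    let ?m = "u - Poly_Mapping.single n (cf u n)"
    have eq: "?m + Poly_Mapping.single n (cf u n) = u"
      by (intro poly_mapping_eqI) (simp add: lookup_add lookup_minus lookup_single when_def)
    have "?m \<in> layer n M (cf u n)" using u eq by (simp add: layer_def lookup_minus)
    hence "u \<in> T (cf u n)" unfolding T_def using eq by (metis image_eqI)
    moreover have "cf u n \<le> t" using layer_empty[OF M, of "cf u n"] \<open>?m \<in> layer n M (cf u n)\<close> by (metis empty_iff not_le)
    ultimately show "u \<in> (\<Union>j\<le>t. T j)" by blast
  qed (auto simp: T_def layer_def)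
  hence "card M = card (\<Union>j\<le>t. T j)" by simp
  also have "\<dots> = (\<Sum>j\<le>t. card (T j))"
  proof (rule card_UN_disjoint)
    show "\<forall>i\<in>{..t}. \<forall>j\<in>{..t}. i \<noteq> j \<longrightarrow> T i \<inter> T j = {}" using Tn by blast
  qed (use fin in \<open>auto simp: T_def\<close>)
  also have "\<dots> = (\<Sum>j\<le>t. card (layer n M j))"
    unfolding T_def by (intro sum.cong refl card_image) (auto simp: inj_on_def)
  finally show ?thesis .
qed

lemma layer_strongly_stable:
  assumes "strongly_stable (Suc n) M" shows "strongly_stable n (layer n M j)"
  unfolding strongly_stable_def
proof (intro ballI allI impI)
  fix m i l assume m: "m \<in> layer n M j" and il: "i < l" "l < n" "cf m l \<noteq> 0"
  have "m + Poly_Mapping.single n j \<in> M" "cf (m + Poly_Mapping.single n j) l \<noteq> 0"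
    using m il by (auto simp: layer_def lookup_add)
  hence "m + Poly_Mapping.single n j - unit l + unit i \<in> M"
    using assms il by (auto simp: strongly_stable_def)
  moreover have "m + Poly_Mapping.single n j - unit l + unit i = (m - unit l + unit i) + Poly_Mapping.single n j"
    using il by (intro poly_mapping_eqI) (auto simp: lookup_add lookup_minus lookup_single when_def)
  ultimately show "m - unit l + unit i \<in> layer n M j"
    using m il by (simp add: layer_def lookup_add lookup_minus unit_lookup)
qed

text \<open>Exchanging one factor of the last variable for an earlier variable.\<close>

lemma layer_shad:
  assumes "strongly_stable (Suc n) M" shows "shad n (layer n M (Suc j)) \<subseteq> layer n M j"
proof
  fix u assume "u \<in> shad n (layer n M (Suc j))"
  then obtain m i where m: "u = m + unit i" "m \<in> layer n M (Suc j)" "i < n" by (auto simp: shad_def)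
  have "m + Poly_Mapping.single n (Suc j) \<in> M" using m by (simp add: layer_def)
  hence "m + Poly_Mapping.single n (Suc j) - unit n + unit i \<in> M"
    using assms m(3) by (auto simp: strongly_stable_def lookup_add)
  moreover have "m + Poly_Mapping.single n (Suc j) - unit n + unit i = u + Poly_Mapping.single n j"
    using m(3) by (intro poly_mapping_eqI) (auto simp: m(1) lookup_add lookup_minus lookup_single when_def)
  ultimately show "u \<in> layer n M j" using m by (simp add: layer_def lookup_add unit_lookup)
qed

text \<open>The induction removes the last variable. The only point is that the layer of \<open>L\<close> without the last
variable is not larger than that of \<open>M\<close>. Replace the layers of \<open>M\<close> by lex segments \<open>S j\<close> of the
same sizes. By induction, and since shadows of lex segments are lex segments, the shadow of
\<open>S (j + 1)\<close> is contained in \<open>S j\<close>. So in the new set \<open>M'\<close> the last variable can be exchanged for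
the last but one. If the claim failed, the smallest element \<open>v\<close> of the layer of \<open>L\<close> would be smaller
than all elements of \<open>S 0\<close>, hence, as this exchange is monotone, smaller than all elements of
\<open>M'\<close>. Then \<open>M'\<close> would be contained in \<open>L - {v}\<close>, against the assumption on cardinalities.\<close>

lemma strongly_stable_comparison:
  "up_closed (mons {..<n} t) L \<Longrightarrow> M \<subseteq> mons {..<n} t \<Longrightarrow> strongly_stable n M \<Longrightarrow> card L \<le> card M \<Longrightarrow>
     i < n \<Longrightarrow> card (upto_var L i) \<le> card (upto_var M i)"
proof (induction n arbitrary: t L M i)
  case (Suc n)
  note L = Suc.prems(1) and M = Suc.prems(2) and st = Suc.prems(3) and card = Suc.prems(4)
  have LM: "L \<subseteq> mons {..<Suc n} t" using L by (simp add: up_closed_def)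
  show ?case
  proof (cases "i = n")
    case True
    have "upto_var K i = K" if "K \<subseteq> mons {..<Suc n} t" for K
      using that by (fastforce simp: upto_var_def True mons_def lessThan_Suc_atMost)
    thus ?thesis using card M LM by simp
  next
    case False
    hence i: "i < n" using Suc.prems(5) by simp
    have upto: "upto_var K i = upto_var (layer n K 0) i" for K
    proof -
      have "cf m n = 0" if "supp m \<subseteq> {..i}" for m
        using that i by (auto simp: in_keys_iff subset_iff)
      thus ?thesis by (auto simp: upto_var_def layer_def)
    qed
    have L0: "up_closed (mons {..<n} t) (layer n L 0)"
    proof -
      have mem: "x \<in> layer n L 0 \<longleftrightarrow> cf x n = 0 \<and> x \<in> L" for x by (simp add: layer_def)
      have "y \<in> layer n L 0" if "x \<in> layer n L 0" "y \<in> mons {..<n} t" "x \<le> y" for x y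
      proof -
        have "y \<in> {m \<in> mons {..<Suc n} t. cf m n = 0}" unfolding mons_Suc_0 by (rule that)
        thus ?thesis using that(1,3) L by (auto simp: mem up_closed_def)
      qed
      thus ?thesis using layer_mons[OF LM, of 0] by (auto simp: up_closed_def)
    qed
    have M0: "layer n M 0 \<subseteq> mons {..<n} t" using layer_mons[OF M, of 0] by simp
    have "card (layer n L 0) \<le> card (layer n M 0)"
    proof (rule ccontr)
      assume "\<not> ?thesis"
      hence lt: "card (layer n M 0) < card (layer n L 0)" by simp
      define S where "S j = seg n (t - j) (card (layer n M j))" for j
      have le: "card (layer n M j) \<le> card (mons {..<n} (t - j))" for j
        by (rule card_mono[OF finite_mons layer_mons[OF M]]) simp
      have S: "up_closed (mons {..<n} (t - j)) (S j)" "card (S j) = card (layer n M j)" for j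
        unfolding S_def using seg[OF le] by auto
      have SM: "S j \<subseteq> mons {..<n} (t - j)" for j using S(1) by (simp add: up_closed_def)
      have Sshad: "shad n (S (Suc j)) \<subseteq> S j" if "Suc j \<le> t" for j
      proof (rule up_closed_card_subset)
        have tj: "t - j = Suc (t - Suc j)" using that by simp
        show "finite (mons {..<n} (t - j))" by (simp add: finite_mons)
        show "up_closed (mons {..<n} (t - j)) (shad n (S (Suc j)))"
          unfolding tj by (rule shad_up_closed[OF S(1)])
        show "up_closed (mons {..<n} (t - j)) (S j)" by (rule S)
        have "card (shad n (S (Suc j))) = (\<Sum>i<n. card (upto_var (S (Suc j)) i))"
          by (rule shad_strongly_stable(2)[OF SM up_closed_strongly_stable[OF S(1)]])
        also have "\<dots> \<le> (\<Sum>i<n. card (upto_var (layer n M (Suc j)) i))"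
          using S(2) by (intro sum_mono Suc.IH[OF S(1) layer_mons[OF M] layer_strongly_stable[OF st]]) auto
        also have "\<dots> = card (shad n (layer n M (Suc j)))"
          by (rule shad_strongly_stable(2)[OF layer_mons[OF M] layer_strongly_stable[OF st], symmetric])
        also have "\<dots> \<le> card (layer n M j)"
          using layer_mons[OF M, of j] finite_mons finite_subset
          by (intro card_mono layer_shad[OF st]) (auto intro: finite_subset[OF _ finite_mons])
        finally show "card (shad n (S (Suc j))) \<le> card (S j)" by (simp add: S(2))
      qed
      obtain n' where n': "n = Suc n'" using i by (cases n) auto
      have push: "m + Poly_Mapping.single n' j \<in> S 0" if "j \<le> t" "m \<in> S j" for j m
        using that
      proof (induction j arbitrary: m)
        case (Suc j)
        have "m + unit n' \<in> shad n (S (Suc j))" using Suc.prems n' by (auto simp: shad_def)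
        hence "m + unit n' \<in> S j" using Sshad Suc.prems by auto
        hence "m + unit n' + Poly_Mapping.single n' j \<in> S 0" using Suc by auto
        moreover have "m + unit n' + Poly_Mapping.single n' j = m + Poly_Mapping.single n' (Suc j)"
          by (intro poly_mapping_eqI) (auto simp: lookup_add lookup_single when_def)
        ultimately show ?case by simp
      qed simp
      have finL0: "finite (layer n L 0)"
        using L0 finite_subset[of "layer n L 0" "mons {..<n} t"] by (simp add: up_closed_def finite_mons)
      have S0t: "up_closed (mons {..<n} t) (S 0)" using S(1)[of 0] by simp
      have S0L0: "S 0 \<subseteq> layer n L 0"
      proof (rule up_closed_card_subset[OF _ S0t L0])
        show "card (S 0) \<le> card (layer n L 0)" using lt S(2)[of 0] by simp
      qed (simp add: finite_mons)
      define v where "v = Min (layer n L 0)"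
      have ne: "layer n L 0 \<noteq> {}" using lt by auto
      have v: "v \<in> layer n L 0" unfolding v_def using finL0 ne by (rule Min_in)
      have vL: "v \<in> L" "cf v n = 0" using v by (auto simp: layer_def)
      have vm: "v \<in> mons {..<Suc n} t" using vL LM by auto
      have vS: "v \<notin> S 0"
      proof
        assume "v \<in> S 0"
        moreover have "v \<le> y" if "y \<in> layer n L 0" for y unfolding v_def using finL0 that by simp
        ultimately have "y \<in> S 0" if "y \<in> layer n L 0" for y
          using that S0t L0 by (auto simp: up_closed_def)
        hence "layer n L 0 \<subseteq> S 0" by blast
        thus False using S0L0 lt S(2)[of 0] by auto
      qed
      define M' where "M' = (\<Union>j\<le>t. (\<lambda>m. m + Poly_Mapping.single n j) ` S j)"
      have Sn: "cf m n = 0" if "m \<in> S j" for m j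
      proof -
        have "n \<notin> supp m" using SM that by (auto simp: mons_def)
        thus ?thesis by (simp add: in_keys_iff)
      qed
      have M'm: "M' \<subseteq> mons {..<Suc n} t"
      proof
        fix u assume "u \<in> M'"
        then obtain j m where jm: "j \<le> t" "m \<in> S j" "u = m + Poly_Mapping.single n j" by (auto simp: M'_def)
        have "m \<in> mons {..<Suc n} (t - j)" using SM jm(2) by (fastforce simp: mons_def)
        moreover have "Poly_Mapping.single n j \<in> mons {..<Suc n} j" by (simp add: mons_def)
        ultimately show "u \<in> mons {..<Suc n} t" using mons_add jm by fastforce
      qed
      have "layer n M' j = S j" if "j \<le> t" for j
      proof (intro equalityI subsetI)
        fix m assume "m \<in> layer n M' j"
        then obtain j' m' where jm: "m' \<in> S j'" "m + Poly_Mapping.single n j = m' + Poly_Mapping.single n j'" "cf m n = 0"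
          by (auto simp: layer_def M'_def)
        have "cf (m + Poly_Mapping.single n j) n = cf (m' + Poly_Mapping.single n j') n" using jm(2) by simp
        hence "j = j'" using jm(3) Sn[OF jm(1)] by (simp add: lookup_add)
        thus "m \<in> S j" using jm by simp
      qed (use that Sn in \<open>auto simp: layer_def M'_def\<close>)
      hence "card M' = card M" unfolding card_layers[OF M'm] card_layers[OF M] by (simp add: S(2))
      moreover have "M' \<subseteq> L - {v}"
      proof
        fix u assume u: "u \<in> M'"
        then obtain j m where jm: "j \<le> t" "m \<in> S j" "u = m + Poly_Mapping.single n j" by (auto simp: M'_def)
        let ?a = "m + Poly_Mapping.single n' j"
        have a: "?a \<in> S 0" by (rule push[OF jm(1,2)])
        have am: "?a \<in> mons {..<n} t" using a SM[of 0] by auto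
        have "v < ?a"
        proof (rule ccontr)
          assume "\<not> v < ?a"
          moreover have "v \<in> mons {..<n} t" using v L0 by (auto simp: up_closed_def)
          ultimately have "v \<in> S 0" using S0t a by (auto simp: up_closed_def)
          thus False using vS by simp
        qed
        have "v < u"
        proof (rule ccontr)
          assume "\<not> v < u"
          moreover have "u \<noteq> v"
          proof
            assume "u = v"
            hence "cf (m + Poly_Mapping.single n j) n = 0" using jm(3) vL(2) by simp
            hence "j = 0" by (simp add: lookup_add)
            hence "u = ?a" using jm(3) by simp
            thus False using \<open>u = v\<close> \<open>v < ?a\<close> by simp
          qed
          ultimately have "u < v" by simp
          then obtain k where k: "cf u k < cf v k" "\<And>l. l < k \<Longrightarrow> cf u l = cf v l"
            unfolding lex_order_exponents by blast
          have um: "u \<in> mons {..<Suc n} t" using M'm u by blast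
          have "k \<in> supp v" using k(1) by (simp add: in_keys_iff)
          hence "k < Suc n" using vm by (auto simp: mons_def)
          moreover have "k \<noteq> n" using k(1) vL(2) by auto
          ultimately have kn: "k < n" by simp
          have cu: "cf u l = cf m l" if "l < n" for l using that by (simp add: jm(3) lookup_add lookup_single)
          show False
          proof (cases "k = n'")
            case False
            hence "k < n'" using kn n' by simp
            hence "?a < v" using k cu n' by (intro lex_lessI[of _ k]) (auto simp: lookup_add lookup_single when_def)
            thus False using \<open>v < ?a\<close> by simp
          next
            case True
            have "cf ?a l = cf v l" if "l < n'" for l
              using k(2)[of l] True cu[of l] that n' by (simp add: lookup_add lookup_single)
            moreover have "v \<in> mons {..<n} t" using v L0 by (auto simp: up_closed_def)
            ultimately have "(\<Sum>l\<in>{n'..<n}. cf ?a l) = (\<Sum>l\<in>{n'..<n}. cf v l)"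
              using n' by (intro degree_tail[OF am]) auto
            hence "cf ?a n' = cf v n'" by (simp add: n')
            moreover have "cf ?a l = cf v l" if "l \<ge> n" for l
            proof -
              have "l \<notin> supp ?a" "l \<notin> supp v" using am \<open>v \<in> mons {..<n} t\<close> that by (auto simp: mons_def)
              thus ?thesis by (simp add: in_keys_iff)
            qed
            ultimately have "cf ?a l = cf v l" for l
              using \<open>\<And>l. l < n' \<Longrightarrow> cf ?a l = cf v l\<close> n' by (metis less_antisym not_le)
            hence "?a = v" by (rule poly_mapping_eqI)
            thus False using \<open>v < ?a\<close> by simp
          qed
        qed
        thus "u \<in> L - {v}" using L vL(1) M'm u by (auto simp: up_closed_def)
      qed
      moreover have "finite L" by (rule finite_subset[OF LM]) (simp add: finite_mons)
      ultimately have "card M \<le> card (L - {v})" using card_mono[of "L - {v}" M'] by simp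
      also have "\<dots> < card L" using \<open>finite L\<close> vL(1) by (rule card_Diff1_less)
      finally show False using card by simp
    qed
    hence "card (upto_var (layer n L 0) i) \<le> card (upto_var (layer n M 0) i)"
      by (rule Suc.IH[OF L0 M0 layer_strongly_stable[OF st] _ i])
    thus ?thesis by (simp only: upto[of L] upto[of M])
  qed
qed simp

section \<open>Compression\<close>

lemma sum_ge_initial:
  fixes A :: "nat set"
  shows "finite A \<Longrightarrow> card A = s \<Longrightarrow> \<Sum>{..<s} \<le> \<Sum>A"
proof (induction s arbitrary: A)
  case (Suc s)
  have ne: "A \<noteq> {}" using Suc.prems by auto
  have M: "Max A \<in> A" using Suc.prems(1) ne by (rule Max_in)
  have "A \<subseteq> {..Max A}" using Suc.prems(1) by auto
  hence "card A \<le> Suc (Max A)" using card_mono[of "{..Max A}" A] by simp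
  hence "s \<le> Max A" using Suc.prems(2) by simp
  moreover have "\<Sum>{..<s} \<le> \<Sum>(A - {Max A})" using Suc.prems M by (intro Suc.IH) auto
  moreover have "\<Sum>A = Max A + \<Sum>(A - {Max A})" using Suc.prems(1) M by (rule sum.remove)
  ultimately show ?case by simp
qed simp

lemma sum_gt_initial:
  fixes A :: "nat set"
  assumes "finite A" "card A = s" "A \<noteq> {..<s}" shows "\<Sum>{..<s} < \<Sum>A"
proof (cases s)
  case 0
  thus ?thesis using assms by simp
next
  case (Suc r)
  have ne: "A \<noteq> {}" using assms Suc by auto
  have M: "Max A \<in> A" using assms(1) ne by (rule Max_in)
  have "\<not> A \<subseteq> {..<s}" using assms card_subset_eq[of "{..<s}" A] by auto
  then obtain x where x: "x \<in> A" "x \<notin> {..<s}" by blast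
  hence "s \<le> Max A" using Max_ge[OF assms(1) x(1)] by simp
  moreover have "\<Sum>{..<r} \<le> \<Sum>(A - {Max A})" using assms M Suc by (intro sum_ge_initial) auto
  moreover have "\<Sum>A = Max A + \<Sum>(A - {Max A})" using assms(1) M by (rule sum.remove)
  ultimately show ?thesis using Suc by simp
qed

text \<open>Compression in the direction of two variables \<open>i < j\<close>: monomials of degree \<open>t\<close> are grouped by
their part outside the two variables, and in every group the given elements are moved to those with the
smallest exponents of the variable \<open>j\<close>.\<close>

locale compression =
  fixes n t i j :: nat
  assumes ij: "i < j" "j < n"
begin

definition key :: "(nat \<Rightarrow>\<^sub>0 nat) \<Rightarrow> (nat \<Rightarrow>\<^sub>0 nat)" where
  "key m = m - Poly_Mapping.single i (cf m i) - Poly_Mapping.single j (cf m j)"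

lemma key_lookup: "cf (key m) k = (if k = i \<or> k = j then 0 else cf m k)"
  using ij by (simp add: key_def lookup_minus lookup_single when_def)

lemma key_decomposition: "m = key m + Poly_Mapping.single i (cf m i) + Poly_Mapping.single j (cf m j)"
  using ij by (intro poly_mapping_eqI) (auto simp: key_lookup lookup_add lookup_single when_def)

lemma mdeg_key: "mdeg m = mdeg (key m) + cf m i + cf m j"
  by (subst key_decomposition) (simp add: mdeg_add)

lemma key_eqI: "(\<And>k. k \<noteq> i \<Longrightarrow> k \<noteq> j \<Longrightarrow> cf a k = cf b k) \<Longrightarrow> key a = key b"
  by (intro poly_mapping_eqI) (simp add: key_lookup)

lemma key_inj:
  assumes "mdeg a = mdeg b" "key a = key b" "cf a j = cf b j" shows "a = b"
proof -
  have "cf a i = cf b i" using mdeg_key[of a] mdeg_key[of b] assms by simp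
  thus ?thesis using key_decomposition[of a] key_decomposition[of b] assms by simp
qed

definition fib :: "(nat \<Rightarrow>\<^sub>0 nat) set \<Rightarrow> (nat \<Rightarrow>\<^sub>0 nat) \<Rightarrow> (nat \<Rightarrow>\<^sub>0 nat) set" where
  "fib M w = {m \<in> M. key m = w}"

definition compress :: "(nat \<Rightarrow>\<^sub>0 nat) set \<Rightarrow> (nat \<Rightarrow>\<^sub>0 nat) set" where
  "compress M = {m \<in> mons {..<n} t. cf m j < card (fib M (key m))}"

lemma fib_inj: "M \<subseteq> mons {..<n} d \<Longrightarrow> inj_on (\<lambda>m. cf m j) (fib M w)"
  by (rule inj_onI, rule key_inj) (auto simp: fib_def mons_def)

lemma fib_finite: "M \<subseteq> mons {..<n} d \<Longrightarrow> finite (fib M w)"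
  by (rule finite_subset[of _ "mons {..<n} d"]) (auto simp: fib_def finite_mons)

lemma card_fib_image: "M \<subseteq> mons {..<n} d \<Longrightarrow> card ((\<lambda>m. cf m j) ` fib M w) = card (fib M w)"
  by (rule card_image[OF fib_inj])

lemma sum_fibers:
  assumes M: "M \<subseteq> mons {..<n} d"
  shows "sum f M = (\<Sum>w\<in>key ` mons {..<n} d. sum f (fib M w))"
  unfolding fib_def
  by (rule sum.group[symmetric]) (use M finite_subset[OF M] finite_mons in auto)

lemma card_fibers: "M \<subseteq> mons {..<n} d \<Longrightarrow> card M = (\<Sum>w\<in>key ` mons {..<n} d. card (fib M w))"
  using sum_fibers[of M d "\<lambda>_. 1 :: nat"] by simp

lemma compress_mons: "compress M \<subseteq> mons {..<n} t" by (auto simp: compress_def)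

text \<open>Since the degree is fixed, the elements of a group correspond to the values of the exponent of \<open>j\<close>,
which form an initial segment of the natural numbers.\<close>

lemma compress_fib_image:
  assumes M: "M \<subseteq> mons {..<n} t"
  shows "(\<lambda>m. cf m j) ` fib (compress M) w = {..<card (fib M w)}"
proof (intro equalityI subsetI)
  fix c assume "c \<in> {..<card (fib M w)}"
  hence c: "c < card (fib M w)" by simp
  hence "fib M w \<noteq> {}" by auto
  then obtain m0 where m0: "m0 \<in> M" "key m0 = w" by (auto simp: fib_def)
  define N where "N = cf m0 i + cf m0 j"
  have deg: "mdeg w + N = t" using m0 M mdeg_key[of m0] by (auto simp: N_def mons_def)
  have "(\<lambda>m. cf m j) ` fib M w \<subseteq> {..N}"
  proof
    fix x assume "x \<in> (\<lambda>m. cf m j) ` fib M w"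
    then obtain m where m: "m \<in> M" "key m = w" "x = cf m j" by (auto simp: fib_def)
    have "mdeg w + cf m i + cf m j = t" using m M mdeg_key[of m] by (auto simp: mons_def)
    thus "x \<in> {..N}" using deg m(3) by simp
  qed
  hence "card ((\<lambda>m. cf m j) ` fib M w) \<le> card {..N}" by (rule card_mono[rotated]) simp
  hence "card (fib M w) \<le> Suc N" unfolding card_fib_image[OF M] by simp
  hence cN: "c \<le> N" using c by simp
  define m where "m = w + Poly_Mapping.single i (N - c) + Poly_Mapping.single j c"
  have wij: "cf w i = 0" "cf w j = 0" using m0(2) key_lookup[of m0] by auto
  have mj: "cf m j = c" using ij wij by (simp add: m_def lookup_add lookup_single)
  have key: "key m = w"
  proof (rule poly_mapping_eqI)
    fix k show "cf (key m) k = cf w k"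
      using wij by (simp add: key_lookup m_def lookup_add lookup_single when_def)
  qed
  have "supp w \<subseteq> supp m0" using m0(2) by (auto simp: in_keys_iff key_lookup split: if_splits)
  hence "supp w \<subseteq> {..<n}" using m0 M by (auto simp: mons_def)
  hence "w \<in> mons {..<n} (mdeg w)" by (simp add: mons_def)
  moreover have "Poly_Mapping.single i (N - c) \<in> mons {..<n} (N - c)" "Poly_Mapping.single j c \<in> mons {..<n} c"
    using ij by (auto simp: mons_def)
  ultimately have "m \<in> mons {..<n} (mdeg w + (N - c) + c)" unfolding m_def by (intro mons_add)
  hence "m \<in> mons {..<n} t" using deg cN by (simp add: add.assoc)
  hence "m \<in> fib (compress M) w" using c key mj by (simp add: fib_def compress_def)
  thus "c \<in> (\<lambda>m. cf m j) ` fib (compress M) w" using mj by (intro image_eqI[of _ _ m]) auto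
qed (auto simp: fib_def compress_def)

lemma card_fib_compress: "M \<subseteq> mons {..<n} t \<Longrightarrow> card (fib (compress M) w) = card (fib M w)"
  using card_fib_image[OF compress_mons, of M w] compress_fib_image[of M w] by simp

lemma card_compress: "M \<subseteq> mons {..<n} t \<Longrightarrow> card (compress M) = card M"
  using card_fibers[OF compress_mons, of M] card_fibers[of M t] by (simp add: card_fib_compress)

text \<open>Consider the elements of the shadow in one group. For the compressed set they have exponents of
\<open>j\<close> in an initial segment, because all contributions are initial segments; so it suffices to bound the
size of the longest. A contribution from the same group has one element more than the set, as the
shadow of \<open>s > 0\<close> monomials in two variables has at least \<open>s + 1\<close> elements, and a contribution from
another group is a translate. Both are dominated by the shadow of the original set.\<close>

lemma compress_shad:
  assumes M: "M \<subseteq> mons {..<n} t" shows "card (shad n (compress M)) \<le> card (shad n M)"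
proof -
  have sM: "shad n M \<subseteq> mons {..<n} (Suc t)" "shad n (compress M) \<subseteq> mons {..<n} (Suc t)"
    by (rule shad_mons[OF M], rule shad_mons[OF compress_mons])
  have "card (fib (shad n (compress M)) w) \<le> card (fib (shad n M) w)" for w
  proof -
    define b where "b = card (fib (shad n M) w)"
    have finb: "finite (fib (shad n M) w)" by (rule fib_finite[OF sM(1)])
    have "(\<lambda>m. cf m j) ` fib (shad n (compress M)) w \<subseteq> {..<b}"
    proof
      fix x assume "x \<in> (\<lambda>m. cf m j) ` fib (shad n (compress M)) w"
      then obtain u where u: "u \<in> shad n (compress M)" "key u = w" "x = cf u j" by (auto simp: fib_def)
      then obtain m l where ml: "u = m + unit l" "m \<in> compress M" "l < n" by (auto simp: shad_def)
      define s where "s = card (fib M (key m))"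
      have mj: "cf m j < s" using ml(2) by (simp add: compress_def s_def)
      have finF: "finite (fib M (key m))" by (rule fib_finite[OF M])
      show "x \<in> {..<b}"
      proof (cases "l = i \<or> l = j")
        case True
        have km: "key m = w" unfolding u(2)[symmetric] ml(1)
          using True by (intro key_eqI) (auto simp: lookup_add unit_lookup)
        define F where "F = fib M w"
        have F: "F \<noteq> {}" "finite F" "card F = s" using mj finF km by (auto simp: F_def s_def)
        obtain m1 where m1: "m1 \<in> F" "\<And>m. m \<in> F \<Longrightarrow> cf m j \<le> cf m1 j"
        proof -
          have "Max ((\<lambda>m. cf m j) ` F) \<in> (\<lambda>m. cf m j) ` F" using F(1,2) by (intro Max_in) auto
          then obtain m1 where m1: "m1 \<in> F" "Max ((\<lambda>m. cf m j) ` F) = cf m1 j" by blast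
          have "cf m j \<le> cf m1 j" if "m \<in> F" for m
            unfolding m1(2)[symmetric] using F(2) that by (intro Max_ge) auto
          thus thesis using that[OF m1(1)] by blast
        qed
        have "insert (m1 + unit j) ((\<lambda>m. m + unit i) ` F) \<subseteq> fib (shad n M) w"
        proof -
          have "key (m + unit k) = w" if "m \<in> F" "k = i \<or> k = j" for m k
          proof -
            have "key (m + unit k) = key m" using that(2) by (intro key_eqI) (auto simp: lookup_add unit_lookup)
            thus ?thesis using that(1) by (simp add: F_def fib_def)
          qed
          moreover have "m + unit k \<in> shad n M" if "m \<in> F" "k = i \<or> k = j" for m k
          proof -
            have "m \<in> M" "k < n" using that ij by (auto simp: F_def fib_def)
            thus ?thesis unfolding shad_def by blast
          qed
          ultimately show ?thesis using m1(1) by (auto simp: fib_def)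
        qed
        hence "card (insert (m1 + unit j) ((\<lambda>m. m + unit i) ` F)) \<le> b"
          unfolding b_def by (rule card_mono[OF finb])
        moreover have "m1 + unit j \<notin> (\<lambda>m. m + unit i) ` F"
        proof
          assume "m1 + unit j \<in> (\<lambda>m. m + unit i) ` F"
          then obtain m where m: "m \<in> F" "m1 + unit j = m + unit i" by blast
          have "cf (m1 + unit j) j = cf (m + unit i) j" using m(2) by simp
          thus False using m1(2)[OF m(1)] ij by (simp add: lookup_add unit_lookup)
        qed
        moreover have "card ((\<lambda>m. m + unit i) ` F) = s"
          unfolding F(3)[symmetric] by (rule card_image) (auto simp: inj_on_def)
        ultimately have "Suc s \<le> b" using F(2) by simp
        thus ?thesis using mj u(3) ml(1) by (auto simp: lookup_add unit_lookup split: if_splits)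
      next
        case False
        have "(\<lambda>m. m + unit l) ` fib M (key m) \<subseteq> fib (shad n M) w"
        proof
          fix v assume "v \<in> (\<lambda>m. m + unit l) ` fib M (key m)"
          then obtain m' where m': "v = m' + unit l" "m' \<in> M" "key m' = key m" by (auto simp: fib_def)
          have "key v = w"
          proof (unfold u(2)[symmetric], rule key_eqI)
            fix k assume "k \<noteq> i" "k \<noteq> j"
            hence "cf m' k = cf m k" using m'(3) key_lookup[of m' k] key_lookup[of m k] by simp
            thus "cf v k = cf u k" by (simp add: m'(1) ml(1) lookup_add)
          qed
          thus "v \<in> fib (shad n M) w" using m' ml(3) by (auto simp: fib_def shad_def)
        qed
        hence "card ((\<lambda>m. m + unit l) ` fib M (key m)) \<le> b" unfolding b_def by (rule card_mono[OF finb])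
        moreover have "card ((\<lambda>m. m + unit l) ` fib M (key m)) = s"
          unfolding s_def by (rule card_image) (auto simp: inj_on_def)
        ultimately show ?thesis using mj u(3) ml(1) False by (simp add: lookup_add unit_lookup)
      qed
    qed
    hence "card ((\<lambda>m. cf m j) ` fib (shad n (compress M)) w) \<le> card {..<b}" by (rule card_mono[rotated]) simp
    thus ?thesis unfolding card_fib_image[OF sM(2)] by (simp add: b_def)
  qed
  thus ?thesis unfolding card_fibers[OF sM(1)] card_fibers[OF sM(2)] by (rule sum_mono)
qed

definition weight :: "(nat \<Rightarrow>\<^sub>0 nat) \<Rightarrow> nat" where "weight m = (\<Sum>k<n. k * cf m k)"

lemma weight_add: "weight (a + b) = weight a + weight b"
  by (simp add: weight_def lookup_add distrib_left sum.distrib)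

lemma weight_single: "k < n \<Longrightarrow> weight (Poly_Mapping.single k c) = k * c"
  by (simp add: weight_def lookup_single when_def if_distrib[of "\<lambda>x. _ * x"] sum.delta cong: if_cong)

text \<open>Within a group the weight grows with the exponent of \<open>j\<close>, the later one of the two variables. So
compression decreases the weight.\<close>

lemma weight_key:
  assumes m: "m \<in> mons {..<n} t"
  shows "weight m = (weight (key m) + i * (t - mdeg (key m))) + (j - i) * cf m j"
proof -
  have "weight m = weight (key m) + i * cf m i + j * cf m j"
    using ij by (subst key_decomposition) (simp add: weight_add weight_single)
  moreover have "mdeg (key m) + cf m i + cf m j = t" using mdeg_key[of m, symmetric] m by (simp add: mons_def)
  hence "t - mdeg (key m) = cf m i + cf m j" by simp
  moreover have "j * cf m j = i * cf m j + (j - i) * cf m j" using ij by (simp add: diff_mult_distrib)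
  ultimately show ?thesis by (simp add: distrib_left)
qed

lemma sum_weight_fib:
  assumes "M \<subseteq> mons {..<n} t"
  shows "sum weight (fib M w) = card (fib M w) * (weight w + i * (t - mdeg w)) + (j - i) * \<Sum>((\<lambda>m. cf m j) ` fib M w)"
proof -
  have "sum weight (fib M w) = (\<Sum>m\<in>fib M w. (weight w + i * (t - mdeg w)) + (j - i) * cf m j)"
    using weight_key assms by (intro sum.cong) (auto simp: fib_def)
  also have "\<dots> = card (fib M w) * (weight w + i * (t - mdeg w)) + (j - i) * (\<Sum>m\<in>fib M w. cf m j)"
    by (simp add: sum.distrib sum_distrib_left)
  also have "(\<Sum>m\<in>fib M w. cf m j) = \<Sum>((\<lambda>m. cf m j) ` fib M w)"
    by (simp add: sum.reindex[OF fib_inj[OF assms]])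
  finally show ?thesis .
qed

lemma compress_weight:
  assumes M: "M \<subseteq> mons {..<n} t" and ne: "compress M \<noteq> M"
  shows "sum weight (compress M) < sum weight M"
proof -
  have im: "finite ((\<lambda>m. cf m j) ` fib M w)" "card ((\<lambda>m. cf m j) ` fib M w) = card (fib M w)" for w
    using fib_finite[OF M] card_fib_image[OF M] by auto
  have le: "sum weight (fib (compress M) w) \<le> sum weight (fib M w)" for w
    unfolding sum_weight_fib[OF M] sum_weight_fib[OF compress_mons] compress_fib_image[OF M] card_fib_compress[OF M]
    using sum_ge_initial[OF im] by simp
  have "\<exists>w\<in>key ` mons {..<n} t. (\<lambda>m. cf m j) ` fib M w \<noteq> {..<card (fib M w)}"
  proof (rule ccontr)
    assume "\<not> ?thesis"
    hence eq: "(\<lambda>m. cf m j) ` fib M w = {..<card (fib M w)}" if "w \<in> key ` mons {..<n} t" for w using that by blast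
    have "M \<subseteq> compress M"
    proof
      fix m assume m: "m \<in> M"
      hence "cf m j \<in> (\<lambda>m. cf m j) ` fib M (key m)" by (auto simp: fib_def)
      moreover have "key m \<in> key ` mons {..<n} t" using m M by blast
      ultimately have "cf m j < card (fib M (key m))" using eq by blast
      thus "m \<in> compress M" using m M by (auto simp: compress_def)
    qed
    moreover have "finite (compress M)" by (rule finite_subset[OF compress_mons]) (simp add: finite_mons)
    ultimately have "M = compress M" using card_compress[OF M] by (intro card_subset_eq) auto
    thus False using ne by simp
  qed
  then obtain w where w: "w \<in> key ` mons {..<n} t" "(\<lambda>m. cf m j) ` fib M w \<noteq> {..<card (fib M w)}" by blast
  have lt: "sum weight (fib (compress M) w) < sum weight (fib M w)"
    unfolding sum_weight_fib[OF M] sum_weight_fib[OF compress_mons] compress_fib_image[OF M] card_fib_compress[OF M]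
    using sum_gt_initial[OF im w(2)] ij by simp
  show ?thesis unfolding sum_fibers[OF M] sum_fibers[OF compress_mons]
    by (rule sum_strict_mono_ex1) (use le lt w(1) finite_mons in auto)
qed

end

text \<open>Among the sets of the same size as \<open>M\<close> whose shadow is not larger, one of smallest weight is fixed
by all compressions and therefore strongly stable.\<close>

lemma macaulay:
  assumes L: "up_closed (mons {..<n} t) L" and M: "M \<subseteq> mons {..<n} t" and card: "card L \<le> card M"
  shows "card (shad n L) \<le> card (shad n M)"
proof -
  define P where "P X \<longleftrightarrow> X \<subseteq> mons {..<n} t \<and> card X = card M \<and> card (shad n X) \<le> card (shad n M)" for X
  define \<phi> where "\<phi> X = (\<Sum>m\<in>X. \<Sum>k<n. k * cf m k)" for X :: "(nat \<Rightarrow>\<^sub>0 nat) set"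
  have "P M" using M by (simp add: P_def)
  then obtain X where X: "P X" "\<And>Y. P Y \<Longrightarrow> \<phi> X \<le> \<phi> Y"
    using ex_has_least_nat[of P M \<phi>] by blast
  have XM: "X \<subseteq> mons {..<n} t" using X(1) by (simp add: P_def)
  have st: "strongly_stable n X" unfolding strongly_stable_def
  proof (intro ballI allI impI)
    fix m i j assume m: "m \<in> X" and ijm: "i < j" "j < n" "cf m j \<noteq> 0"
    interpret compression n t i j by standard (use ijm in auto)
    have "P (compress X)" using X(1) card_compress[OF XM] compress_shad[OF XM] compress_mons by (auto simp: P_def)
    hence "\<phi> X \<le> \<phi> (compress X)" by (rule X(2))
    hence eq: "compress X = X" using compress_weight[OF XM] by (force simp: \<phi>_def weight_def)
    have mm: "m \<in> mons {..<n} t" using m XM by blast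
    have "t \<noteq> 0"
    proof
      assume "t = 0"
      hence "m = 0" using mm by (simp add: mons_0)
      thus False using ijm by simp
    qed
    then obtain s where s: "t = Suc s" by (cases t) auto
    have "m - unit j \<in> mons {..<n} s" using mm ijm unfolding s by (intro minus_unit_mons)
    hence "m - unit j + unit i \<in> mons {..<n} (s + 1)" using ij by (intro mons_add unit_mons) auto
    hence "m - unit j + unit i \<in> mons {..<n} t" by (simp add: s)
    moreover have "key (m - unit j + unit i) = key m"
      by (rule key_eqI) (simp add: lookup_add lookup_minus unit_lookup)
    moreover have "cf m j < card (fib X (key m))" using m eq by (auto simp: compress_def)
    moreover have "cf (m - unit j + unit i) j \<le> cf m j" using ij by (simp add: lookup_add lookup_minus unit_lookup)
    ultimately have "m - unit j + unit i \<in> compress X" by (simp add: compress_def)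
    thus "m - unit j + unit i \<in> X" unfolding eq .
  qed
  have LM: "L \<subseteq> mons {..<n} t" using L by (simp add: up_closed_def)
  have "card (shad n L) = (\<Sum>i<n. card (upto_var L i))"
    by (rule shad_strongly_stable(2)[OF LM up_closed_strongly_stable[OF L]])
  also have "\<dots> \<le> (\<Sum>i<n. card (upto_var X i))"
    using X(1) card by (intro sum_mono strongly_stable_comparison[OF L XM st]) (auto simp: P_def)
  also have "\<dots> = card (shad n X)" by (rule shad_strongly_stable(2)[OF XM st, symmetric])
  also have "\<dots> \<le> card (shad n M)" using X(1) by (simp add: P_def)
  finally show ?thesis .
qed

section \<open>Leading monomials\<close>

text \<open>Leading monomials with respect to the lexicographic order.\<close>

definition leading :: "('k::field) mpoly set \<Rightarrow> (nat \<Rightarrow>\<^sub>0 nat) set" where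
  "leading W = {Max (supp f) | f. f \<in> W \<and> f \<noteq> 0}"

lemma supp_empty: "supp f = {} \<longleftrightarrow> f = 0"
  by (auto simp: poly_mapping_eq_iff fun_eq_iff in_keys_iff)

lemma leading_subset: "(\<And>f. f \<in> W \<Longrightarrow> supp f \<subseteq> A) \<Longrightarrow> leading W \<subseteq> A"
proof
  fix m assume W: "\<And>f. f \<in> W \<Longrightarrow> supp f \<subseteq> A" and "m \<in> leading W"
  then obtain f where f: "m = Max (supp f)" "f \<in> W" "f \<noteq> 0" by (auto simp: leading_def)
  have "m \<in> supp f" unfolding f(1) using f(3) supp_empty[of f] by (intro Max_in) auto
  thus "m \<in> A" using W[OF f(2)] by blast
qed

text \<open>Adjoining to the allowed monomials a largest one raises the dimension by one precisely if it is a
leading monomial.\<close>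

lemma dim_leading:
  fixes W :: "('k::field) mpoly set"
  assumes "finite A"
  shows "mpoly_space.subspace W \<Longrightarrow> (\<And>f. f \<in> W \<Longrightarrow> supp f \<subseteq> A) \<Longrightarrow> mpoly_space.dim W = card (leading W)"
  using assms
proof (induction A arbitrary: W rule: finite_linorder_max_induct)
  case empty
  hence "W = {0}" using mpoly_space.subspace_0[OF empty(1)] supp_empty by blast
  moreover have "leading ({0} :: 'k mpoly set) = {}" by (simp add: leading_def)
  ultimately show ?case by (simp add: dim_zero)
next
  case (insert b A)
  have b: "b \<notin> A" using insert.hyps by blast
  have maxb: "Max (supp f) = b" if "f \<in> W" "cf f b \<noteq> 0" for f
  proof (rule Max_eqI)
    show "y \<le> b" if "y \<in> supp f" for y
    proof -
      have "y \<in> insert b A" using insert.prems(2)[OF \<open>f \<in> W\<close>] that by blast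
      thus ?thesis using insert.hyps(2) by auto
    qed
  qed (use that in \<open>auto simp: in_keys_iff\<close>)
  define W' where "W' = {f \<in> W. cf f b = 0}"
  have W': "mpoly_space.subspace W'"
  proof (rule mpoly_space.subspaceI)
    show "0 \<in> W'" using mpoly_space.subspace_0[OF insert.prems(1)] by (simp add: W'_def)
    show "x + y \<in> W'" if "x \<in> W'" "y \<in> W'" for x y
      using that mpoly_space.subspace_add[OF insert.prems(1)] by (simp add: W'_def lookup_add)
    show "scale c x \<in> W'" if "x \<in> W'" for c x
      using that mpoly_space.subspace_scale[OF insert.prems(1)] by (simp add: W'_def)
  qed
  have supp': "supp f \<subseteq> A" if "f \<in> W'" for f
  proof -
    have "b \<notin> supp f" using that by (simp add: W'_def in_keys_iff)
    thus ?thesis using insert.prems(2)[of f] that by (auto simp: W'_def)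
  qed
  have IH: "mpoly_space.dim W' = card (leading W')" by (rule insert.IH[OF W' supp'])
  have nb: "b \<notin> leading W'" using leading_subset[OF supp'] b by blast
  show ?case
  proof (cases "\<exists>g\<in>W. cf g b \<noteq> 0")
    case False
    hence "W' = W" by (auto simp: W'_def)
    thus ?thesis using IH by simp
  next
    case True
    then obtain g where g: "g \<in> W" "cf g b \<noteq> 0" by blast
    have fW': "fin_dim W'"
      by (rule fin_dim_mono[OF dim_supp_subset(1)[OF insert.hyps(1)]]) (use supp' in blast)
    have "mpoly_space.span (insert g W') = W"
    proof
      show "mpoly_space.span (insert g W') \<subseteq> W"
        using g by (intro mpoly_space.span_minimal insert.prems(1)) (auto simp: W'_def)
      show "W \<subseteq> mpoly_space.span (insert g W')"
      proof
        fix f assume f: "f \<in> W"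
        define c where "c = cf f b / cf g b"
        have "f - scale c g \<in> W'"
          using f g mpoly_space.subspace_diff[OF insert.prems(1) f mpoly_space.subspace_scale[OF insert.prems(1) g(1)]]
          by (simp add: W'_def lookup_minus c_def)
        hence "f - scale c g \<in> mpoly_space.span (insert g W')" by (intro mpoly_space.span_base) auto
        moreover have "scale c g \<in> mpoly_space.span (insert g W')"
          by (intro mpoly_space.span_scale mpoly_space.span_base) auto
        ultimately have "(f - scale c g) + scale c g \<in> mpoly_space.span (insert g W')" by (rule mpoly_space.span_add)
        thus "f \<in> mpoly_space.span (insert g W')" by simp
      qed
    qed
    hence "mpoly_space.dim W = Suc (mpoly_space.dim W')"
      using dim_span_insert[OF W' fW', of g] g(2) by (simp add: W'_def)
    moreover have "leading W = insert b (leading W')"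
    proof (intro equalityI subsetI)
      fix m assume "m \<in> leading W"
      then obtain f where f: "m = Max (supp f)" "f \<in> W" "f \<noteq> 0" by (auto simp: leading_def)
      show "m \<in> insert b (leading W')"
      proof (cases "cf f b = 0")
        case True
        thus ?thesis using f by (auto simp: leading_def W'_def)
      qed (use maxb[OF f(2)] f(1) in auto)
    next
      fix m assume "m \<in> insert b (leading W')"
      moreover have "b \<in> leading W"
      proof -
        have "g \<noteq> 0" using g(2) by auto
        thus ?thesis unfolding leading_def using maxb[OF g] g(1) by blast
      qed
      ultimately show "m \<in> leading W" by (auto simp: leading_def W'_def)
    qed
    moreover have "finite (leading W')" by (rule finite_subset[OF leading_subset[OF supp'] insert.hyps(1)])
    ultimately show ?thesis using IH nb by simp
  qed
qed

lemma leading_shad: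
  fixes J :: "('k::field) mpoly set"
  assumes J: "ideal J (poly_ring n)"
  shows "shad n (leading (J \<inter> forms n t)) \<subseteq> leading (J \<inter> forms n (Suc t))"
proof
  fix u assume "u \<in> shad n (leading (J \<inter> forms n t))"
  then obtain f i where f: "u = Max (supp f) + unit i" "f \<in> J" "f \<in> forms n t" "f \<noteq> 0" "i < n"
    by (auto simp: shad_def leading_def)
  let ?g = "var i * f"
  have lookup: "cf ?g (m + unit i) = cf f m" for m
  proof -
    have "?g = (\<Sum>k\<in>supp f. Poly_Mapping.single (k + unit i) (cf f k))"
      by (subst poly_expansion[of f]) (simp add: sum_distrib_left var_def monomial_def mult_single add.commute)
    hence "cf ?g (m + unit i) = (\<Sum>k\<in>supp f. if k = m then cf f k else 0)"
      by (simp add: lookup_sum lookup_single when_def)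
    thus ?thesis by (simp add: sum.delta in_keys_iff)
  qed
  have sub: "supp ?g \<subseteq> (\<lambda>m. m + unit i) ` supp f"
    using keys_mult[of "var i :: 'k mpoly" f] by (auto simp: var_def monomial_def add.commute)
  have supp: "supp ?g = (\<lambda>m. m + unit i) ` supp f"
    using sub lookup by (auto simp: in_keys_iff)
  have ne: "supp f \<noteq> {}" using f(4) supp_empty by blast
  have "Max (supp ?g) = Max (supp f) + unit i" unfolding supp
    using ne by (intro mono_Max_commute[symmetric]) (auto intro!: monoI add_right_mono)
  moreover have "?g \<noteq> 0" using supp ne supp_empty[of ?g] by simp
  moreover have "?g \<in> J" using f var_forms[OF f(5)] forms_polys by (intro ideal_mult[OF J]) auto
  moreover have "?g \<in> forms n (Suc t)" using mult_forms[OF var_forms[OF f(5)] f(3)] by simp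
  ultimately show "u \<in> leading (J \<inter> forms n (Suc t))" unfolding leading_def f(1) by force
qed

section \<open>Existence and uniqueness of the lex ideal\<close>

text \<open>The polynomials all of whose monomials lie in \<open>K\<close> form an ideal that contains the generators.\<close>

lemma monomial_ideal_supp:
  fixes K :: "('k::field) mpoly set"
  assumes K: "monomial_ideal n K" and f: "f \<in> K"
  shows "ideal K (poly_ring n)" "m \<in> supp f \<Longrightarrow> monomial m \<in> K"
proof -
  obtain M where M: "M \<subseteq> exponents n" "K = gen n (monomial ` M)" using K by (auto simp: monomial_ideal_def)
  have Mp: "(monomial ` M :: 'k mpoly set) \<subseteq> polys n" using M(1) monomial_polys by blast
  show KI: "ideal K (poly_ring n)" unfolding M(2) by (rule gen_ideal[OF Mp])
  define S where "S = {g :: 'k mpoly. g \<in> polys n \<and> (\<forall>m\<in>supp g. (monomial m :: 'k mpoly) \<in> K)}"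
  have "ideal S (poly_ring n)" unfolding ideal_iff
  proof (intro conjI ballI)
    show "S \<subseteq> polys n" "0 \<in> S" by (auto simp: S_def)
    show "a + b \<in> S" if "a \<in> S" "b \<in> S" for a b
      using that keys_add[of a b] by (auto simp: S_def add_polys)
    show "x * a \<in> S" if a: "a \<in> S" and x: "x \<in> polys n" for a x
    proof -
      have "monomial m \<in> K" if mx: "m \<in> supp (x * a)" for m
      proof -
        obtain u v where uv: "m = u + v" "u \<in> supp x" "v \<in> supp a" using mx keys_mult[of x a] by blast
        have "monomial u * monomial v \<in> K"
          using uv a x by (intro ideal_mult[OF KI] monomial_polys) (auto simp: S_def polys_iff)
        thus ?thesis by (simp add: uv(1) monomial_add)
      qed
      thus ?thesis using a x by (simp add: S_def mult_polys)
    qed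
  qed
  moreover have "monomial ` M \<subseteq> S"
    using M gen_superset[OF Mp] monomial_polys by (auto simp: S_def monomial_def[of "_"])
  ultimately have "K \<subseteq> S" unfolding M(2) by (rule gen_minimal)
  thus "m \<in> supp f \<Longrightarrow> monomial m \<in> K" using f by (auto simp: S_def)
qed

definition monomials_of :: "nat \<Rightarrow> ('k::field) mpoly set \<Rightarrow> nat \<Rightarrow> (nat \<Rightarrow>\<^sub>0 nat) set" where
  "monomials_of n K t = {m \<in> mons {..<n} t. monomial m \<in> K}"

lemma monomial_ideal_forms:
  fixes K :: "('k::field) mpoly set"
  assumes K: "monomial_ideal n K"
  shows "K \<inter> forms n t = {f. supp f \<subseteq> monomials_of n K t}"
proof (intro equalityI subsetI)
  fix f assume "f \<in> K \<inter> forms n t"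
  thus "f \<in> {f. supp f \<subseteq> monomials_of n K t}"
    using monomial_ideal_supp(2)[OF K] by (auto simp: forms_iff monomials_of_def)
next
  fix f :: "'k mpoly" assume f: "f \<in> {f. supp f \<subseteq> monomials_of n K t}"
  obtain M where "M \<subseteq> exponents n" "K = gen n (monomial ` M)" using K by (auto simp: monomial_ideal_def)
  hence KI: "ideal K (poly_ring n)" using monomial_polys by (auto intro!: gen_ideal)
  have "(\<Sum>m\<in>supp f. scale (cf f m) (monomial m)) \<in> K"
    using f by (intro ideal_sum[OF KI] ideal_scale[OF KI]) (auto simp: monomials_of_def)
  hence "f \<in> K" unfolding single_eq_scale[symmetric] poly_expansion[of f, symmetric] .
  thus "f \<in> K \<inter> forms n t" using f by (auto simp: forms_iff monomials_of_def)
qed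

lemma monomial_ideal_graded:
  fixes K :: "('k::field) mpoly set"
  assumes K: "monomial_ideal n K" shows "graded n K"
proof -
  obtain M where M: "M \<subseteq> exponents n" "K = gen n (monomial ` M)" using K by (auto simp: monomial_ideal_def)
  have "monomial ` M \<subseteq> (\<Union>t. forms n t :: 'k mpoly set)" using M(1) monomial_forms by (fastforce simp: exponents_mons)
  thus ?thesis unfolding M(2) by (rule graded_gen)
qed

lemma card_monomials_of:
  fixes K :: "('k::field) mpoly set"
  assumes "monomial_ideal n K" shows "card (monomials_of n K t) = hilbert_function n K t"
proof -
  have "finite (monomials_of n K t)"
    by (rule finite_subset[of _ "mons {..<n} t"]) (auto simp: monomials_of_def finite_mons)
  thus ?thesis unfolding hilbert_function_def monomial_ideal_forms[OF assms] by (simp add: dim_supp_subset(2))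
qed

lemma lex_up_closed:
  fixes K :: "('k::field) mpoly set"
  assumes "lex_segment_ideal n K" shows "up_closed (mons {..<n} t) (monomials_of n K t)"
  using assms unfolding up_closed_def lex_segment_ideal_def monomials_of_def
  by (auto simp: mons_def exponents_def)

lemma lex_ideal_unique:
  fixes J K :: "('k::field) mpoly set"
  assumes J: "lex_segment_ideal n J" and K: "lex_segment_ideal n K"
    and h: "hilbert_function n J = hilbert_function n K"
  shows "J \<subseteq> K"
proof -
  have mJ: "monomial_ideal n J" and mK: "monomial_ideal n K" using J K by (auto simp: lex_segment_ideal_def)
  have "monomials_of n J t \<subseteq> monomials_of n K t" for t
    using h by (intro up_closed_card_subset[OF _ lex_up_closed[OF J] lex_up_closed[OF K]])
      (auto simp: card_monomials_of[OF mJ] card_monomials_of[OF mK] finite_mons)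
  hence "J \<inter> forms n t \<subseteq> K" for t
    using monomial_ideal_forms[OF mJ, of t] monomial_ideal_forms[OF mK, of t] by blast
  thus ?thesis by (intro graded_eqI[OF monomial_ideal_graded[OF mJ] graded_ideal[OF monomial_ideal_graded[OF mK]]])
qed

text \<open>Take in each degree the lex segment with as many elements as \<open>I\<close> has leading monomials. By Macaulay's
theorem these segments are closed under multiplication by variables.\<close>

lemma lex_ideal_exists:
  fixes I :: "('k::field) mpoly set"
  assumes I: "graded n I"
  shows "\<exists>J :: 'k mpoly set. lex_segment_ideal n J \<and> hilbert_function n J = hilbert_function n I"
proof -
  note II = graded_ideal[OF I]
  define D where "D t = leading (I \<inter> forms n t)" for t
  have Dm: "D t \<subseteq> mons {..<n} t" for t
    unfolding D_def by (rule leading_subset) (simp add: forms_iff)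
  have Dc: "card (D t) = hilbert_function n I t" for t
    unfolding D_def hilbert_function_def
    by (rule dim_leading[OF finite_mons, symmetric, of "{..<n}" _ t])
      (auto simp: forms_iff intro!: mpoly_space.subspace_inter ideal_subspace[OF II] forms_subspace)
  define L where "L t = seg n t (card (D t))" for t
  have L: "up_closed (mons {..<n} t) (L t)" "card (L t) = card (D t)" for t
    unfolding L_def by (rule seg, rule card_mono[OF finite_mons Dm], simp)+
  have Lm: "L t \<subseteq> mons {..<n} t" for t using L(1) by (simp add: up_closed_def)
  have Lshad: "shad n (L t) \<subseteq> L (Suc t)" for t
  proof (rule up_closed_card_subset[OF _ shad_up_closed[OF L(1)] L(1)])
    have "card (shad n (L t)) \<le> card (shad n (D t))" by (rule macaulay[OF L(1) Dm]) (simp add: L(2))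
    also have "\<dots> \<le> card (D (Suc t))"
    proof (rule card_mono)
      show "finite (D (Suc t))" by (rule finite_subset[OF Dm]) (simp add: finite_mons)
      show "shad n (D t) \<subseteq> D (Suc t)" unfolding D_def by (rule leading_shad[OF II])
    qed
    finally show "card (shad n (L t)) \<le> card (L (Suc t))" by (simp add: L(2))
  qed (simp add: finite_mons)
  have Ladd: "m + k \<in> L (t + s)" if "m \<in> L t" "k \<in> mons {..<n} s" for m k t s
    using that(2)
  proof (induction s arbitrary: k)
    case 0
    thus ?case using that(1) by (simp add: mons_0)
  next
    case (Suc s)
    have "k \<noteq> 0" using Suc.prems by (auto simp: mons_def)
    then obtain i where i: "cf k i \<noteq> 0" by (auto simp: poly_mapping_eq_iff fun_eq_iff)
    hence "i \<in> supp k" by (simp add: in_keys_iff)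
    hence iN: "i < n" using Suc.prems by (auto simp: mons_def)
    have "m + (k - unit i) \<in> L (t + s)" using minus_unit_mons[OF Suc.prems i] by (rule Suc.IH)
    hence "(m + (k - unit i)) + unit i \<in> shad n (L (t + s))" using iN unfolding shad_def by blast
    hence "m + k \<in> shad n (L (t + s))" unfolding add.assoc add_minus_single[OF i] .
    thus ?case using Lshad[of "t + s"] by auto
  qed
  define U where "U = (\<Union>t. L t)"
  have Ue: "U \<subseteq> exponents n" using Lm by (auto simp: U_def exponents_mons)
  have UL: "U \<inter> mons {..<n} t = L t" for t
    using Lm by (fastforce simp: U_def mons_def)
  define J where "J = {f :: 'k mpoly. supp f \<subseteq> U}"
  have JI: "ideal J (poly_ring n)" unfolding ideal_iff
  proof (intro conjI ballI)
    show "J \<subseteq> polys n" "0 \<in> J" using Ue by (auto simp: J_def polys_iff)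
    show "a + b \<in> J" if "a \<in> J" "b \<in> J" for a b using that keys_add[of a b] by (auto simp: J_def)
    show "x * a \<in> J" if a: "a \<in> J" and x: "x \<in> polys n" for a x
      unfolding J_def
    proof (intro CollectI subsetI)
      fix m assume "m \<in> supp (x * a)"
      then obtain u v where uv: "m = u + v" "u \<in> supp x" "v \<in> supp a" using keys_mult[of x a] by blast
      obtain t where t: "v \<in> L t" using uv(3) a by (auto simp: J_def U_def)
      have "u \<in> exponents n" using uv(2) x by (auto simp: polys_iff)
      then obtain s where "u \<in> mons {..<n} s" by (auto simp: exponents_mons)
      hence "v + u \<in> L (t + s)" using Ladd t by blast
      thus "m \<in> U" by (auto simp: U_def uv(1) add.commute)
    qed
  qed
  have Up: "(monomial ` U :: 'k mpoly set) \<subseteq> polys n" using Ue monomial_polys by blast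
  have "J = gen n (monomial ` U)"
  proof
    have G: "ideal (gen n (monomial ` U :: 'k mpoly set)) (poly_ring n)" by (rule gen_ideal[OF Up])
    show "J \<subseteq> gen n (monomial ` U)"
    proof
      fix f assume f: "f \<in> J"
      have "(\<Sum>m\<in>supp f. scale (cf f m) (monomial m)) \<in> gen n (monomial ` U)"
        using f gen_superset[OF Up] by (intro ideal_sum[OF G] ideal_scale[OF G]) (auto simp: J_def)
      thus "f \<in> gen n (monomial ` U)" unfolding single_eq_scale[symmetric] poly_expansion[of f, symmetric] .
    qed
    show "gen n (monomial ` U) \<subseteq> J" by (rule gen_minimal[OF JI]) (auto simp: J_def monomial_def)
  qed
  hence mono: "monomial_ideal n J" unfolding monomial_ideal_def using Ue by blast
  have mJ: "monomial m \<in> J \<longleftrightarrow> m \<in> U" for m by (simp add: J_def monomial_def)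
  have "lex_segment_ideal n J" unfolding lex_segment_ideal_def
  proof (intro conjI mono ballI impI)
    fix a b assume ab: "a \<in> exponents n" "b \<in> exponents n" "monomial a \<in> J \<and> mdeg b = mdeg a \<and> a \<le> b"
    have "a \<in> U \<inter> mons {..<n} (mdeg a)" "b \<in> mons {..<n} (mdeg a)"
      using ab mJ by (auto simp: mons_def exponents_def)
    hence "b \<in> L (mdeg a)" using L(1)[of "mdeg a"] ab(3) unfolding UL by (auto simp: up_closed_def)
    thus "monomial b \<in> J" by (auto simp: mJ U_def)
  qed
  moreover have "hilbert_function n J t = hilbert_function n I t" for t
  proof -
    have "monomials_of n J t = L t" using UL[of t] by (auto simp: monomials_of_def mJ)
    thus ?thesis using card_monomials_of[OF mono, of t] by (simp add: L(2) Dc)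
  qed
  ultimately show ?thesis by blast
qed

lemma lex_ideal_properties:
  fixes I :: "('k::field) mpoly set"
  assumes "graded n I"
  shows "lex_segment_ideal n (lex_ideal n I)" "hilbert_function n (lex_ideal n I) = hilbert_function n I"
proof -
  have "\<exists>!J :: 'k mpoly set. lex_segment_ideal n J \<and> hilbert_function n J = hilbert_function n I"
  proof (rule ex_ex1I[OF lex_ideal_exists[OF assms]])
    fix J K :: "'k mpoly set"
    assume "lex_segment_ideal n J \<and> hilbert_function n J = hilbert_function n I"
      "lex_segment_ideal n K \<and> hilbert_function n K = hilbert_function n I"
    thus "J = K" using lex_ideal_unique[of n J K] lex_ideal_unique[of n K J] by auto
  qed
  from theI'[OF this] show "lex_segment_ideal n (lex_ideal n I)" "hilbert_function n (lex_ideal n I) = hilbert_function n I"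
    unfolding lex_ideal_def by auto
qed

section \<open>Reductions of graded quotients\<close>

lemma hilb_cong:
  "hilbert_function n (J :: ('k::field) mpoly set) = hilbert_function n (I :: 'k mpoly set) \<Longrightarrow> hilb n J t = hilb n I t"
  by (drule fun_cong[where x = t]) (simp add: hilb_def hilbert_function_def)

text \<open>Ideals of \<open>R/I\<close> generated by residue classes are pulled back to \<open>R\<close>.\<close>

lemma quotient_generated_mem:
  fixes I :: "('k::field) mpoly set"
  assumes I: "ideal I (poly_ring n)" and z: "set zs \<subseteq> polys n" and f: "f \<in> polys n"
  shows "I +>\<^bsub>poly_ring n\<^esub> f \<in> Idl\<^bsub>poly_ring n Quot I\<^esub> (set (map (\<lambda>z. I +>\<^bsub>poly_ring n\<^esub> z) zs)) \<longleftrightarrow> f \<in> ext n I zs"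
proof
  let ?R = "poly_ring n :: 'k mpoly ring"
  let ?A = "?R Quot I"
  let ?Z = "set (map (\<lambda>z. I +>\<^bsub>?R\<^esub> z) zs)"
  interpret ideal I ?R by (rule I)
  interpret h: ring_hom_ring ?R ?A "(+>\<^bsub>?R\<^esub>) I" by (rule rcos_ring_hom_ring)
  have carr: "I +>\<^bsub>?R\<^esub> r \<in> carrier ?A" if "r \<in> polys n" for r using that by (rule h.hom_closed)
  have Zc: "?Z \<subseteq> carrier ?A" using z carr by auto
  have A: "ring ?A" by (rule quotient_is_ring)
  have EI: "ideal (ext n I zs) ?R" by (rule ext_ideal[OF I z])
  {
    assume "I +>\<^bsub>?R\<^esub> f \<in> Idl\<^bsub>?A\<^esub> ?Z"
    moreover have "ideal ((\<lambda>r. I +>\<^bsub>?R\<^esub> r) ` ext n I zs) ?A" by (rule ring_ideal_imp_quot_ideal[OF I EI])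
    moreover have "?Z \<subseteq> (\<lambda>r. I +>\<^bsub>?R\<^esub> r) ` ext n I zs" using ext_superset(2)[OF I z] by auto
    ultimately have "I +>\<^bsub>?R\<^esub> f \<in> (\<lambda>r. I +>\<^bsub>?R\<^esub> r) ` ext n I zs"
      using ring.genideal_minimal[OF A] by blast
    then obtain g where g: "g \<in> ext n I zs" "f - g \<in> I" using coset_eq_iff[OF I, of f] by auto
    have "(f - g) + g \<in> ext n I zs" using g ext_superset(1)[OF I z] by (intro ideal_add[OF EI]) auto
    thus "f \<in> ext n I zs" by simp
  }
  {
    assume fE: "f \<in> ext n I zs"
    have ZI: "ideal (Idl\<^bsub>?A\<^esub> ?Z) ?A" by (rule ring.genideal_ideal[OF A Zc])
    have V: "ideal {r \<in> carrier ?R. I +>\<^bsub>?R\<^esub> r \<in> Idl\<^bsub>?A\<^esub> ?Z} ?R" by (rule h.ideal_vimage[OF ZI])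
    have "I \<subseteq> {r \<in> carrier ?R. I +>\<^bsub>?R\<^esub> r \<in> Idl\<^bsub>?A\<^esub> ?Z}"
    proof
      fix r assume r: "r \<in> I"
      have "I +>\<^bsub>?R\<^esub> r = I +>\<^bsub>?R\<^esub> 0" using r by (simp add: coset_eq_iff[OF I])
      also have "\<dots> = \<zero>\<^bsub>?A\<^esub>" by (simp add: FactRing_def coset_eq_set)
      also have "\<dots> \<in> Idl\<^bsub>?A\<^esub> ?Z" by (rule additive_subgroup.zero_closed[OF ideal.axioms(1)[OF ZI]])
      finally show "r \<in> {r \<in> carrier ?R. I +>\<^bsub>?R\<^esub> r \<in> Idl\<^bsub>?A\<^esub> ?Z}" using r ideal_subset[OF I] by auto
    qed
    moreover have "set zs \<subseteq> {r \<in> carrier ?R. I +>\<^bsub>?R\<^esub> r \<in> Idl\<^bsub>?A\<^esub> ?Z}"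
      using ring.genideal_self[OF A Zc] z by auto
    ultimately have "ext n I zs \<subseteq> {r \<in> carrier ?R. I +>\<^bsub>?R\<^esub> r \<in> Idl\<^bsub>?A\<^esub> ?Z}"
      by (rule ext_minimal[OF V])
    thus "I +>\<^bsub>?R\<^esub> f \<in> Idl\<^bsub>?A\<^esub> ?Z" using fE by blast
  }
qed

lemma quotient_component_covered:
  fixes I :: "('k::field) mpoly set"
  assumes I: "ideal I (poly_ring n)" and z: "set zs \<subseteq> polys n"
  shows "Idl\<^bsub>poly_ring n Quot I\<^esub> (set (map (\<lambda>z. I +>\<^bsub>poly_ring n\<^esub> z) zs)) \<inter> quotient_component n I t = quotient_component n I t
    \<longleftrightarrow> forms n t \<subseteq> ext n I zs"
proof -
  have "I +>\<^bsub>poly_ring n\<^esub> f \<in> Idl\<^bsub>poly_ring n Quot I\<^esub> (set (map (\<lambda>z. I +>\<^bsub>poly_ring n\<^esub> z) zs)) \<longleftrightarrow> f \<in> ext n I zs"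
    if "f \<in> forms n t" for f using quotient_generated_mem[OF I z forms_polys[OF that]] .
  thus ?thesis unfolding quotient_component_def by blast
qed

lemma linear_forms_reduction:
  fixes I :: "('k::field) mpoly set"
  assumes I: "ideal I (poly_ring n)" and z: "set zs \<subseteq> forms n 1" "length zs = d" and fin: "finite_length n (ext n I zs)"
  shows "is_reduction (poly_ring n Quot I) (quotient_component n I) d
    (Idl\<^bsub>poly_ring n Quot I\<^esub> (set (map (\<lambda>z. I +>\<^bsub>poly_ring n\<^esub> z) zs)))"
proof -
  have zp: "set zs \<subseteq> polys n" using z forms_polys by blast
  obtain t0 where "\<forall>t\<ge>t0. forms n t \<subseteq> ext n I zs"
    using fin finite_length_iff[OF ext_ideal[OF I zp]] by blast
  moreover have "set (map (\<lambda>z. I +>\<^bsub>poly_ring n\<^esub> z) zs) \<subseteq> quotient_component n I 1"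
    using z(1) by (auto simp: quotient_component_def)
  ultimately show ?thesis unfolding is_reduction_def
    using quotient_component_covered[OF I zp] z(2)
    by (intro conjI exI[of _ "map (\<lambda>z. I +>\<^bsub>poly_ring n\<^esub> z) zs"] exI[of _ t0]) simp_all
qed

lemma reduction_linear_forms:
  fixes I :: "('k::field) mpoly set"
  assumes "is_reduction (poly_ring n Quot I) (quotient_component n I) d q"
  obtains zs where "length zs = d" "set zs \<subseteq> forms n 1"
    "q = Idl\<^bsub>poly_ring n Quot I\<^esub> (set (map (\<lambda>z. I +>\<^bsub>poly_ring n\<^esub> z) zs))"
proof -
  obtain Zs where Z: "length Zs = d" "set Zs \<subseteq> quotient_component n I 1" "q = Idl\<^bsub>poly_ring n Quot I\<^esub> (set Zs)"
    using assms unfolding is_reduction_def by blast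
  have "Zs \<in> lists ((\<lambda>f. I +>\<^bsub>poly_ring n\<^esub> f) ` forms n 1)" using Z(2) by (auto simp: quotient_component_def)
  hence "Zs \<in> map (\<lambda>f. I +>\<^bsub>poly_ring n\<^esub> f) ` lists (forms n 1)" by (simp only: lists_image)
  then obtain zs where zs: "Zs = map (\<lambda>f. I +>\<^bsub>poly_ring n\<^esub> f) zs" "zs \<in> lists (forms n 1)" by blast
  have "length zs = d" using Z(1) zs(1) by simp
  moreover have "set zs \<subseteq> forms n 1" using zs(2) by auto
  moreover have "q = Idl\<^bsub>poly_ring n Quot I\<^esub> (set (map (\<lambda>z. I +>\<^bsub>poly_ring n\<^esub> z) zs))" unfolding Z(3) zs(1) ..
  ultimately show thesis by (rule that)
qed

text \<open>The infimum is attained because there is at least one reduction by linear forms.\<close>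

lemma red_attained:
  fixes I :: "('k::field) mpoly set"
  assumes inf: "infinite (UNIV :: 'k set)" and I: "graded n I"
    and d: "krull_dim (poly_ring n Quot I) = enat d" "growth n I d"
  obtains zs where "length zs = d" "set zs \<subseteq> forms n 1" "forms n (Suc (red n I)) \<subseteq> ext n I zs"
proof -
  note II = graded_ideal[OF I]
  let ?A = "poly_ring n Quot I" and ?G = "quotient_component n I"
  define X where "X = {reduction_number_wrt ?G q | q d. krull_dim ?A = enat d \<and> is_reduction ?A ?G d q}"
  obtain ws where ws: "length ws = d" "set ws \<subseteq> forms n 1" "finite_length n (ext n I ws)"
    by (rule exists_linear_reduction[OF inf I d(2)])
  have "X \<noteq> {}" using linear_forms_reduction[OF II ws(2,1,3)] d(1) unfolding X_def by blast
  hence "Inf X \<in> X" by (rule Inf_nat_def1)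
  moreover have "red n I = Inf X" by (simp add: red_def reduction_number_def X_def)
  ultimately obtain q d' where q: "red n I = reduction_number_wrt ?G q" "krull_dim ?A = enat d'" "is_reduction ?A ?G d' q"
    unfolding X_def by auto
  have "d' = d" using q(2) d(1) by simp
  obtain zs where zs: "length zs = d'" "set zs \<subseteq> forms n 1"
    "q = Idl\<^bsub>?A\<^esub> (set (map (\<lambda>z. I +>\<^bsub>poly_ring n\<^esub> z) zs))"
    by (rule reduction_linear_forms[OF q(3)])
  have zp: "set zs \<subseteq> polys n" using zs forms_polys by blast
  obtain t0 where "\<forall>t\<ge>t0. q \<inter> ?G t = ?G t" using q(3) unfolding is_reduction_def by blast
  hence "q \<inter> ?G (t0 + 1) = ?G (t0 + 1)" by simp
  hence "q \<inter> ?G (reduction_number_wrt ?G q + 1) = ?G (reduction_number_wrt ?G q + 1)"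
    unfolding reduction_number_wrt_def by (rule LeastI[of "\<lambda>r. q \<inter> ?G (r + 1) = ?G (r + 1)"])
  hence "forms n (red n I + 1) \<subseteq> ext n I zs"
    unfolding q(1) zs(3) quotient_component_covered[OF II zp] .
  thus thesis using that zs(1,2) \<open>d' = d\<close> by simp
qed

lemma red_le:
  fixes I :: "('k::field) mpoly set"
  assumes I: "ideal I (poly_ring n)" and d: "krull_dim (poly_ring n Quot I) = enat d"
    and z: "set zs \<subseteq> forms n 1" "length zs = d" and cov: "forms n (Suc r) \<subseteq> ext n I zs"
  shows "red n I \<le> r"
proof -
  let ?A = "poly_ring n Quot I" and ?G = "quotient_component n I"
  let ?q = "Idl\<^bsub>?A\<^esub> (set (map (\<lambda>z. I +>\<^bsub>poly_ring n\<^esub> z) zs))"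
  have zp: "set zs \<subseteq> polys n" using z forms_polys by blast
  have EI: "ideal (ext n I zs) (poly_ring n)" by (rule ext_ideal[OF I zp])
  have "forms n t \<subseteq> ext n I zs" if "t \<ge> Suc r" for t
    using forms_upward[OF EI cov, of "t - Suc r"] that by simp
  hence "finite_length n (ext n I zs)" unfolding finite_length_iff[OF EI] by blast
  hence "is_reduction ?A ?G d ?q" by (rule linear_forms_reduction[OF I z])
  hence "reduction_number_wrt ?G ?q \<in> {reduction_number_wrt ?G q | q d. krull_dim ?A = enat d \<and> is_reduction ?A ?G d q}"
    using d by blast
  hence "red n I \<le> reduction_number_wrt ?G ?q"
    unfolding red_def reduction_number_def by (rule cInf_lower) simp
  also have "\<dots> \<le> r"
  proof -
    have "?q \<inter> ?G (r + 1) = ?G (r + 1)" unfolding quotient_component_covered[OF I zp] using cov by simp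
    thus ?thesis unfolding reduction_number_wrt_def by (rule Least_le)
  qed
  finally show ?thesis .
qed

section \<open>The reduction number of a lex-segment ideal\<close>

text \<open>If \<open>J\<close> contained no monomial of degree \<open>t\<close> in the last \<open>d + 1\<close> variables, the Hilbert function
of \<open>R/J\<close> at \<open>t\<close> would be at least the number of these monomials.\<close>

lemma lex_segment_covered:
  fixes J :: "('k::field) mpoly set"
  assumes J: "lex_segment_ideal n J" and d: "d \<le> n" and t: "t \<ge> 1" and h: "hilb n J t < (t + d) choose d"
  shows "forms n t \<subseteq> ext n J (map var [n - d..<n])"
proof -
  have mono: "monomial_ideal n J" using J by (simp add: lex_segment_ideal_def)
  note JI = graded_ideal[OF monomial_ideal_graded[OF mono]]
  let ?zs = "map var [n - d..<n] :: 'k mpoly list"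
  have "set ?zs \<subseteq> forms n 1" using var_forms[of _ n] by auto
  hence zp: "set ?zs \<subseteq> polys n" using forms_polys by blast
  have EI: "ideal (ext n J ?zs) (poly_ring n)" by (rule ext_ideal[OF JI zp])
  have div: "monomial m \<in> ext n J ?zs" if m: "m \<in> mons {..<n} t" and i: "n - d \<le> i" "cf m i \<noteq> 0" for m i
  proof -
    have "i \<in> supp m" using i by (simp add: in_keys_iff)
    hence "i < n" using m by (auto simp: mons_def)
    hence "var i \<in> set ?zs" using i by auto
    hence "(var i :: 'k mpoly) \<in> ext n J ?zs" using ext_superset(2)[OF JI zp] by blast
    moreover have "m - unit i \<in> exponents n"
      using m by (auto simp: exponents_def mons_def in_keys_iff lookup_minus subset_iff)
    ultimately have "monomial (m - unit i) * var i \<in> ext n J ?zs"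
      by (intro ideal_mult[OF EI] monomial_polys)
    thus ?thesis unfolding var_def monomial_add[symmetric] add_minus_single[OF i(2)] .
  qed
  show ?thesis
  proof (rule forms_subset_of_monomials[OF EI])
    fix m assume m: "m \<in> mons {..<n} t"
    show "monomial m \<in> ext n J ?zs"
    proof (cases "\<exists>i\<ge>n - d. cf m i \<noteq> 0")
      case True
      thus ?thesis using div[OF m] by blast
    next
      case False
      have m0: "m \<noteq> 0" using m t by (auto simp: mons_def)
      have nd: "d < n"
      proof (rule ccontr)
        assume "\<not> d < n"
        hence "cf m i = 0" for i using False by auto
        thus False using m0 by (auto simp: poly_mapping_eq_iff fun_eq_iff)
      qed
      define k where "k = n - d - 1"
      have k: "n - d = Suc k" "k < n" using nd by (auto simp: k_def)
      define V where "V = {k..<n}"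
      have V: "finite V" "card V = Suc d" using k d by (auto simp: V_def)
      have "\<exists>w\<in>mons V t. monomial w \<in> J"
      proof (rule ccontr)
        assume "\<not> ?thesis"
        hence disj: "monomials_of n J t \<inter> mons V t = {}" by (auto simp: monomials_of_def)
        have "mons V t \<subseteq> mons {..<n} t" by (auto simp: mons_def V_def)
        hence sub: "monomials_of n J t \<union> mons V t \<subseteq> mons {..<n} t" by (auto simp: monomials_of_def)
        have fin: "finite (mons {..<n} t)" by (simp add: finite_mons)
        have "card (monomials_of n J t \<union> mons V t) \<le> card (mons {..<n} t)" by (rule card_mono[OF fin sub])
        moreover have "card (monomials_of n J t \<union> mons V t) = card (monomials_of n J t) + card (mons V t)"
          using finite_subset[OF _ fin] sub by (intro card_Un_disjoint disj) auto
        moreover have "card (mons {..<n} t) = mpoly_space.dim (forms n t :: 'k mpoly set)"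
          using mons_card[of "{..<n}" t] by (simp add: dim_forms)
        moreover have "card (mons V t) = (t + d) choose t" using mons_card[OF V(1), of t] V(2) by (simp add: add.commute)
        moreover have "(t + d) choose t = (t + d) choose d" using binomial_symmetric[of t "t + d"] by simp
        ultimately show False using h card_monomials_of[OF mono, of t] by (simp add: hilb_def hilbert_function_def)
      qed
      then obtain w where w: "w \<in> mons V t" "monomial w \<in> J" by blast
      define p where "p = Poly_Mapping.single k t"
      have pe: "p \<in> exponents n" "mdeg p = t" using k by (auto simp: p_def exponents_def)
      have we: "w \<in> exponents n" "mdeg w = t" using w(1) by (auto simp: mons_def exponents_def V_def)
      have "w \<le> p"
      proof (cases "w = p")
        case False
        have "cf w k \<noteq> t"
        proof
          assume wk: "cf w k = t"
          have "mdeg w = (\<Sum>j\<in>V. cf w j)" using w(1) by (intro mdeg_superset V) (auto simp: mons_def)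
          also have "\<dots> = cf w k + (\<Sum>j\<in>V - {k}. cf w j)" using k V(1) by (intro sum.remove) (auto simp: V_def)
          finally have "(\<Sum>j\<in>V - {k}. cf w j) = 0" using wk we(2) by simp
          hence z: "cf w j = 0" if "j \<in> V - {k}" for j using V(1) that by simp
          have "cf w j = cf p j" for j
          proof (cases "j \<in> V")
            case True
            thus ?thesis using z[of j] wk by (cases "j = k") (auto simp: p_def lookup_single)
          next
            case F: False
            hence "j \<notin> supp w" using w(1) by (auto simp: mons_def)
            moreover have "j \<noteq> k" using F k by (auto simp: V_def)
            ultimately show ?thesis by (simp add: p_def lookup_single in_keys_iff)
          qed
          thus False using False by (simp add: poly_mapping_eqI)
        qed
        moreover have "cf w k \<le> t"
          using member_le_sum[of k V "cf w"] V(1) k mdeg_superset[OF V(1), of w] w(1) by (auto simp: V_def mons_def)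
        ultimately have lt: "cf w k < cf p k" by (simp add: p_def)
        have "w < p"
        proof (rule lex_lessI[OF lt])
          fix j assume j: "j < k"
          hence "j \<notin> supp w" using w(1) by (auto simp: mons_def V_def)
          thus "cf w j = cf p j" using j by (simp add: p_def lookup_single in_keys_iff)
        qed
        thus ?thesis by simp
      qed simp
      hence pJ: "monomial p \<in> J" using J we pe w(2) unfolding lex_segment_ideal_def by metis
      have "p \<le> m"
      proof (cases "m = p")
        case False
        have low: "\<exists>j<k. cf m j \<noteq> 0"
        proof (rule ccontr)
          assume "\<not> ?thesis"
          hence zero: "cf m j = 0" if "j \<noteq> k" for j
            using that \<open>\<not> (\<exists>i\<ge>n - d. cf m i \<noteq> 0)\<close> k(1) by (cases "j < k") auto
          hence "supp m \<subseteq> {k}" by (auto simp: in_keys_iff)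
          hence "mdeg m = cf m k" using mdeg_superset[of "{k}" m] by simp
          hence "m = p" using zero m by (intro poly_mapping_eqI) (auto simp: p_def lookup_single when_def mons_def)
          thus False using False by simp
        qed
        define j where "j = (LEAST j. cf m j \<noteq> 0)"
        have j: "cf m j \<noteq> 0" unfolding j_def using low LeastI_ex[of "\<lambda>j. cf m j \<noteq> 0"] by blast
        have jk: "j < k" using low unfolding j_def by (meson Least_le le_less_trans)
        have "p < m"
        proof (rule lex_lessI)
          show "cf p j < cf m j" using j jk by (simp add: p_def lookup_single)
          fix l assume l: "l < j"
          hence "cf m l = 0" unfolding j_def using not_less_Least by blast
          thus "cf p l = cf m l" using l jk by (simp add: p_def lookup_single)
        qed
        thus ?thesis by simp
      qed simp
      moreover have "m \<in> exponents n" "mdeg m = t" using m by (auto simp: mons_def exponents_def)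
      ultimately have "monomial m \<in> J" using J pJ pe unfolding lex_segment_ideal_def by metis
      thus ?thesis using ext_superset(1)[OF JI zp] by blast
    qed
  qed
qed

lemma red_lex_le:
  fixes I :: "('k::field) mpoly set"
  assumes inf: "infinite (UNIV :: 'k set)" and I: "graded n I"
    and d: "d \<ge> 1" "d \<le> n" "growth n I d" "\<not> growth n I (d - 1)"
    and h: "hilb n I (Suc r) < (Suc r + d) choose d"
  shows "red n (lex_ideal n I) \<le> r"
proof -
  let ?J = "lex_ideal n I"
  have J: "lex_segment_ideal n ?J" and hJ: "hilb n ?J t = hilb n I t" for t
    using lex_ideal_properties[OF I] hilb_cong by blast+
  have G: "graded n ?J" using J by (intro monomial_ideal_graded) (simp add: lex_segment_ideal_def)
  have gr: "growth n ?J D \<longleftrightarrow> growth n I D" for D by (rule growth_cong) (rule hJ)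
  have "krull_dim (poly_ring n Quot ?J) = enat d"
    using d gr by (intro krull_dim_eqI[OF inf G]) (auto simp: dim_at_least_def)
  moreover have "set (map var [n - d..<n]) \<subseteq> (forms n 1 :: 'k mpoly set)" using var_forms[of _ n] by auto
  moreover have "forms n (Suc r) \<subseteq> ext n ?J (map var [n - d..<n])"
    using h by (intro lex_segment_covered[OF J d(2)]) (simp_all add: hJ)
  ultimately show ?thesis using d(2) by (intro red_le[OF graded_ideal[OF G]]) auto
qed

section \<open>Minimal generators\<close>

text \<open>A generator \<open>0\<close> is redundant, and a nonzero constant would generate the unit ideal.\<close>

lemma minimal_generators_degrees:
  fixes I :: "('k::field) mpoly set"
  assumes gen: "minimal_homogeneous_generators n I fs" and proper: "1 \<notin> I"
  shows "forms_of_degrees n (map tdeg fs) fs"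
proof -
  have fs: "set fs \<subseteq> (\<Union>t. forms n t)" "I = gen n (set fs)" and min: "\<And>S. S \<subset> set fs \<Longrightarrow> I \<noteq> gen n S"
    using gen by (auto simp: minimal_homogeneous_generators_def)
  have fp: "set fs \<subseteq> polys n" using fs(1) forms_polys by blast
  have "tdeg f \<ge> 1 \<and> f \<in> forms n (tdeg f)" if f: "f \<in> set fs" for f
  proof -
    obtain e where e: "f \<in> forms n e" using f fs(1) by blast
    have "f \<noteq> 0"
    proof
      assume "f = 0"
      have S: "set fs - {f} \<subseteq> polys n" using fp by blast
      have "gen n (set fs) \<subseteq> gen n (set fs - {f})"
        using gen_superset[OF S] ideal_zero[OF gen_ideal[OF S]] \<open>f = 0\<close> by (intro gen_minimal gen_ideal[OF S]) auto
      moreover have "gen n (set fs - {f}) \<subseteq> gen n (set fs)" by (rule gen_mono[OF fp]) blast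
      ultimately have "I = gen n (set fs - {f})" using fs(2) by simp
      thus False using min[of "set fs - {f}"] f by blast
    qed
    hence ne: "supp f \<noteq> {}" using supp_empty by blast
    obtain m where m: "m \<in> supp f" using ne by blast
    have deg: "\<And>m. m \<in> supp f \<Longrightarrow> mdeg m = e" using e by (simp add: forms_def)
    have "mdeg ` supp f = {e}" using deg m by (auto intro: image_eqI[of _ _ m])
    hence te: "tdeg f = e" by (simp add: tdeg_def)
    have "e \<noteq> 0"
    proof
      assume "e = 0"
      hence "supp f \<subseteq> {0}" using e by (simp add: forms_iff mons_0)
      hence s: "supp f = {0}" using ne by blast
      have nz: "cf f 0 \<noteq> 0" using s by (simp add: in_keys_iff[symmetric])
      have z: "cf f m = 0" if "m \<noteq> 0" for m using s that by (simp add: not_in_keys_iff_lookup_eq_zero[symmetric])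
      have "scale (inverse (cf f 0)) f = 1"
      proof (rule poly_mapping_eqI)
        show "cf (scale (inverse (cf f 0)) f) m = cf 1 m" for m
          using nz z[of m] by (cases "m = 0") (simp_all add: lookup_one)
      qed
      moreover have "scale (inverse (cf f 0)) f \<in> I"
        unfolding fs(2) using gen_superset[OF fp] f by (intro ideal_scale[OF gen_ideal[OF fp]]) auto
      ultimately show False using proper by simp
    qed
    thus ?thesis using e te by simp
  qed
  thus ?thesis unfolding forms_of_degrees_def by (auto simp: list_all2_conv_all_nth)
qed

text \<open>The degree-\<open>1\<close> part of \<open>I\<close> lies in the ideal of the other generators if the left-out generator has
degree at least \<open>2\<close>; so such a generator would be redundant.\<close>

lemma linear_minimal_generators:
  fixes I :: "('k::field) mpoly set"
  assumes gen: "minimal_homogeneous_generators n I fs" and fd: "forms_of_degrees n (map tdeg fs) fs"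
    and lin: "I \<subseteq> gen n (I \<inter> forms n 1)" and e: "e \<in> set (map tdeg fs)"
  shows "e < 2"
proof (rule ccontr)
  assume "\<not> e < 2"
  have fs: "set fs \<subseteq> (\<Union>t. forms n t)" "I = gen n (set fs)" and min: "\<And>S. S \<subset> set fs \<Longrightarrow> I \<noteq> gen n S"
    using gen by (auto simp: minimal_homogeneous_generators_def)
  have fp: "set fs \<subseteq> polys n" using fs(1) forms_polys by blast
  obtain g where g: "g \<in> set fs" "e = tdeg g" using e by auto
  have gf: "g \<in> forms n e" using fd g by (auto simp: forms_of_degrees_def list_all2_conv_all_nth in_set_conv_nth)
  define S where "S = set fs - {g}"
  have S: "S \<subseteq> (\<Union>t. forms n t)" "S \<subseteq> polys n" using fs(1) fp by (auto simp: S_def)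
  have SG: "graded n (gen n S)" by (rule graded_gen[OF S(1)])
  note SI = graded_ideal[OF SG]
  have ins: "insert g S = set fs" using g by (auto simp: S_def)
  have "I \<inter> forms n 1 \<subseteq> gen n S"
  proof
    fix x assume x: "x \<in> I \<inter> forms n 1"
    have "I = adj n (gen n S) g" unfolding fs(2) ins[symmetric] by (rule gen_insert[OF S(2) forms_polys[OF gf]])
    then obtain j h where jh: "x = j + h * g" "j \<in> gen n S" "h \<in> polys n" using x unfolding adj_def by blast
    have "hcomp 1 x = hcomp 1 j"
      using gf hcomp_mult_homogeneous[of g e 1 h] \<open>\<not> e < 2\<close> by (simp add: jh(1) hcomp_add forms_def)
    moreover have "hcomp 1 x = x" using x hcomp_homogeneous[of x 1 1] by (simp add: forms_def)
    ultimately show "x \<in> gen n S" using graded_hcomp[OF SG jh(2), of 1] by simp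
  qed
  hence "gen n (I \<inter> forms n 1) \<subseteq> gen n S" by (rule gen_minimal[OF SI])
  hence "I \<subseteq> gen n S" using lin by blast
  moreover have "gen n S \<subseteq> I" unfolding fs(2) by (rule gen_mono[OF fp]) (auto simp: S_def)
  ultimately have "I = gen n S" by blast
  thus False using min[of S] g by (auto simp: S_def)
qed

lemma prod_list_ge_1: "\<forall>a\<in>set as. a \<ge> 1 \<Longrightarrow> prod_list as \<ge> (1::nat)"
  by (induction as) (auto simp: Suc_le_eq)

theorem theorem2p7:
  fixes n d :: nat
    and I :: "('k::field) mpoly set"
    and fs :: "'k mpoly list"
    and a :: "nat list"
  assumes infinite_field: "infinite (UNIV :: 'k set)"
    and homogeneous: "homogeneous_ideal n I"
    and dimension: "krull_dim (poly_ring n Quot I) = enat d"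
    and dim_pos: "d \<ge> 1"
    and generators: "minimal_homogeneous_generators n I fs"
    and degrees: "a = map tdeg fs"
    and descending: "sorted_wrt (\<ge>) a"
    \<comment> \<open>If \<open>d \<ge> 2\<close> and \<open>I\<close> is generated by linear forms (or \<open>I = 0\<close>), then \<open>r(R/I) = 0\<close> and both
      bounds equal \<open>1 - d < 0\<close>; this degenerate case has to be excluded.\<close>
    and nonlinear: "d \<ge> 2 \<longrightarrow> (\<exists>e\<in>set a. e \<ge> 2)"
  shows "int (red n (lex_ideal n I))
           \<le> int d * (int ((red n I + n - d) choose (n - d)) - 2) + 1 \<and>
         int (red n (lex_ideal n I))
           \<le> int d * ((\<Prod>i<n - d. int (a ! i)) - 2) + 1"
proof -
  have I: "graded n I" using homogeneous graded_gen unfolding homogeneous_ideal_def by blast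
  note II = graded_ideal[OF I] and Z = graded_ideal[OF graded_zero]
  have gr: "growth n I d" and ngr: "\<not> growth n I (d - 1)"
    using growth_of_krull_dim[OF infinite_field I dimension dim_pos] by auto
  obtain zs where zs: "length zs = d" "set zs \<subseteq> forms n 1" "forms n (Suc (red n I)) \<subseteq> ext n I zs"
    by (rule red_attained[OF infinite_field I dimension gr])
  have zp: "set zs \<subseteq> polys n" using zs forms_polys by blast
  have EI: "ideal (ext n I zs) (poly_ring n)" by (rule ext_ideal[OF II zp])
  have "forms n t \<subseteq> ext n I zs" if "t \<ge> Suc (red n I)" for t
    using forms_upward[OF EI zs(3), of "t - Suc (red n I)"] that by simp
  hence fin: "finite_length n (ext n I zs)" unfolding finite_length_iff[OF EI] by blast
  note ind = reduction_independent[OF I zs(2,1) dim_pos ngr fin]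
  have proper: "1 \<notin> I"
  proof
    assume 1: "1 \<in> I"
    have "forms n t \<subseteq> I" for t using ideal_mult[OF II 1] forms_polys by fastforce
    hence "finite_length n I" using finite_length_iff[OF II] by blast
    thus False using growth_mono[OF growth_of_finite_length] ngr by blast
  qed
  have fd: "forms_of_degrees n a fs" unfolding degrees by (rule minimal_generators_degrees[OF generators proper])
  have Igen: "I = gen n (set fs)" using generators by (simp add: minimal_homogeneous_generators_def)
  have fp: "set fs \<subseteq> polys n" by (rule forms_of_degrees_polys[OF fd])
  have zd: "forms_of_degrees n (replicate d 1) zs" using forms_of_degrees_const[OF _ zs(2)] zs(1) by simp
  have h0: "hilb n (ext n I zs) 0 = 1"
  proof -
    have "I = ext n {0} fs"
      unfolding Igen ext_def using ideal_zero[OF gen_ideal[OF fp]] gen_superset[OF fp] fp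
      by (intro equalityI gen_mono gen_minimal gen_ideal[OF fp]) auto
    hence "ext n I zs = ext n {0} (fs @ zs)" using ext_ext[OF Z fp zp] by simp
    thus ?thesis using hilb_ext_0[OF forms_of_degrees_append[OF fd zd]] by simp
  qed
  note deg_bound = hilb_bound_of_degrees[OF infinite_field fd Igen descending zs(2,1) dim_pos ngr fin]
  have pos: "\<forall>x\<in>set a. x \<ge> 1" by (rule forms_of_degrees_pos[OF fd])
  have nontrivial: "d < n \<and> red n I \<ge> 1" if d2: "d \<ge> 2"
  proof -
    obtain e where e: "e \<in> set a" "e \<ge> 2" using nonlinear d2 by blast
    have nl: "\<not> forms n 1 \<subseteq> ext n I zs"
    proof
      assume "forms n 1 \<subseteq> ext n I zs"
      hence "I \<subseteq> gen n (I \<inter> forms n 1)"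
        by (rule linear_ideal_of_reduction_zero[OF infinite_field I zs(2,1) dim_pos ngr])
      hence "e < 2" using linear_minimal_generators[OF generators _ _ e(1)[unfolded degrees]] fd degrees by simp
      thus False using e(2) by simp
    qed
    have "red n I \<noteq> 0"
    proof
      assume "red n I = 0"
      thus False using zs(3) nl by simp
    qed
    moreover have "d \<noteq> n"
    proof
      assume "d = n"
      hence "hilbert_series n (ext n {0} zs) $ 1 = 0" using ind(3) by (simp add: fps_one_nth)
      hence "forms n 1 \<subseteq> ext n {0} zs" using hilb_eq_0_iff[OF ext_ideal[OF Z zp]] by simp
      moreover have "ext n {0} zs \<subseteq> ext n I zs"
        unfolding ext_def using ideal_zero[OF II] ideal_subset[OF II] zp by (intro gen_mono) auto
      ultimately show False using nl by blast
    qed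
    ultimately show ?thesis using ind(1) by simp
  qed
  have bound: "int (red n (lex_ideal n I)) \<le> int d * (e - 2) + 1"
    if e: "e \<ge> 1" "d \<ge> 2 \<longrightarrow> e \<ge> 2"
      and h: "\<And>t. t \<ge> 1 \<Longrightarrow> int t > int d * (e - 2) + 1 \<Longrightarrow> hilb n I t < (t + d) choose d" for e :: int
  proof -
    \<comment> \<open>The bound is nonnegative: for \<open>d = 1\<close> it is \<open>e - 1\<close>, for \<open>d \<ge> 2\<close> it is at least \<open>1\<close>.\<close>
    define r where "r = nat (int d * (e - 2) + 1)"
    have "int d * (e - 2) + 1 \<ge> 0"
    proof (cases "d \<ge> 2")
      case True
      thus ?thesis using e by simp
    next
      case False
      hence "d = 1" using dim_pos by simp
      thus ?thesis using e by simp
    qed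
    hence r: "int r = int d * (e - 2) + 1" by (simp add: r_def)
    have "hilb n I (Suc r) < (Suc r + d) choose d" using r by (intro h) auto
    hence "red n (lex_ideal n I) \<le> r" by (rule red_lex_le[OF infinite_field I dim_pos ind(1) gr ngr])
    thus ?thesis using r by simp
  qed
  show ?thesis
  proof
    show "int (red n (lex_ideal n I)) \<le> int d * (int ((red n I + n - d) choose (n - d)) - 2) + 1"
    proof (rule bound)
      have eq: "red n I + n - d = red n I + (n - d)" using ind(1) by simp
      show "1 \<le> int ((red n I + n - d) choose (n - d))" unfolding eq by (simp add: Suc_le_eq)
      show "2 \<le> d \<longrightarrow> 2 \<le> int ((red n I + n - d) choose (n - d))"
      proof
        assume "2 \<le> d"
        hence "1 + (n - d) \<le> red n I + (n - d)" "n - d \<ge> 1" using nontrivial by auto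
        hence "(1 + (n - d)) choose (n - d) \<le> (red n I + (n - d)) choose (n - d)" by (intro binomial_right_mono)
        moreover have "(1 + (n - d)) choose (n - d) = Suc (n - d)" by simp
        ultimately show "2 \<le> int ((red n I + n - d) choose (n - d))" unfolding eq using \<open>n - d \<ge> 1\<close> by simp
      qed
      show "hilb n I t < (t + d) choose d"
        if "t \<ge> 1" "int t > int d * (int ((red n I + n - d) choose (n - d)) - 2) + 1" for t
        by (rule hilb_bound_of_reduction_number[OF I h0 zs(2,1) dim_pos ngr zs(3) that])
    qed
    have prod: "(\<Prod>i<n - d. int (a ! i)) = int (prod_list (take (n - d) a))"
    proof -
      have "prod_list (take (n - d) a) = (\<Prod>i<n - d. a ! i)"
        using deg_bound(1) by (simp add: prod.list_conv_set_nth atLeast0LessThan)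
      thus ?thesis by simp
    qed
    show "int (red n (lex_ideal n I)) \<le> int d * ((\<Prod>i<n - d. int (a ! i)) - 2) + 1"
      unfolding prod
    proof (rule bound)
      have pos': "\<forall>x\<in>set (take (n - d) a). x \<ge> 1" using pos set_take_subset[of "n - d" a] by blast
      show "1 \<le> int (prod_list (take (n - d) a))" using prod_list_ge_1[OF pos'] by simp
      show "2 \<le> d \<longrightarrow> 2 \<le> int (prod_list (take (n - d) a))"
      proof
        assume d2: "2 \<le> d"
        obtain e where e: "e \<in> set a" "e \<ge> 2" using nonlinear d2 by blast
        then obtain b as where a: "a = b # as" by (cases a) auto
        have "b \<ge> 2" using descending e by (auto simp: a)
        obtain m where m: "n - d = Suc m" using nontrivial[OF d2] by (cases "n - d") auto
        have "prod_list (take m as) \<ge> 1" using pos' by (intro prod_list_ge_1) (simp add: a m)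
        hence "2 * 1 \<le> b * prod_list (take m as)" using \<open>b \<ge> 2\<close> by (rule mult_le_mono[rotated])
        hence "2 \<le> prod_list (take (n - d) a)" by (simp add: a m)
        hence "int 2 \<le> int (prod_list (take (n - d) a))" by (simp only: of_nat_le_iff)
        thus "2 \<le> int (prod_list (take (n - d) a))" by simp
      qed
    qed (rule deg_bound(2))
  qed
qed

end
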